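(* Let $R$ be a ring and let $\mathfrak{K} = (\mathbf{K}, \preccurlyeq)$ be an abstract elementary class of $R$-modules which is $\kappa$-local for some cardinal $\kappa \geq \mathrm{LS}(\mathfrak{K})$. Then: (1) there is $\xi > \kappa$ such that for every cardinal $\mu$ satisfying $\mu = \mu^{<\xi} + \sum\{2^{2^{\sigma}} : \sigma < \xi\}$, $\mathfrak{K}$ is almost $\mu$-stable; (2) if in addition $\mathfrak{K}$ has the amalgamation property and $\mu$ is as in (1), then $\mathfrak{K}$ is $\mu$-stable.
   Context: An abstract elementary class (AEC) $\mathfrak{K} = (\mathbf{K}, \preccurlyeq)$ is a class $\mathbf{K}$ of structures in a fixed vocabulary, closed under isomorphism, with a partial order $\preccurlyeq$ refining substructure, invariant under isomorphism, satisfying coherence, the Tarski–Vaught chain axioms and having a Löwenheim–Skolem number $\mathrm{LS}(\mathfrak{K})$; an AEC of $R$-modules is one whose members are $R$-modules (in the vocabulary of $R$-modules). Orbital types: for $N \in \mathbf{K}$, $A \subseteq N$ and a sequence $\bar b$ in $N$, $\mathrm{ortp}(\bar b/A;N)$ is the class of $(\bar b, A, N)$ modulo the transitive closure of the relation $E'$, where $(\bar b_1, A, N_1) E' (\bar b_2, A, N_2)$ iff there are $N \in \mathbf{K}$ and $\preccurlyeq$-embeddings $f_\ell : N_\ell \to N$ fixing $A$ pointwise with $f_1(\bar b_1) = f_2(\bar b_2)$. For $M \in \mathbf{K}$, $\mathcal{S}(M) = \{\mathrm{ortp}(b/M;N) : M \preccurlyeq N \in \mathbf{K}, b \in N\}$;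 for $p = \mathrm{ortp}(b/M;N)$ and $A \subseteq M$, $p \restriction A = \mathrm{ortp}(b/A;N)$. $\mathfrak{K}$ is $\kappa$-local if for every $M \in \mathbf{K}$ and $p \neq q \in \mathcal{S}(M)$ there is $M_0 \subseteq M$ with $|M_0| \leq \kappa$ and $p \restriction M_0 \neq q \restriction M_0$. $\mathfrak{K}$ is $\mu$-stable if $|\mathcal{S}(M)| \leq \mu$ for all $M \in \mathbf{K}$ with $|M| = \mu$. $\mathfrak{K}$ is almost $\mu$-stable if for all $M, N \in \mathbf{K}$ with $|M| = |N| = \mu$ and $M \preccurlyeq N$, the set $\mathcal{S}(M;N) = \{\mathrm{ortp}(c/M;N) : c \in N\}$ has cardinality $\leq \mu$. Amalgamation property: whenever $M \preccurlyeq N_1$, $M \preccurlyeq N_2$ in $\mathbf{K}$, there are $N \in \mathbf{K}$ and $\preccurlyeq$-embeddings $N_\ell \to N$ agreeing on $M$. *)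

theory Defs
  imports "HOL-Algebra.Ring" "HOL-Library.FuncSet"
begin

unbundle cardinal_syntax

section \<open>The set-theoretic universe and its cardinals\<close>

text \<open>
  HOL has no proper classes. All structures live on subsets of a type \<open>'u\<close> that plays the role of
  the class of all sets: a subset of \<open>'u\<close> counts as a set (rather than a proper class) iff its
  cardinality is smaller than that of \<open>'u\<close>, and the cardinality of \<open>'u\<close> is strongly inaccessible.
  A class of structures is then a set of structures with small carriers, and ``cardinal'' means
  a cardinal smaller than \<open>'u\<close>; every cardinal arithmetic operation used below stays below \<open>'u\<close>.
\<close>

definition set_universe :: "'u itself \<Rightarrow> bool" where
  "set_universe _ \<longleftrightarrow>
     natLeq <o |UNIV :: 'u set| \<and>
     regularCard |UNIV :: 'u set| \<and>
     (\<forall>A :: 'u set. |A| <o |UNIV :: 'u set| \<longrightarrow> |Pow A| <o |UNIV :: 'u set| )"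

definition cardinal :: "'u rel \<Rightarrow> bool" where
  "cardinal \<kappa> \<longleftrightarrow> Card_order \<kappa> \<and> \<kappa> <o |UNIV :: 'u set|"

text \<open>
  The cardinals below \<open>\<xi>\<close>, each represented exactly once: as the initial segment of \<open>\<xi>\<close> that is
  the corresponding initial ordinal.
\<close>

definition cardinals_below :: "'u rel \<Rightarrow> 'u rel set" where
  "cardinals_below \<xi> =
     {\<sigma>. Card_order \<sigma> \<and> (\<exists>a \<in> Field \<xi>. \<sigma> = Restr \<xi> (underS \<xi> a))}"

text \<open>\<open>\<mu>\<close> to the power \<open><\<xi>\<close>, as the sum of all \<open>\<mu>\<^sup>\<sigma>\<close>, \<open>\<sigma> < \<xi>\<close>; for infinite \<open>\<mu>\<close>, \<open>\<xi>\<close> this is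
  also the supremum.\<close>

definition power_less :: "'u rel \<Rightarrow> 'u rel \<Rightarrow> ('u rel \<times> ('u \<Rightarrow> 'u)) rel" where
  "power_less \<mu> \<xi> = |SIGMA \<sigma> : cardinals_below \<xi>. Field (\<mu> ^c \<sigma>)|"

definition sum_double_exp :: "'u rel \<Rightarrow> ('u rel \<times> (('u \<Rightarrow> bool) \<Rightarrow> bool)) rel" where
  "sum_double_exp \<xi> = |SIGMA \<sigma> : cardinals_below \<xi>. Field (ctwo ^c (ctwo ^c \<sigma>))|"


section \<open>Structures in the vocabulary of modules over a ring\<close>

text \<open>
  The operations are set-theoretic functions: total HOL functions that are \<open>undefined\<close> outside
  their domain. Hence two structures are equal iff they are equal as set-theoretic objects.
\<close>

record ('r, 'u) rstr =
  univ :: "'u set"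
  zer :: 'u
  pls :: "'u \<times> 'u \<Rightarrow> 'u"
  scl :: "'r \<times> 'u \<Rightarrow> 'u"

definition rstructure :: "('r, 'x) ring_scheme \<Rightarrow> ('r, 'u) rstr \<Rightarrow> bool" where
  "rstructure R M \<longleftrightarrow>
     |univ M| <o |UNIV :: 'u set| \<and>
     zer M \<in> univ M \<and>
     pls M \<in> univ M \<times> univ M \<rightarrow>\<^sub>E univ M \<and>
     scl M \<in> carrier R \<times> univ M \<rightarrow>\<^sub>E univ M"

definition substructure ::
  "('r, 'x) ring_scheme \<Rightarrow> ('r, 'u) rstr \<Rightarrow> ('r, 'u) rstr \<Rightarrow> bool" where
  "substructure R M N \<longleftrightarrow>
     rstructure R M \<and> rstructure R N \<and>
     univ M \<subseteq> univ N \<and>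
     zer M = zer N \<and>
     pls M = restrict (pls N) (univ M \<times> univ M) \<and>
     scl M = restrict (scl N) (carrier R \<times> univ M)"

definition rstr_iso ::
  "('r, 'x) ring_scheme \<Rightarrow> ('r, 'u) rstr \<Rightarrow> ('r, 'u) rstr \<Rightarrow> ('u \<Rightarrow> 'u) \<Rightarrow> bool" where
  "rstr_iso R M N f \<longleftrightarrow>
     rstructure R M \<and> rstructure R N \<and>
     bij_betw f (univ M) (univ N) \<and>
     f (zer M) = zer N \<and>
     (\<forall>x \<in> univ M. \<forall>y \<in> univ M. f (pls M (x, y)) = pls N (f x, f y)) \<and>
     (\<forall>a \<in> carrier R. \<forall>x \<in> univ M. f (scl M (a, x)) = scl N (a, f x))"

text \<open>The library's modules are over commutative rings only, so left modules are spelled out.\<close>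

definition left_module :: "('r, 'x) ring_scheme \<Rightarrow> ('r, 'u) rstr \<Rightarrow> bool" where
  "left_module R M \<longleftrightarrow>
     ring R \<and> rstructure R M \<and>
     comm_group \<lparr>carrier = univ M, mult = (\<lambda>x y. pls M (x, y)), one = zer M\<rparr> \<and>
     (\<forall>a \<in> carrier R. \<forall>x \<in> univ M. \<forall>y \<in> univ M.
        scl M (a, pls M (x, y)) = pls M (scl M (a, x), scl M (a, y))) \<and>
     (\<forall>a \<in> carrier R. \<forall>b \<in> carrier R. \<forall>x \<in> univ M.
        scl M (a \<oplus>\<^bsub>R\<^esub> b, x) = pls M (scl M (a, x), scl M (b, x))) \<and>
     (\<forall>a \<in> carrier R. \<forall>b \<in> carrier R. \<forall>x \<in> univ M.
        scl M (a \<otimes>\<^bsub>R\<^esub> b, x) = scl M (a, scl M (b, x))) \<and>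
     (\<forall>x \<in> univ M. scl M (\<one>\<^bsub>R\<^esub>, x) = x)"

text \<open>The union of a nonempty chain of substructures indexed by \<open>I\<close>.\<close>

definition rstr_Union ::
  "('r, 'x) ring_scheme \<Rightarrow> 'i set \<Rightarrow> ('i \<Rightarrow> ('r, 'u) rstr) \<Rightarrow> ('r, 'u) rstr" where
  "rstr_Union R I M =
     (let U = (\<Union>i \<in> I. univ (M i)) in
      \<lparr>univ = U,
       zer = (THE z. \<exists>i \<in> I. z = zer (M i)),
       pls = (\<lambda>p \<in> U \<times> U.
                THE z. \<exists>i \<in> I. p \<in> univ (M i) \<times> univ (M i) \<and> z = pls (M i) p),
       scl = (\<lambda>p \<in> carrier R \<times> U.
                THE z. \<exists>i \<in> I. p \<in> carrier R \<times> univ (M i) \<and> z = scl (M i) p)\<rparr>)"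


section \<open>Abstract elementary classes\<close>

record ('r, 'u) abstract_class =
  Models :: "('r, 'u) rstr set"
  sleq :: "('r, 'u) rstr \<Rightarrow> ('r, 'u) rstr \<Rightarrow> bool"

definition is_partial_order :: "('r, 'u) abstract_class \<Rightarrow> bool" where
  "is_partial_order K \<longleftrightarrow>
     (\<forall>M N. sleq K M N \<longrightarrow> M \<in> Models K \<and> N \<in> Models K) \<and>
     (\<forall>M \<in> Models K. sleq K M M) \<and>
     (\<forall>M N. sleq K M N \<longrightarrow> sleq K N M \<longrightarrow> M = N) \<and>
     (\<forall>M N P. sleq K M N \<longrightarrow> sleq K N P \<longrightarrow> sleq K M P)"

definition iso_invariant :: "('r, 'x) ring_scheme \<Rightarrow> ('r, 'u) abstract_class \<Rightarrow> bool" where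
  "iso_invariant R K \<longleftrightarrow>
     (\<forall>M N f. M \<in> Models K \<longrightarrow> rstr_iso R M N f \<longrightarrow> N \<in> Models K) \<and>
     (\<forall>M N M' N' f. sleq K M N \<longrightarrow> rstr_iso R N N' f \<longrightarrow> rstr_iso R M M' f \<longrightarrow> sleq K M' N')"

definition coherent :: "('r, 'x) ring_scheme \<Rightarrow> ('r, 'u) abstract_class \<Rightarrow> bool" where
  "coherent R K \<longleftrightarrow>
     (\<forall>M0 M1 M2. sleq K M0 M2 \<longrightarrow> sleq K M1 M2 \<longrightarrow> substructure R M0 M1 \<longrightarrow> sleq K M0 M1)"

text \<open>
  A chain of limit length: indexed by the field of a small nonempty well-order without a last
  element. Since every small well-order is isomorphic to one on a subset of \<open>'u\<close>, such index sets
  suffice.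
\<close>

definition limit_chain ::
  "('r, 'u) abstract_class \<Rightarrow> 'u rel \<Rightarrow> ('u \<Rightarrow> ('r, 'u) rstr) \<Rightarrow> bool" where
  "limit_chain K \<delta> M \<longleftrightarrow>
     Well_order \<delta> \<and> |Field \<delta>| <o |UNIV :: 'u set| \<and> Field \<delta> \<noteq> {} \<and>
     (\<forall>i \<in> Field \<delta>. \<exists>j. j \<noteq> i \<and> (i, j) \<in> \<delta>) \<and>
     (\<forall>i j. (i, j) \<in> \<delta> \<longrightarrow> sleq K (M i) (M j))"

definition tarski_vaught :: "('r, 'x) ring_scheme \<Rightarrow> ('r, 'u) abstract_class \<Rightarrow> bool" where
  "tarski_vaught R K \<longleftrightarrow>
     (\<forall>\<delta> M. limit_chain K \<delta> M \<longrightarrow>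
        rstr_Union R (Field \<delta>) M \<in> Models K \<and>
        (\<forall>i \<in> Field \<delta>. sleq K (M i) (rstr_Union R (Field \<delta>) M)) \<and>
        (\<forall>N. (\<forall>i \<in> Field \<delta>. sleq K (M i) N) \<longrightarrow> sleq K (rstr_Union R (Field \<delta>) M) N))"

text \<open>
  As usual, the candidates for the Loewenheim-Skolem number are required to be at least the size of
  the vocabulary plus \<open>\<aleph>\<^sub>0\<close>; the number itself is the least candidate and hence unique up to \<open>=o\<close>.
\<close>

definition ls_candidate ::
  "('r, 'x) ring_scheme \<Rightarrow> ('r, 'u) abstract_class \<Rightarrow> 'u rel \<Rightarrow> bool" where
  "ls_candidate R K \<chi> \<longleftrightarrow>
     cardinal \<chi> \<and> cinfinite \<chi> \<and> |carrier R| \<le>o \<chi> \<and>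
     (\<forall>M \<in> Models K. \<forall>A \<subseteq> univ M.
        \<exists>M0. sleq K M0 M \<and> A \<subseteq> univ M0 \<and> |univ M0| \<le>o |A| +c \<chi>)"

definition is_LS ::
  "('r, 'x) ring_scheme \<Rightarrow> ('r, 'u) abstract_class \<Rightarrow> 'u rel \<Rightarrow> bool" where
  "is_LS R K \<chi> \<longleftrightarrow>
     ls_candidate R K \<chi> \<and> (\<forall>\<nu>. ls_candidate R K \<nu> \<longrightarrow> \<chi> \<le>o \<nu>)"

definition AEC :: "('r, 'x) ring_scheme \<Rightarrow> ('r, 'u) abstract_class \<Rightarrow> bool" where
  "AEC R K \<longleftrightarrow>
     (\<forall>M \<in> Models K. rstructure R M) \<and>
     is_partial_order K \<and>
     (\<forall>M N. sleq K M N \<longrightarrow> substructure R M N) \<and>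
     iso_invariant R K \<and>
     coherent R K \<and>
     tarski_vaught R K \<and>
     (\<exists>\<chi>. is_LS R K \<chi>)"

definition AEC_of_modules :: "('r, 'x) ring_scheme \<Rightarrow> ('r, 'u) abstract_class \<Rightarrow> bool" where
  "AEC_of_modules R K \<longleftrightarrow> AEC R K \<and> (\<forall>M \<in> Models K. left_module R M)"

definition K_embedding ::
  "('r, 'x) ring_scheme \<Rightarrow> ('r, 'u) abstract_class \<Rightarrow> ('r, 'u) rstr \<Rightarrow> ('r, 'u) rstr
     \<Rightarrow> ('u \<Rightarrow> 'u) \<Rightarrow> bool" where
  "K_embedding R K M N f \<longleftrightarrow> (\<exists>M'. rstr_iso R M M' f \<and> sleq K M' N)"

definition amalgamation :: "('r, 'x) ring_scheme \<Rightarrow> ('r, 'u) abstract_class \<Rightarrow> bool" where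
  "amalgamation R K \<longleftrightarrow>
     (\<forall>M N1 N2. sleq K M N1 \<longrightarrow> sleq K M N2 \<longrightarrow>
        (\<exists>N f1 f2. N \<in> Models K \<and> K_embedding R K N1 N f1 \<and> K_embedding R K N2 N f2 \<and>
           (\<forall>x \<in> univ M. f1 x = f2 x)))"


section \<open>Orbital types\<close>

definition E_prime ::
  "('r, 'x) ring_scheme \<Rightarrow> ('r, 'u) abstract_class \<Rightarrow> ('u \<times> 'u set \<times> ('r, 'u) rstr) rel" where
  "E_prime R K =
     {((b1, A, N1), (b2, A, N2)) | b1 b2 A N1 N2.
        N1 \<in> Models K \<and> N2 \<in> Models K \<and> A \<subseteq> univ N1 \<and> A \<subseteq> univ N2 \<and>
        b1 \<in> univ N1 \<and> b2 \<in> univ N2 \<and>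
        (\<exists>N f1 f2. N \<in> Models K \<and> K_embedding R K N1 N f1 \<and> K_embedding R K N2 N f2 \<and>
           (\<forall>a \<in> A. f1 a = a \<and> f2 a = a) \<and> f1 b1 = f2 b2)}"

definition ortp ::
  "('r, 'x) ring_scheme \<Rightarrow> ('r, 'u) abstract_class \<Rightarrow> 'u \<Rightarrow> 'u set \<Rightarrow> ('r, 'u) rstr
     \<Rightarrow> ('u \<times> 'u set \<times> ('r, 'u) rstr) set" where
  "ortp R K b A N = (E_prime R K)\<^sup>+ `` {(b, A, N)}"

definition types_in ::
  "('r, 'x) ring_scheme \<Rightarrow> ('r, 'u) abstract_class \<Rightarrow> ('r, 'u) rstr \<Rightarrow> ('r, 'u) rstr
     \<Rightarrow> ('u \<times> 'u set \<times> ('r, 'u) rstr) set set" where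
  "types_in R K M N = {ortp R K c (univ M) N | c. c \<in> univ N}"

definition types_over ::
  "('r, 'x) ring_scheme \<Rightarrow> ('r, 'u) abstract_class \<Rightarrow> ('r, 'u) rstr
     \<Rightarrow> ('u \<times> 'u set \<times> ('r, 'u) rstr) set set" where
  "types_over R K M = {ortp R K b (univ M) N | b N. sleq K M N \<and> b \<in> univ N}"

definition type_restrict ::
  "('r, 'x) ring_scheme \<Rightarrow> ('r, 'u) abstract_class
     \<Rightarrow> ('u \<times> 'u set \<times> ('r, 'u) rstr) set \<Rightarrow> 'u set
     \<Rightarrow> ('u \<times> 'u set \<times> ('r, 'u) rstr) set" where
  "type_restrict R K p A =
     (THE q. \<exists>b B N. N \<in> Models K \<and> b \<in> univ N \<and> A \<subseteq> B \<and> B \<subseteq> univ N \<and>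
        p = ortp R K b B N \<and> q = ortp R K b A N)"

definition is_local ::
  "('r, 'x) ring_scheme \<Rightarrow> ('r, 'u) abstract_class \<Rightarrow> 'u rel \<Rightarrow> bool" where
  "is_local R K \<kappa> \<longleftrightarrow>
     (\<forall>M \<in> Models K. \<forall>p \<in> types_over R K M. \<forall>q \<in> types_over R K M. p \<noteq> q \<longrightarrow>
        (\<exists>M0 \<subseteq> univ M. |M0| \<le>o \<kappa> \<and> type_restrict R K p M0 \<noteq> type_restrict R K q M0))"

definition stable_in ::
  "('r, 'x) ring_scheme \<Rightarrow> ('r, 'u) abstract_class \<Rightarrow> 'u rel \<Rightarrow> bool" where
  "stable_in R K \<mu> \<longleftrightarrow>
     (\<forall>M \<in> Models K. |univ M| =o \<mu> \<longrightarrow> |types_over R K M| \<le>o \<mu>)"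

definition almost_stable_in ::
  "('r, 'x) ring_scheme \<Rightarrow> ('r, 'u) abstract_class \<Rightarrow> 'u rel \<Rightarrow> bool" where
  "almost_stable_in R K \<mu> \<longleftrightarrow>
     (\<forall>M N. M \<in> Models K \<and> N \<in> Models K \<and> |univ M| =o \<mu> \<and> |univ N| =o \<mu> \<and> sleq K M N \<longrightarrow>
        |types_in R K M N| \<le>o \<mu>)"


section \<open>Restriction of orbital types is well defined\<close>

lemma E_prime_sym:
  assumes "(s, t) \<in> E_prime R K"
  shows "(t, s) \<in> E_prime R K"
proof -
  obtain b1 b2 A N1 N2 N f1 f2 where
    st: "s = (b1, A, N1)" "t = (b2, A, N2)"
    and "N1 \<in> Models K" "N2 \<in> Models K" "A \<subseteq> univ N1" "A \<subseteq> univ N2"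
      "b1 \<in> univ N1" "b2 \<in> univ N2"
      "N \<in> Models K" "K_embedding R K N1 N f1" "K_embedding R K N2 N f2"
      "\<forall>a \<in> A. f2 a = a \<and> f1 a = a" "f2 b2 = f1 b1"
    using assms unfolding E_prime_def by auto
  then show ?thesis
    unfolding st E_prime_def by blast
qed

lemma ortp_eqI:
  assumes "(s, t) \<in> (E_prime R K)\<^sup>+"
  shows "(E_prime R K)\<^sup>+ `` {s} = (E_prime R K)\<^sup>+ `` {t}"
proof -
  have "sym ((E_prime R K)\<^sup>+)"
    by (rule sym_trancl, rule symI, rule E_prime_sym)
  then have "(t, s) \<in> (E_prime R K)\<^sup>+"
    using assms by (rule symD)
  then show ?thesis
    using assms unfolding Image_singleton by (blast intro: trancl_trans)
qed

lemma E_prime_mono: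
  assumes "(s, t) \<in> (E_prime R K)\<^sup>+" "A \<subseteq> fst (snd s)"
  shows "fst (snd t) = fst (snd s) \<and>
    ((fst s, A, snd (snd s)), (fst t, A, snd (snd t))) \<in> (E_prime R K)\<^sup>+"
proof -
  have one: "fst (snd t) = fst (snd s) \<and>
      ((fst s, A, snd (snd s)), (fst t, A, snd (snd t))) \<in> E_prime R K"
    if st: "(s, t) \<in> E_prime R K" and sub: "A \<subseteq> fst (snd s)" for s t
  proof -
    obtain b1 b2 B N1 N2 N f1 f2 where
      eqs: "s = (b1, B, N1)" "t = (b2, B, N2)"
      and *: "N1 \<in> Models K" "N2 \<in> Models K" "B \<subseteq> univ N1" "B \<subseteq> univ N2"
        "b1 \<in> univ N1" "b2 \<in> univ N2"
        "N \<in> Models K" "K_embedding R K N1 N f1" "K_embedding R K N2 N f2"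
        "\<forall>a \<in> B. f1 a = a \<and> f2 a = a" "f1 b1 = f2 b2"
      using st unfolding E_prime_def by auto
    have "A \<subseteq> B" using sub eqs by simp
    with * have "A \<subseteq> univ N1" "A \<subseteq> univ N2" "\<forall>a \<in> A. f1 a = a \<and> f2 a = a"
      by auto
    with * have "((b1, A, N1), (b2, A, N2)) \<in> E_prime R K"
      unfolding E_prime_def by blast
    then show ?thesis using eqs by simp
  qed
  from assms show ?thesis
  proof (induction rule: trancl_induct)
    case (base y)
    then show ?case using one by blast
  next
    case (step y z)
    then have IH: "fst (snd y) = fst (snd s)"
      "((fst s, A, snd (snd s)), (fst y, A, snd (snd y))) \<in> (E_prime R K)\<^sup>+"
      by simp_all
    with step.prems have "A \<subseteq> fst (snd y)" by simp
    from one[OF step.hyps(2) this] IH show ?case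
      by (simp add: trancl.trancl_into_trancl)
  qed
qed

lemma K_embedding_id:
  assumes "AEC R K" "N \<in> Models K"
  shows "K_embedding R K N N (\<lambda>x. x)"
  unfolding K_embedding_def
proof (intro exI conjI)
  show "rstr_iso R N N (\<lambda>x. x)"
    using assms by (auto simp: rstr_iso_def AEC_def bij_betw_def)
  show "sleq K N N"
    using assms by (auto simp: AEC_def is_partial_order_def)
qed

lemma type_restrict_ortp:
  assumes "AEC R K" "N \<in> Models K" "b \<in> univ N" "A \<subseteq> B" "B \<subseteq> univ N"
  shows "type_restrict R K (ortp R K b B N) A = ortp R K b A N"
  unfolding type_restrict_def
proof (rule the_equality)
  show "\<exists>b' B' N'. N' \<in> Models K \<and> b' \<in> univ N' \<and> A \<subseteq> B' \<and> B' \<subseteq> univ N' \<and>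
      ortp R K b B N = ortp R K b' B' N' \<and> ortp R K b A N = ortp R K b' A N'"
    using assms by blast
next
  fix q
  assume "\<exists>b' B' N'. N' \<in> Models K \<and> b' \<in> univ N' \<and> A \<subseteq> B' \<and> B' \<subseteq> univ N' \<and>
      ortp R K b B N = ortp R K b' B' N' \<and> q = ortp R K b' A N'"
  then obtain b' B' N' where p: "ortp R K b B N = ortp R K b' B' N'" "A \<subseteq> B'"
    and q: "q = ortp R K b' A N'" by blast
  have "((b, B, N), (b, B, N)) \<in> E_prime R K"
    using assms K_embedding_id[OF assms(1,2)] unfolding E_prime_def by blast
  then have "(b, B, N) \<in> ortp R K b B N"
    unfolding ortp_def by blast
  then have "((b', B', N'), (b, B, N)) \<in> (E_prime R K)\<^sup>+"
    using p(1) unfolding ortp_def by blast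
  from E_prime_mono[OF this, of A] p(2)
  have "((b', A, N'), (b, A, N)) \<in> (E_prime R K)\<^sup>+" by simp
  then show "q = ortp R K b A N"
    unfolding q ortp_def by (rule ortp_eqI)
qed

end

theory Submission
  imports Defs
begin

text \<open>
  Almost stability is trivial, because \<open>|N| = \<mu>\<close>. For stability, amalgamation gives a model \<open>N\<close>
  realising more than \<open>\<mu>\<close> types over \<open>M\<close>. By locality the type of \<open>c\<close> over \<open>M\<close> is determined by
  the types of the tuples \<open>(c, a)\<close>, where \<open>a\<close> ranges over the \<open>\<kappa>\<close>-tuples of \<open>M\<close>, and there is a
  bound on the number of such types that does not depend on \<open>N\<close>. So Shelah's non-splitting
  argument yields a half graph: tuples \<open>e\<^sub>i\<close> of \<open>N\<close>, indexed by a long well-order, such that the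
  type of \<open>(e\<^sub>i, e\<^sub>j)\<close> for \<open>i < j\<close> differs from that of \<open>(e\<^sub>j, e\<^sub>i)\<close>.

  This is impossible in modules. For \<open>l < i < j < k\<close> the affine combination \<open>(e\<^sub>j, e\<^sub>k) - (e\<^sub>l,
  e\<^sub>k) + (e\<^sub>l, e\<^sub>i)\<close> of increasing pairs is the decreasing pair \<open>(e\<^sub>j, e\<^sub>i)\<close>, and linear
  equations are preserved by affine combinations. The combination has a left inverse that is
  again an affine combination, so on sufficiently indiscernible families it also reflects linear
  equations. Moreover the left inverse can be chosen to have a left inverse of the same kind, and
  so on. Alternately enlarging the families to enumerations of models and applying these
  operators, one gets two interleaved chains of models with a common union; coherence then turns
  the swap of \<open>e\<^sub>i\<close> and \<open>e\<^sub>j\<close> into an isomorphism of \<open>\<preceq>\<close>-submodels of \<open>N\<close>. The indiscernibility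
  needed at each stage comes from the Erdos-Rado theorem; a stage is kept if it is realised by
  families of unbounded length, so that infinitely many stages can be performed although \<open>N\<close>
  changes.
\<close>


section \<open>Small sets\<close>

text \<open>Equal quantifier-free diagrams give an isomorphism but say nothing about \<preceq>: the
  affine image of an enumerated model is a substructure isomorphic to that model, and nothing makes
  it \<preceq> \<open>N\<close>. This obstacle forces infinitely many operators with left inverses.
  Each stage extends the image of the previous one to a model. Two stages up, operator and left
  inverse cancel, and the old coordinates again list a member of the old family, hence a model
  \<preceq> \<open>N\<close>. So \<preceq> is known between stages of equal parity and only
  inclusion between neighbours; the common union closes the gap. The diagrams of all stages are
  fixed once and for all, so the limit can be formed abstractly although no single \<open>N\<close>
  need carry all stages.

  The two summands of \<mu> serve the counting: if \<open>V\<close> indexes the half graph, \<mu> to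
  the power |V| bounds the sequences that are coded, and the double exponential of |V| bounds the
  functions on colour patterns. Hence \<xi> need only exceed a cardinal |V| that does not depend on
  \<mu>.\<close>

definition small_set :: "'u itself \<Rightarrow> 'a set \<Rightarrow> bool" where
  "small_set _ A \<longleftrightarrow> |A| <o |UNIV :: 'u set|"

locale universe =
  fixes u :: "'u itself"
  assumes universe: "set_universe u"
begin

text \<open>Smallness is measured against \<open>'u\<close> but asked of sets over every type, so
  that lists, functions, structures and sets of atoms can be bounded as well.\<close>

abbreviation small :: "'a set \<Rightarrow> bool" where
  "small \<equiv> small_set u"

lemmas small_def = small_set_def

text \<open>An initial well-order of \<open>'u\<close>: the whole is not small, every proper initial
  segment is. Its elements serve as ordinals, its segments as index sets.\<close>

definition lt :: "'u \<Rightarrow> 'u \<Rightarrow> bool" (infix \<open>\<prec>\<close> 50) where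
  "x \<prec> y \<longleftrightarrow> (x, y) \<in> |UNIV :: 'u set| - Id"

lemma infinite_UNIV_u: "infinite (UNIV :: 'u set)"
proof -
  have "natLeq \<le>o |UNIV :: 'u set|"
    by (rule ordLess_imp_ordLeq) (use universe in \<open>simp add: set_universe_def\<close>)
  then show ?thesis
    using infinite_iff_natLeq_ordLeq[of "UNIV :: 'u set"] by blast
qed

lemma cinfinite_UNIV_u: "Cinfinite |UNIV :: 'u set|"
  using infinite_UNIV_u card_of_Card_order by (simp add: cinfinite_def Field_card_of)

lemma small_mono: "small B \<Longrightarrow> A \<subseteq> B \<Longrightarrow> small A"
  unfolding small_def by (rule ordLeq_ordLess_trans[OF card_of_mono1])

lemma small_ordLeq: "small B \<Longrightarrow> |A| \<le>o |B| \<Longrightarrow> small A"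
  unfolding small_def by (rule ordLeq_ordLess_trans)

lemma small_image: "small A \<Longrightarrow> small (f ` A)"
  by (rule small_ordLeq[OF _ card_of_image])

lemma small_finite: "finite A \<Longrightarrow> small A"
  unfolding small_def
  by (rule finite_ordLess_infinite)
    (simp_all add: Field_card_of card_of_well_order_on infinite_UNIV_u)

lemma small_natLeq: "natLeq <o |UNIV :: 'u set|"
  using universe unfolding set_universe_def by blast

lemma small_nat: "small (UNIV :: nat set)"
  unfolding small_def by (rule ordIso_ordLess_trans[OF card_of_nat small_natLeq])

lemma small_copy:
  assumes "small A"
  obtains B :: "'u set" where "|A| =o |B|"
proof -
  have "|A| \<le>o |UNIV :: 'u set|"
    using assms ordLess_imp_ordLeq unfolding small_def by blast
  then obtain f :: "'a \<Rightarrow> 'u" where "inj_on f A"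
    unfolding card_of_ordLeq[symmetric] by blast
  then have "|A| =o |f ` A|"
    using card_of_ordIso inj_on_imp_bij_betw by blast
  then show ?thesis using that by blast
qed

text \<open>The universe hypothesis speaks of subsets of \<open>'u\<close> only, hence the detour
  through a copy.\<close>

lemma small_Pow: "small A \<Longrightarrow> small (Pow A)"
proof -
  assume "small A"
  then obtain B :: "'u set" where B: "|A| =o |B|" using small_copy by blast
  then have "small B"
    using \<open>small A\<close> ordIso_symmetric ordIso_ordLess_trans unfolding small_def by blast
  then have "small (Pow B)"
    using universe unfolding set_universe_def small_def by blast
  moreover have "|Pow A| =o |Pow B|"
  proof -
    obtain f where "bij_betw f A B" using B card_of_ordIso by blast
    then have "bij_betw ((`) f) (Pow A) (Pow B)" by (rule bij_betw_Pow)
    then show ?thesis using card_of_ordIso by blast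
  qed
  ultimately show ?thesis using ordIso_ordLess_trans unfolding small_def by blast
qed

lemma small_Un: "small A \<Longrightarrow> small B \<Longrightarrow> small (A \<union> B)"
  unfolding small_def using infinite_UNIV_u by (rule card_of_Un_ordLess_infinite)

lemma small_UN:
  assumes "small I" "\<And>i. i \<in> I \<Longrightarrow> small (A i)"
  shows "small (\<Union>i \<in> I. A i)"
proof -
  have "stable |UNIV :: 'u set|"
    using universe cinfinite_UNIV_u unfolding set_universe_def
    by (intro regularCard_stable) (auto simp: cinfinite_def)
  then show ?thesis using assms unfolding small_def by (intro stable_UNION) auto
qed

lemma small_Sigma:
  assumes "small I" "\<And>i. i \<in> I \<Longrightarrow> small (A i)"
  shows "small (SIGMA i : I. A i)"
proof -
  have "(SIGMA i : I. A i) = (\<Union>i \<in> I. Pair i ` A i)" by auto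
  then show ?thesis by (simp only:) (intro small_UN small_image assms)
qed

lemma small_Times: "small A \<Longrightarrow> small B \<Longrightarrow> small (A \<times> B)"
  by (rule small_Sigma)

lemma small_Func:
  assumes "small A" "small B"
  shows "small (Func A B)"
proof -
  \<comment> \<open>A member of \<open>Func A B\<close> is \<open>undefined\<close> off
    \<open>A\<close>, so its graph over \<open>A\<close> determines it.\<close>
  define gr where "gr f = (\<lambda>x. (x, f x)) ` A" for f :: "'a \<Rightarrow> 'b"
  have "inj_on gr (Func A B)"
  proof (rule inj_onI)
    fix f g assume fg: "f \<in> Func A B" "g \<in> Func A B" "gr f = gr g"
    show "f = g"
    proof
      fix x
      show "f x = g x"
      proof (cases "x \<in> A")
        case True
        then have "(x, f x) \<in> gr g" using fg(3) unfolding gr_def by blast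
        then show ?thesis unfolding gr_def by blast
      next
        case False
        then show ?thesis using fg(1,2) unfolding Func_def by simp
      qed
    qed
  qed
  moreover have "gr ` Func A B \<subseteq> Pow (A \<times> B)"
    unfolding gr_def Func_def by blast
  ultimately have "|Func A B| \<le>o |Pow (A \<times> B)|"
    unfolding card_of_ordLeq[symmetric] by blast
  then show ?thesis
    using small_ordLeq[OF small_Pow[OF small_Times[OF assms]]] by blast
qed

lemma small_lists: "small A \<Longrightarrow> small (lists A)"
proof -
  assume A: "small A"
  have "small {l. set l \<subseteq> A \<and> length l = n}" for n
  proof (induction n)
    case 0
    then show ?case by (auto intro: small_finite)
  next
    case (Suc n)
    have "{l. set l \<subseteq> A \<and> length l = Suc n} \<subseteq>
      (\<lambda>(x, l). x # l) ` (A \<times> {l. set l \<subseteq> A \<and> length l = n})"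
      by (auto simp: length_Suc_conv)
    then show ?case
      by (rule small_mono[OF small_image[OF small_Times[OF A Suc]]])
  qed
  moreover have "lists A = (\<Union>n \<in> UNIV. {l. set l \<subseteq> A \<and> length l = n})"
    by auto
  ultimately show ?thesis
    using small_UN[OF small_nat, of "\<lambda>n. {l. set l \<subseteq> A \<and> length l = n}"] by simp
qed

lemma lt_trans: "x \<prec> y \<Longrightarrow> y \<prec> z \<Longrightarrow> x \<prec> z"
  using card_of_Well_order[of "UNIV :: 'u set"]
  unfolding lt_def well_order_on_def linear_order_on_def partial_order_on_def preorder_on_def
    trans_def antisym_def by blast

lemma lt_total: "x \<noteq> y \<Longrightarrow> x \<prec> y \<or> y \<prec> x"
  using card_of_Well_order[of "UNIV :: 'u set"] Field_card_of[of "UNIV :: 'u set"]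
  unfolding lt_def well_order_on_def linear_order_on_def total_on_def by auto

lemma lt_irrefl [simp]: "\<not> x \<prec> x"
  by (simp add: lt_def)

lemma lt_asym: "x \<prec> y \<Longrightarrow> \<not> y \<prec> x"
  using lt_trans lt_irrefl by blast

lemma wf_lt: "wf {(x, y). x \<prec> y}"
proof -
  have "{(x, y). x \<prec> y} = |UNIV :: 'u set| - Id"
    unfolding lt_def by blast
  then show ?thesis
    using card_of_Well_order[of "UNIV :: 'u set"] unfolding well_order_on_def by simp
qed

lemma lt_induct [case_names less]:
  assumes "\<And>x. (\<And>y. y \<prec> x \<Longrightarrow> P y) \<Longrightarrow> P x"
  shows "P a"
  using wf_lt by (rule wf_induct_rule) (use assms in blast)

lemma lt_min:
  assumes "x \<in> A"
  shows "\<exists>z. z \<in> A \<and> (\<forall>y. y \<prec> z \<longrightarrow> y \<notin> A)"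
  using assms by (rule wfE_min[OF wf_lt]) blast

lemma below_eq_underS: "{y. y \<prec> x} = underS |UNIV :: 'u set| x"
  unfolding lt_def underS_def by blast

lemma small_below: "small {y. y \<prec> x}"
  unfolding below_eq_underS small_def
  by (rule card_of_underS[OF card_of_Card_order]) (simp add: Field_card_of)

text \<open>A segment as large as the power set of \<open>A\<close> exists, because
  \<open>|Pow A|\<close> is below \<open>|UNIV|\<close>; Cantor then makes the inequality
  strict.\<close>

lemma small_ordLess_below:
  assumes "small A"
  obtains x where "|A| <o |{y. y \<prec> x}|"
proof -
  obtain B :: "'u set" where B: "|Pow A| =o |B|"
    using small_copy[OF small_Pow[OF assms]] .
  have "|B| <o |UNIV :: 'u set|"
    using small_Pow[OF assms] ordIso_ordLess_trans[OF ordIso_symmetric[OF B]]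
    unfolding small_def by blast
  then obtain x where "|B| =o Restr |UNIV :: 'u set| (underS |UNIV :: 'u set| x)"
    using ordLess_iff_ordIso_Restr[OF card_of_Well_order[of "UNIV :: 'u set"] card_of_Well_order[of B]]
    by (simp only: Field_card_of) blast
  then have "|Field |B| | =o |Field (Restr |UNIV :: 'u set| (underS |UNIV :: 'u set| x))|"
    by (rule card_of_cong)
  moreover have "Field (Restr |UNIV :: 'u set| (underS |UNIV :: 'u set| x)) \<subseteq> {y. y \<prec> x}"
    unfolding below_eq_underS by (auto simp: Field_def)
  ultimately have "|B| \<le>o |{y. y \<prec> x}|"
    unfolding Field_card_of by (rule ordIso_ordLeq_trans[OF _ card_of_mono1])
  then have "|A| <o |{y. y \<prec> x}|"
    using ordLess_ordLeq_trans[OF ordLess_ordIso_trans[OF card_of_Pow[of A] B]] by blast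
  then show ?thesis using that by blast
qed

end


section \<open>A partition theorem for increasing tuples\<close>

context universe
begin

definition inc :: "'u set \<Rightarrow> nat \<Rightarrow> 'u list set" where
  "inc W n = {l. sorted_wrt (\<prec>) l \<and> set l \<subseteq> W \<and> length l = n}"

lemma inc_mono: "W' \<subseteq> W \<Longrightarrow> inc W' n \<subseteq> inc W n"
  unfolding inc_def by blast

lemma inc_0 [simp]: "inc W 0 = {[]}"
  unfolding inc_def by auto

lemma inc_snoc: "l @ [x] \<in> inc W (Suc n) \<longleftrightarrow> l \<in> inc {v \<in> W. v \<prec> x} n \<and> x \<in> W"
  unfolding inc_def by (auto simp: sorted_wrt_append)

lemma inc_Suc:
  assumes "l \<in> inc W (Suc n)"
  obtains w x where "l = w @ [x]" "w \<in> inc {v \<in> W. v \<prec> x} n" "x \<in> W"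
proof -
  have "length l = Suc n" using assms unfolding inc_def by simp
  then obtain w x where l: "l = w @ [x]" by (metis length_Suc_conv_rev)
  show thesis using that[OF l] assms unfolding l inc_snoc by blast
qed

text \<open>
  The Erdos-Rado tree of a colouring: \<open>prec F W n z\<close> is the set of predecessors of \<open>z\<close>, built
  greedily from below so that every colour \<open>F (l @ [y])\<close> with \<open>y\<close> a predecessor agrees with \<open>F (l
  @ [z])\<close>.
\<close>

definition prec :: "('u list \<Rightarrow> 'q) \<Rightarrow> 'u set \<Rightarrow> nat \<Rightarrow> 'u \<Rightarrow> 'u set" where
  "prec F W n z = {y. wfrec {(x, y). x \<prec> y}
     (\<lambda>g y. y \<prec> z \<and> y \<in> W \<and> (\<forall>l \<in> inc {v. v \<prec> y \<and> g v} n. F (l @ [y]) = F (l @ [z]))) y}"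

lemma prec_iff:
  "y \<in> prec F W n z \<longleftrightarrow>
    y \<prec> z \<and> y \<in> W \<and> (\<forall>l \<in> inc {v \<in> prec F W n z. v \<prec> y} n. F (l @ [y]) = F (l @ [z]))"
proof -
  let ?H = "\<lambda>g y. y \<prec> z \<and> y \<in> W \<and> (\<forall>l \<in> inc {v. v \<prec> y \<and> g v} n. F (l @ [y]) = F (l @ [z]))"
  let ?R = "{(x, y). x \<prec> y}"
  have "wfrec ?R ?H y = ?H (cut (wfrec ?R ?H) ?R y) y"
    by (rule wfrec[OF wf_lt])
  moreover have "{v. v \<prec> y \<and> cut (wfrec ?R ?H) ?R y v} = {v. v \<prec> y \<and> wfrec ?R ?H v}"
    by (auto simp: cut_def)
  ultimately have "wfrec ?R ?H y = ?H (wfrec ?R ?H) y"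
    by simp
  moreover have "{v. v \<prec> y \<and> wfrec ?R ?H v} = {v \<in> prec F W n z. v \<prec> y}"
    unfolding prec_def by blast
  ultimately show ?thesis
    unfolding prec_def mem_Collect_eq by simp
qed

lemma prec_lt: "y \<in> prec F W n z \<Longrightarrow> y \<prec> z"
  and prec_in: "y \<in> prec F W n z \<Longrightarrow> y \<in> W"
  and prec_col: "y \<in> prec F W n z \<Longrightarrow> l \<in> inc {v \<in> prec F W n z. v \<prec> y} n \<Longrightarrow>
    F (l @ [y]) = F (l @ [z])"
  using prec_iff[of y F W n z] by blast+

text \<open>The greedy constructions for \<open>y\<close> and for \<open>z\<close> agree below
  \<open>y\<close>, since \<open>y\<close> has the colours of \<open>z\<close> over its
  predecessors. This makes \<open>prec\<close> a tree order.\<close>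

lemma prec_prec:
  assumes y: "y \<in> prec F W n z"
  shows "prec F W n y = {v \<in> prec F W n z. v \<prec> y}"
proof -
  have "v \<prec> y \<longrightarrow> (v \<in> prec F W n y \<longleftrightarrow> v \<in> prec F W n z)" for v
  proof (induction v rule: lt_induct)
    case (less v)
    show ?case
    proof
      assume vy: "v \<prec> y"
      have "{x \<in> prec F W n y. x \<prec> v} = {x \<in> prec F W n z. x \<prec> v}"
        using less vy lt_trans by blast
      moreover have "F (l @ [y]) = F (l @ [z])" if "l \<in> inc {x \<in> prec F W n z. x \<prec> v} n" for l
      proof -
        have "{x \<in> prec F W n z. x \<prec> v} \<subseteq> {x \<in> prec F W n z. x \<prec> y}"
          using vy lt_trans by blast
        then show ?thesis using that prec_col[OF y] inc_mono by blast
      qed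
      ultimately show "v \<in> prec F W n y \<longleftrightarrow> v \<in> prec F W n z"
        using prec_iff[of v F W n y] prec_iff[of v F W n z] vy lt_trans[OF vy prec_lt[OF y]]
        by auto
    qed
  qed
  then show ?thesis using prec_lt by blast
qed

text \<open>If \<open>b \<prec> b'\<close>, the greedy rule for \<open>b'\<close> would admit
  \<open>b\<close>, because both have the same colours over their common predecessors.\<close>

lemma prec_unique:
  assumes "b \<in> W" "b' \<in> W" "prec F W n b = prec F W n b'"
    and "\<And>l. l \<in> inc (prec F W n b) n \<Longrightarrow> F (l @ [b]) = F (l @ [b'])"
  shows "b = b'"
proof -
  have False if "b \<prec> b'" "b \<in> W" "prec F W n b = prec F W n b'"
    "\<And>l. l \<in> inc (prec F W n b) n \<Longrightarrow> F (l @ [b]) = F (l @ [b'])" for b b'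
  proof -
    have "F (l @ [b]) = F (l @ [b'])" if "l \<in> inc {v \<in> prec F W n b'. v \<prec> b} n" for l
    proof -
      have "{v \<in> prec F W n b'. v \<prec> b} \<subseteq> prec F W n b" using \<open>prec F W n b = prec F W n b'\<close> by blast
      from inc_mono[OF this, of n] that show ?thesis
        using \<open>\<And>l. l \<in> inc (prec F W n b) n \<Longrightarrow> F (l @ [b]) = F (l @ [b'])\<close> by blast
    qed
    then have "b \<in> prec F W n b'"
      using that(1,2) prec_iff[of b F W n b'] by blast
    then have "b \<prec> b" using that(3) prec_lt by blast
    then show False by simp
  qed
  from this[of b b'] this[of b' b] show ?thesis
    using assms lt_total by metis
qed

text \<open>The height of \<open>z\<close> in the tree, as an element of \<open>'u\<close>: the
  least one that is not the height of a predecessor.\<close>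

definition lev :: "('u list \<Rightarrow> 'q) \<Rightarrow> 'u set \<Rightarrow> nat \<Rightarrow> 'u \<Rightarrow> 'u" where
  "lev F W n = wfrec {(x, y). x \<prec> y}
     (\<lambda>g z. SOME a. a \<notin> g ` prec F W n z \<and> (\<forall>a'. a' \<prec> a \<longrightarrow> a' \<in> g ` prec F W n z))"

lemma lev:
  "lev F W n z \<notin> lev F W n ` prec F W n z"
  "a \<prec> lev F W n z \<Longrightarrow> a \<in> lev F W n ` prec F W n z"
proof -
  let ?H = "\<lambda>g z. SOME a. a \<notin> g ` prec F W n z \<and> (\<forall>a'. a' \<prec> a \<longrightarrow> a' \<in> g ` prec F W n z)"
  let ?R = "{(x, y). x \<prec> y}"
  have "lev F W n z = ?H (cut (lev F W n) ?R z) z"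
    unfolding lev_def by (rule wfrec[OF wf_lt])
  moreover have "cut (lev F W n) ?R z ` prec F W n z = lev F W n ` prec F W n z"
    by (rule image_cong) (auto simp: cut_def dest: prec_lt)
  ultimately have eq: "lev F W n z = ?H (lev F W n) z" by simp
  \<comment> \<open>A missing value exists because the predecessors form a small set and
    \<open>'u\<close> is not small.\<close>
  have "prec F W n z \<subseteq> {y. y \<prec> z}" using prec_lt by blast
  then have "small (lev F W n ` prec F W n z)"
    using small_mono[OF small_below] small_image by blast
  then have "lev F W n ` prec F W n z \<noteq> UNIV"
    using ordLess_irreflexive[of "|UNIV :: 'u set|"] unfolding small_def by metis
  then obtain x where "x \<in> - (lev F W n ` prec F W n z)" by blast
  from lt_min[OF this] have "\<exists>a. a \<notin> lev F W n ` prec F W n z \<and> (\<forall>a'. a' \<prec> a \<longrightarrow>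
      a' \<in> lev F W n ` prec F W n z)"
    by blast
  from someI_ex[OF this]
  show "lev F W n z \<notin> lev F W n ` prec F W n z"
    "a \<prec> lev F W n z \<Longrightarrow> a \<in> lev F W n ` prec F W n z"
    unfolding eq[symmetric] by blast+
qed

lemma lev_mono:
  assumes "y \<in> prec F W n z"
  shows "lev F W n y \<prec> lev F W n z"
proof -
  have "lev F W n y \<noteq> lev F W n z" 
    using lev(1)[of F W n z] imageI[OF assms, of "lev F W n"] by metis
  moreover have "\<not> lev F W n z \<prec> lev F W n y"
  proof
    assume "lev F W n z \<prec> lev F W n y"
    then have "lev F W n z \<in> lev F W n ` prec F W n y" by (rule lev(2))
    then show False using lev(1)[of F W n z] unfolding prec_prec[OF assms] by blast
  qed
  ultimately show ?thesis using lt_total by blast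
qed

lemma lev_inj: "inj_on (lev F W n) (prec F W n z)"
proof (rule inj_onI, rule ccontr)
  fix x y assume xy: "x \<in> prec F W n z" "y \<in> prec F W n z" "lev F W n x = lev F W n y" "x \<noteq> y"
  from xy(4) have "x \<prec> y \<or> y \<prec> x" by (rule lt_total)
  then have "x \<in> prec F W n y \<or> y \<in> prec F W n x"
    using xy(1,2) prec_prec[OF xy(1)] prec_prec[OF xy(2)] by blast
  then show False using lev_mono xy(3) lt_irrefl by metis
qed

text \<open>A node is coded by its height and by the colours over its predecessors, where the
  predecessors are named by their heights. Going up two branches with the same code, nodes of equal
  height coincide by \<open>prec_unique\<close>.\<close>

lemma prec_code_inj:
  assumes z: "z \<in> W" "z' \<in> W" and le: "lev F W n z = lev F W n z'"
    and col: "\<And>l l'. l \<in> inc (prec F W n z) n \<Longrightarrow> l' \<in> inc (prec F W n z') n \<Longrightarrow>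
      map (lev F W n) l = map (lev F W n) l' \<Longrightarrow> F (l @ [z]) = F (l' @ [z'])"
  shows "z = z'"
proof -
  have sub: "b \<in> prec F W n z'"
    if b: "b \<in> prec F W n z" and le: "lev F W n z = lev F W n z'"
      and col: "\<And>l l'. l \<in> inc (prec F W n z) n \<Longrightarrow> l' \<in> inc (prec F W n z') n \<Longrightarrow>
      map (lev F W n) l = map (lev F W n) l' \<Longrightarrow> F (l @ [z]) = F (l' @ [z'])" for b z z'
    using b
  proof (induction b rule: lt_induct)
    case (less b)
    let ?P = "prec F W n" and ?lev = "lev F W n"
    have "?lev b \<in> ?lev ` ?P z'"
      using lev_mono[OF less.prems] le lev(2)[of "?lev b" F W n z'] by simp
    then obtain b' where b': "b' \<in> ?P z'" "?lev b' = ?lev b" by auto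
    have sub: "?P b \<subseteq> ?P z'" using less prec_prec[OF less.prems] by blast
    have sub': "?P b' \<subseteq> ?P z'" using prec_prec[OF b'(1)] by blast
    have img: "?lev ` ?P b = ?lev ` ?P b'"
    proof -
      have "?lev ` ?P x = {a. a \<prec> ?lev x}" for x
        using lev_mono[of _ F W n x] lev(2)[of _ F W n x] by auto
      then show ?thesis using b'(2) by simp
    qed
    have Pb: "?P b = ?P b'"
      using inj_on_image_eq_iff[OF lev_inj[of F W n z'] sub sub'] img by blast
    have "b = b'"
    proof (rule prec_unique)
      show "b \<in> W" "b' \<in> W" using prec_in less.prems b'(1) by blast+
      show "?P b = ?P b'" by (rule Pb)
      fix l assume l: "l \<in> inc (?P b) n"
      then have "F (l @ [b]) = F (l @ [z])"
        using prec_col[OF less.prems] prec_prec[OF less.prems] by metis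
      moreover have "F (l @ [b']) = F (l @ [z'])"
        using l prec_col[OF b'(1)] prec_prec[OF b'(1)] Pb by metis
      moreover have "F (l @ [z]) = F (l @ [z'])"
      proof (rule col)
        show "l \<in> inc (?P z) n" using l prec_prec[OF less.prems] inc_mono[of "?P b" "?P z"] by blast
        show "l \<in> inc (?P z') n" using l sub inc_mono[OF sub] by blast
      qed simp
      ultimately show "F (l @ [b]) = F (l @ [b'])" by simp
    qed
    then show ?case using b'(1) by simp
  qed
  have P: "prec F W n z = prec F W n z'"
  proof
    show "prec F W n z \<subseteq> prec F W n z'"
      using sub[OF _ le col] by blast
    show "prec F W n z' \<subseteq> prec F W n z"
    proof
      fix b assume b: "b \<in> prec F W n z'"
      show "b \<in> prec F W n z"
        by (rule sub[OF b le[symmetric]]) (use col in metis)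
    qed
  qed
  show ?thesis
    by (rule prec_unique[OF z P]) (use col P in simp)
qed

text \<open>Either some node has at least \<open>|?B|\<close> predecessors, and they form
  \<open>W1\<close>, or all heights stay below \<open>a0\<close>. In the second case the coding of
  nodes injects \<open>W\<close> into a set smaller than \<open>S'\<close>.\<close>

lemma end_homogeneous:
  fixes S :: "'u set" and Q :: "'q set"
  assumes "small S" "small Q"
  obtains S' :: "'u set" where "small S'"
    "\<And>W F. |S'| \<le>o |W| \<Longrightarrow> F ` inc W (Suc n) \<subseteq> Q \<Longrightarrow>
      \<exists>z \<in> W. \<exists>W1 \<subseteq> {v \<in> W. v \<prec> z}. |S| \<le>o |W1| \<and>
        (\<forall>l x. l @ [x] \<in> inc W1 (Suc n) \<longrightarrow> F (l @ [x]) = F (l @ [z]))"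
proof -
  obtain a0 where a0: "|S| <o |{y. y \<prec> a0}|"
    using small_ordLess_below[OF assms(1)] .
  let ?B = "{y. y \<prec> a0}"
  \<comment> \<open>The codes: a height below \<open>a0\<close>, and a colour for every list of
    heights, with \<open>None\<close> for lists that do not come from an increasing tuple of
    predecessors.\<close>
  define D where "D = ?B \<times> Func (lists ?B) (insert None (Some ` Q))"
  have "small D" unfolding D_def
    by (intro small_Times small_Func small_lists small_below)
      (use small_Un[OF small_finite[of "{None}"] small_image[OF assms(2), of Some]] in simp)
  then obtain x where x: "|D| <o |{y. y \<prec> x}|" by (rule small_ordLess_below)
  let ?S' = "{y. y \<prec> x}"
  show thesis
  proof (rule that[of ?S'])
    show "small ?S'" by (rule small_below)
    fix W and F :: "'u list \<Rightarrow> 'q"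
    assume W: "|?S'| \<le>o |W|" and F: "F ` inc W (Suc n) \<subseteq> Q"
    show "\<exists>z \<in> W. \<exists>W1 \<subseteq> {v \<in> W. v \<prec> z}. |S| \<le>o |W1| \<and>
        (\<forall>l x. l @ [x] \<in> inc W1 (Suc n) \<longrightarrow> F (l @ [x]) = F (l @ [z]))"
    proof (cases "\<exists>z \<in> W. |?B| \<le>o |prec F W n z|")
      case True
      then obtain z where z: "z \<in> W" "|?B| \<le>o |prec F W n z|" by blast
      then have "|S| \<le>o |prec F W n z|"
        using a0 ordLess_imp_ordLeq ordLeq_transitive by blast
      moreover have "prec F W n z \<subseteq> {v \<in> W. v \<prec> z}" using prec_in prec_lt by blast
      moreover have "F (l @ [x]) = F (l @ [z])" if "l @ [x] \<in> inc (prec F W n z) (Suc n)" for l x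
        using that unfolding inc_snoc by (blast intro: prec_col)
      ultimately show ?thesis using z(1) by blast
    next
      case False
      let ?P = "prec F W n" and ?lev = "lev F W n"
      have lev_lt: "?lev z \<prec> a0" if "z \<in> W" for z
      proof (rule ccontr)
        assume "\<not> ?lev z \<prec> a0"
        then have "?B \<subseteq> {a. a \<prec> ?lev z}" using lt_total[of "?lev z" a0] lt_trans by blast
        also have "\<dots> \<subseteq> ?lev ` ?P z" using lev(2)[of _ F W n z] by blast
        finally have "|?B| \<le>o |?P z|"
          using card_of_mono1 card_of_image ordLeq_transitive by blast
        then show False using False that by blast
      qed
      define G where "G z = (\<lambda>l. if l \<in> lists ?B
          then if \<exists>w \<in> inc (?P z) n. l = map ?lev w
            then Some (F (inv_into (lists (?P z)) (map ?lev) l @ [z])) else None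
          else undefined)" for z
      have inv: "inv_into (lists (?P z)) (map ?lev) (map ?lev w) = w" if "w \<in> inc (?P z) n" for w z
      proof (rule inv_into_f_f)
        show "inj_on (map ?lev) (lists (?P z))"
          using lev_inj by (rule inj_on_map_lists)
        show "w \<in> lists (?P z)" using that unfolding inc_def by auto
      qed
      have lists: "map ?lev w \<in> lists ?B" if "w \<in> inc (?P z) n" "z \<in> W" for w z
        using that lev_lt[OF that(2)] lev_mono[of _ F W n z] lt_trans
            unfolding inc_def by auto blast
      have G: "G z (map ?lev w) = Some (F (w @ [z]))" if "w \<in> inc (?P z) n" "z \<in> W" for w z
        unfolding G_def using lists[OF that] inv[OF that(1)] that(1) by auto
      have "inj_on (\<lambda>z. (?lev z, G z)) W"
      proof (rule inj_onI)
        fix z z' assume zz: "z \<in> W" "z' \<in> W" "(?lev z, G z) = (?lev z', G z')"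
        show "z = z'"
        proof (rule prec_code_inj[OF zz(1,2)])
          show "?lev z = ?lev z'" using zz(3) by simp
          fix l l' assume l: "l \<in> inc (?P z) n" "l' \<in> inc (?P z') n" "map ?lev l = map ?lev l'"
          then show "F (l @ [z]) = F (l' @ [z'])"
            using G[OF l(1) zz(1)] G[OF l(2) zz(2)] zz(3) by simp
        qed
      qed
      moreover have "(\<lambda>z. (?lev z, G z)) ` W \<subseteq> D"
      proof
        fix d assume "d \<in> (\<lambda>z. (?lev z, G z)) ` W"
        then obtain z where z: "z \<in> W" "d = (?lev z, G z)" by blast
        have "F (w @ [z]) \<in> Q" if "w \<in> inc (?P z) n" for w
        proof -
          have "?P z \<subseteq> {v \<in> W. v \<prec> z}" using prec_in prec_lt by blast
          then have "w @ [z] \<in> inc W (Suc n)" unfolding inc_snoc using z(1) that inc_mono by blast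
          then show ?thesis using F by blast
        qed
        then have "G z \<in> Func (lists ?B) (insert None (Some ` Q))"
          unfolding Func_def G_def using inv by auto
        then show "d \<in> D" unfolding D_def z(2) using lev_lt[OF z(1)] by blast
      qed
      ultimately have "|W| \<le>o |D|" unfolding card_of_ordLeq[symmetric] by blast
      then have "|W| <o |W|" using x W ordLeq_ordLess_trans ordLess_ordLeq_trans by blast
      then show ?thesis using ordLess_irreflexive by blast
    qed
  qed
qed

text \<open>On an end-homogeneous set with end point \<open>z\<close>, a colouring of tuples of
  length \<open>n + 1\<close> becomes the colouring \<open>F (l @ [z])\<close> of tuples of length
  \<open>n\<close>. Only smallness of the bound matters, so no explicit exponentials are
  tracked.\<close>

lemma erdos_rado:
  fixes S :: "'u set" and Q :: "'q set"
  assumes "small S" "small Q"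
  shows "\<exists>S' :: 'u set. small S' \<and>
    (\<forall>W F. |S'| \<le>o |W| \<longrightarrow> F ` inc W n \<subseteq> Q \<longrightarrow>
      (\<exists>W' \<subseteq> W. |S| \<le>o |W'| \<and> (\<exists>c. \<forall>l \<in> inc W' n. F l = c)))"
proof (induction n)
  case 0
  then show ?case using assms(1) by (intro exI[of _ S]) auto
next
  case (Suc n)
  then obtain S1 :: "'u set" where S1: "small S1"
    "\<And>W F. |S1| \<le>o |W| \<Longrightarrow> F ` inc W n \<subseteq> Q \<Longrightarrow>
      (\<exists>W' \<subseteq> W. |S| \<le>o |W'| \<and> (\<exists>c. \<forall>l \<in> inc W' n. F l = c))" by blast
  obtain S' :: "'u set" where S': "small S'"
    "\<And>W F. |S'| \<le>o |W| \<Longrightarrow> F ` inc W (Suc n) \<subseteq> Q \<Longrightarrow>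
      \<exists>z \<in> W. \<exists>W1 \<subseteq> {v \<in> W. v \<prec> z}. |S1| \<le>o |W1| \<and>
        (\<forall>l x. l @ [x] \<in> inc W1 (Suc n) \<longrightarrow> F (l @ [x]) = F (l @ [z]))"
    using end_homogeneous[OF S1(1) assms(2)] by blast
  show ?case
  proof (rule exI[of _ S'], intro conjI allI impI)
    show "small S'" by (rule S'(1))
    fix W F assume W: "|S'| \<le>o |W|" "F ` inc W (Suc n) \<subseteq> Q"
    obtain z W1 where z: "z \<in> W" "W1 \<subseteq> {v \<in> W. v \<prec> z}" "|S1| \<le>o |W1|"
      "\<And>l x. l @ [x] \<in> inc W1 (Suc n) \<Longrightarrow> F (l @ [x]) = F (l @ [z])"
      using S'(2)[OF W] by blast
    have "l @ [z] \<in> inc W (Suc n)" if "l \<in> inc W1 n" for l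
      unfolding inc_snoc using that z(1) inc_mono[OF z(2)] by blast
    then have "(\<lambda>l. F (l @ [z])) ` inc W1 n \<subseteq> Q" using W(2) by blast
    from S1(2)[OF z(3) this] obtain W' c where W': "W' \<subseteq> W1" "|S| \<le>o |W'|"
      "\<And>l. l \<in> inc W' n \<Longrightarrow> F (l @ [z]) = c" by blast
    have "F l = c" if l: "l \<in> inc W' (Suc n)" for l
    proof -
      from l obtain w x where w: "l = w @ [x]" "w \<in> inc {v \<in> W'. v \<prec> x} n" "x \<in> W'"
        by (rule inc_Suc)
      have "w @ [x] \<in> inc W1 (Suc n)" using l W'(1) inc_mono unfolding w(1) by blast
      moreover have "w \<in> inc W' n" using w(2) inc_mono[of "{v \<in> W'. v \<prec> x}" W'] by blast
      ultimately show ?thesis using z(4) W'(3) w(1) by simp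
    qed
    moreover have "W' \<subseteq> W" using W'(1) z(2) by blast
    ultimately show "\<exists>W' \<subseteq> W. |S| \<le>o |W'| \<and> (\<exists>c. \<forall>l \<in> inc W' (Suc n). F l = c)"
      using W'(2) by blast
  qed
qed

text \<open>A pigeonhole over the colours: if each colour \<open>q\<close> failed from some size
  \<open>S q\<close> on, the union of these sets would still be small, and Erdos-Rado for that size
  yields a colour that does not fail. The object \<open>x\<close> may vary with the size; the colour
  may not.\<close>

lemma homogenize:
  fixes Q :: "'q set" and \<Phi> :: "'x \<Rightarrow> 'u set \<Rightarrow> bool" and col :: "'x \<Rightarrow> 'u list \<Rightarrow> 'q"
  assumes shrink: "\<And>x W W'. \<Phi> x W \<Longrightarrow> W' \<subseteq> W \<Longrightarrow> \<Phi> x W'"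
    and large: "\<And>S :: 'u set. small S \<Longrightarrow> \<exists>x W. \<Phi> x W \<and> |S| \<le>o |W|"
    and col: "\<And>x W l. \<Phi> x W \<Longrightarrow> l \<in> inc W n \<Longrightarrow> col x l \<in> Q"
    and Q: "small Q"
  shows "\<exists>q. \<forall>S :: 'u set. small S \<longrightarrow>
    (\<exists>x W. \<Phi> x W \<and> |S| \<le>o |W| \<and> (\<forall>l \<in> inc W n. col x l = q))"
proof (rule ccontr)
  assume "\<not> ?thesis"
  then have "\<forall>q. \<exists>S :: 'u set. small S \<and>
    \<not> (\<exists>x W. \<Phi> x W \<and> |S| \<le>o |W| \<and> (\<forall>l \<in> inc W n. col x l = q))" by blast
  then obtain S :: "'q \<Rightarrow> 'u set" where S: "\<And>q. small (S q)"
    "\<And>q x W. \<Phi> x W \<Longrightarrow> |S q| \<le>o |W| \<Longrightarrow> \<exists>l \<in> inc W n. col x l \<noteq> q" by metis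
  \<comment> \<open>\<open>undefined\<close> is the stand-in colour for the case that
    \<open>W'\<close> has no increasing tuple of length \<open>n\<close>.\<close>
  define S0 where "S0 = (\<Union>q \<in> insert undefined Q. S q)"
  have "small S0" unfolding S0_def
    using small_UN[of "insert undefined Q" S] S(1) small_Un[OF small_finite[of "{undefined}"] Q]
        by simp
  from erdos_rado[OF this Q, of n] obtain S' :: "'u set" where S': "small S'"
    "\<And>W F. |S'| \<le>o |W| \<Longrightarrow> F ` inc W n \<subseteq> Q \<Longrightarrow>
      (\<exists>W' \<subseteq> W. |S0| \<le>o |W'| \<and> (\<exists>c. \<forall>l \<in> inc W' n. F l = c))" by blast
  obtain x W where x: "\<Phi> x W" "|S'| \<le>o |W|" using large[OF S'(1)] by blast
  have "col x ` inc W n \<subseteq> Q" using col[OF x(1)] by blast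
  from S'(2)[OF x(2) this] obtain W' c where W': "W' \<subseteq> W" "|S0| \<le>o |W'|"
    "\<And>l. l \<in> inc W' n \<Longrightarrow> col x l = c" by blast
  have \<Phi>: "\<Phi> x W'" using shrink[OF x(1) W'(1)] .
  define q where "q = (if inc W' n = {} then undefined else c)"
  have "q \<in> insert undefined Q" unfolding q_def using W'(3) col[OF \<Phi>] by auto
  then have "S q \<subseteq> S0" unfolding S0_def by blast
  then have "|S q| \<le>o |W'|" using W'(2) card_of_mono1 ordLeq_transitive by blast
  from S(2)[OF \<Phi> this] obtain l where "l \<in> inc W' n" "col x l \<noteq> q" by blast
  then show False using W'(3) unfolding q_def by (cases "inc W' n = {}") auto
qed

end


section \<open>Affine operators on families\<close>

text \<open>The affine combination x - y + z, written multiplicatively because it is developed for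
  \<open>monoid\<close> records.\<close>

definition tern :: "('a, 'b) monoid_scheme \<Rightarrow> 'a \<Rightarrow> 'a \<Rightarrow> 'a \<Rightarrow> 'a" where
  "tern G x y z = x \<otimes>\<^bsub>G\<^esub> inv\<^bsub>G\<^esub> y \<otimes>\<^bsub>G\<^esub> z"

context comm_group
begin

lemma tern_closed [simp, intro]:
  "x \<in> carrier G \<Longrightarrow> y \<in> carrier G \<Longrightarrow> z \<in> carrier G \<Longrightarrow> tern G x y z \<in> carrier G"
  by (simp add: tern_def)

lemma tern_mult:
  assumes "x \<in> carrier G" "y \<in> carrier G" "z \<in> carrier G"
  shows "tern G x y z \<otimes> y = x \<otimes> z"
proof -
  have "tern G x y z \<otimes> y = x \<otimes> (inv y \<otimes> (y \<otimes> z))"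
    unfolding tern_def using assms by (simp add: m_assoc m_comm[of z y])
  also have "inv y \<otimes> (y \<otimes> z) = z"
    using assms by (simp add: m_assoc[symmetric])
  finally show ?thesis .
qed

text \<open>Characterises the operation by an equation without inverses, so that the identities
  below reduce to cancellation and commutativity.\<close>

lemma tern_eqI:
  assumes "x \<in> carrier G" "y \<in> carrier G" "z \<in> carrier G" "r \<in> carrier G"
    and "x \<otimes> z = r \<otimes> y"
  shows "tern G x y z = r"
  using tern_mult[OF assms(1-3)] assms by (metis right_cancel tern_closed)

lemma tern_same [simp]:
  assumes "x \<in> carrier G" "y \<in> carrier G"
  shows "tern G x y y = x" "tern G x x y = y"
  by (rule tern_eqI; use assms in \<open>simp add: m_comm\<close>)+

text \<open>The map x \<mapsto> x - a + b commutes with affine combinations; thus a fixed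
  \<open>a\<close>, \<open>b\<close> can be pulled out of a whole operator.\<close>

lemma tern_tern:
  assumes "x \<in> carrier G" "y \<in> carrier G" "z \<in> carrier G" "a \<in> carrier G" "b \<in> carrier G"
  shows "tern G (tern G x a b) (tern G y a b) (tern G z a b) = tern G (tern G x y z) a b"
proof (rule tern_eqI)
  let ?s = "tern G x a b" and ?t = "tern G y a b" and ?v = "tern G z a b"
    and ?r = "tern G x y z" and ?l = "tern G (tern G x y z) a b"
  have eqs: "?s \<otimes> a = x \<otimes> b" "?t \<otimes> a = y \<otimes> b" "?v \<otimes> a = z \<otimes> b" "?r \<otimes> y = x \<otimes> z"
    "?l \<otimes> a = ?r \<otimes> b"
    using assms by (simp_all add: tern_mult)
  have "?s \<otimes> ?v \<otimes> (a \<otimes> a) = (?s \<otimes> a) \<otimes> (?v \<otimes> a)" using assms by (simp add: m_ac)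
  also have "\<dots> = (x \<otimes> z) \<otimes> (b \<otimes> b)" using assms eqs by (simp add: m_ac)
  also have "\<dots> = (?r \<otimes> y) \<otimes> (b \<otimes> b)" using eqs by simp
  also have "\<dots> = (?r \<otimes> b) \<otimes> (y \<otimes> b)" using assms by (simp add: m_ac)
  also have "\<dots> = (?l \<otimes> a) \<otimes> (?t \<otimes> a)" using eqs by simp
  also have "\<dots> = ?l \<otimes> ?t \<otimes> (a \<otimes> a)" using assms by (simp add: m_ac)
  finally show "?s \<otimes> ?v = ?l \<otimes> ?t" using assms by (subst (asm) right_cancel) auto
qed (use assms in auto)

text \<open>In additive form, (A - B + Y) - (A - a + b) + (B - a + b) = Y. This is the cancellation
  by which the improved left inverse becomes invertible itself.\<close>

lemma tern_recover:
  assumes "A \<in> carrier G" "B \<in> carrier G" "Y \<in> carrier G" "a \<in> carrier G" "b \<in> carrier G"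
  shows "tern G (tern G A B Y) (tern G A a b) (tern G B a b) = Y"
proof (rule tern_eqI)
  let ?s = "tern G A B Y" and ?t = "tern G A a b" and ?v = "tern G B a b"
  have eqs: "?s \<otimes> B = A \<otimes> Y" "?t \<otimes> a = A \<otimes> b" "?v \<otimes> a = B \<otimes> b"
    using assms by (simp_all add: tern_mult)
  have "?s \<otimes> ?v \<otimes> (B \<otimes> a) = (?s \<otimes> B) \<otimes> (?v \<otimes> a)" using assms by (simp add: m_ac)
  also have "\<dots> = (A \<otimes> Y) \<otimes> (B \<otimes> b)" using eqs by simp
  also have "\<dots> = Y \<otimes> (A \<otimes> b) \<otimes> B" using assms by (simp add: m_ac)
  also have "\<dots> = Y \<otimes> (?t \<otimes> a) \<otimes> B" using eqs by simp
  also have "\<dots> = Y \<otimes> ?t \<otimes> (B \<otimes> a)" using assms by (simp add: m_ac)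
  finally show "?s \<otimes> ?v = Y \<otimes> ?t" using assms by (subst (asm) right_cancel) auto
qed (use assms in auto)

text \<open>The names are pairs of positions; this is the cancellation that undoes the swap
  operator.\<close>

lemma tern_swap_recover:
  assumes "jk \<in> carrier G" "lk \<in> carrier G" "li \<in> carrier G" "pq \<in> carrier G" "lq \<in> carrier G"
  shows "tern G (tern G jk lk li) (tern G pq lq li) (tern G pq lq lk) = jk"
proof (rule tern_eqI)
  let ?s = "tern G jk lk li" and ?t = "tern G pq lq li" and ?v = "tern G pq lq lk"
  have eqs: "?s \<otimes> lk = jk \<otimes> li" "?t \<otimes> lq = pq \<otimes> li" "?v \<otimes> lq = pq \<otimes> lk"
    using assms by (simp_all add: tern_mult)
  have "?s \<otimes> ?v \<otimes> (lk \<otimes> lq) = (?s \<otimes> lk) \<otimes> (?v \<otimes> lq)" using assms by (simp add: m_ac)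
  also have "\<dots> = (jk \<otimes> li) \<otimes> (pq \<otimes> lk)" using eqs by simp
  also have "\<dots> = jk \<otimes> (pq \<otimes> li) \<otimes> lk" using assms by (simp add: m_ac)
  also have "\<dots> = jk \<otimes> (?t \<otimes> lq) \<otimes> lk" using eqs by simp
  also have "\<dots> = jk \<otimes> ?t \<otimes> (lk \<otimes> lq)" using assms by (simp add: m_ac)
  finally show "?s \<otimes> ?v = jk \<otimes> ?t" using assms by (subst (asm) right_cancel) auto
qed (use assms in auto)

end

text \<open>
  Affine operators on families \<open>y\<close> indexed by increasing sequences: a leaf \<open>Sub f\<close> evaluates the
  family at a subsequence, and \<open>Tern\<close> stands for the affine operation \<open>x - y + z\<close>. A family of
  arity \<open>n\<close> depends only on the first \<open>n\<close> entries of its argument.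
\<close>

datatype trm = Sub "nat \<Rightarrow> nat" | Tern trm trm trm

primrec ev :: "('a \<Rightarrow> 'a \<Rightarrow> 'a \<Rightarrow> 'a) \<Rightarrow> trm \<Rightarrow> ((nat \<Rightarrow> 'w) \<Rightarrow> 'a) \<Rightarrow> (nat \<Rightarrow> 'w) \<Rightarrow> 'a" where
  "ev h (Sub f) y w = y (w \<circ> f)"
| "ev h (Tern a b c) y w = h (ev h a y w) (ev h b y w) (ev h c y w)"

primrec mapV :: "((nat \<Rightarrow> nat) \<Rightarrow> nat \<Rightarrow> nat) \<Rightarrow> trm \<Rightarrow> trm" where
  "mapV g (Sub f) = Sub (g f)"
| "mapV g (Tern a b c) = Tern (mapV g a) (mapV g b) (mapV g c)"

primrec comp_trm :: "trm \<Rightarrow> trm \<Rightarrow> trm" where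
  "comp_trm (Sub f) s = mapV ((\<circ>) f) s"
| "comp_trm (Tern a b c) s = Tern (comp_trm a s) (comp_trm b s) (comp_trm c s)"

definition increasing_into :: "nat \<Rightarrow> nat \<Rightarrow> (nat \<Rightarrow> nat) \<Rightarrow> bool" where
  "increasing_into n m f \<longleftrightarrow> (\<forall>j < n. f j < m \<and> (\<forall>i < j. f i < f j))"

primrec arity :: "nat \<Rightarrow> nat \<Rightarrow> trm \<Rightarrow> bool" where
  "arity n m (Sub f) \<longleftrightarrow> increasing_into n m f"
| "arity n m (Tern a b c) \<longleftrightarrow> arity n m a \<and> arity n m b \<and> arity n m c"

definition dep :: "nat \<Rightarrow> ((nat \<Rightarrow> 'w) \<Rightarrow> 'a) \<Rightarrow> bool" where
  "dep n y \<longleftrightarrow> (\<forall>w w'. (\<forall>i < n. w i = w' i) \<longrightarrow> y w = y w')"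

lemma increasing_into_comp:
  "increasing_into n m f \<Longrightarrow> increasing_into m k g \<Longrightarrow> increasing_into n k (g \<circ> f)"
  unfolding increasing_into_def by (auto dest: less_trans)

lemma ev_ren: "ev h (mapV ((\<circ>) g) T) y w = ev h T y (w \<circ> g)"
  by (induction T) (simp_all add: comp_def)

lemma ev_comp: "ev h (comp_trm E s) y w = ev h E (ev h s y) w"
  by (induction E) (simp_all add: ev_ren)

lemma ev_dep:
  assumes "arity n m T" "dep n y"
  shows "dep m (ev h T y)"
  using assms(1)
proof (induction T)
  case (Sub f)
  show ?case unfolding dep_def
  proof (intro allI impI)
    fix w w' :: "nat \<Rightarrow> 'a" assume "\<forall>i < m. w i = w' i"
    then have "\<forall>i < n. (w \<circ> f) i = (w' \<circ> f) i"
      using Sub unfolding arity.simps increasing_into_def by simp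
    then show "ev h (Sub f) y w = ev h (Sub f) y w'"
      using assms(2) unfolding dep_def ev.simps by blast
  qed
next
  case (Tern a b c)
  then have IH: "dep m (ev h a y)" "dep m (ev h b y)" "dep m (ev h c y)" by simp_all
  show ?case unfolding dep_def
  proof (intro allI impI)
    fix w w' :: "nat \<Rightarrow> 'a" assume "\<forall>i < m. w i = w' i"
    then have "ev h a y w = ev h a y w'" "ev h b y w = ev h b y w'" "ev h c y w = ev h c y w'"
      using IH unfolding dep_def by blast+
    then show "ev h (Tern a b c) y w = ev h (Tern a b c) y w'" by simp
  qed
qed

lemma arity_mapV:
  "arity n m T \<Longrightarrow> (\<And>f. increasing_into n m f \<Longrightarrow> increasing_into n' m' (g f)) \<Longrightarrow> arity n' m' (mapV g T)"
  by (induction T) auto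

lemma arity_weaken: "arity n m T \<Longrightarrow> m \<le> m' \<Longrightarrow> arity n m' T"
  by (induction T) (auto simp: increasing_into_def)

lemma arity_comp: "arity m k E \<Longrightarrow> arity n m s \<Longrightarrow> arity n k (comp_trm E s)"
  by (induction E) (auto intro: arity_mapV increasing_into_comp)

lemma ev_closed:
  "comm_group G \<Longrightarrow> (\<And>w. y w \<in> carrier G) \<Longrightarrow> ev (tern G) T y w \<in> carrier G"
  by (induction T) (simp_all add: comm_group.tern_closed)

section \<open>Blocks of positions and left inverses of operators\<close>

definition cat :: "nat \<Rightarrow> (nat \<Rightarrow> nat) \<Rightarrow> (nat \<Rightarrow> nat) \<Rightarrow> nat \<Rightarrow> nat" where
  "cat k a b j = (if j < k then a j else b (j - k))"

lemma increasing_into_cat: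
  assumes "increasing_into k m a" "increasing_into l m b" "\<And>i j. i < k \<Longrightarrow> j < l \<Longrightarrow> a i < b j"
  shows "increasing_into (k + l) m (cat k a b)"
  using assms unfolding increasing_into_def cat_def
  by (auto simp: less_diff_conv2)

text \<open>With the second group of positions frozen at \<open>b\<close>, the family
  \<open>W\<close> is \<open>Z\<close> translated by a constant, and \<open>tern_tern\<close> moves
  the translation outside the operator \<open>T\<close>.\<close>

lemma ev_cat:
  assumes "\<And>a. W (w \<circ> cat k a b) = tern G (Z (w \<circ> a)) B Y"
    and "comm_group G" "B \<in> carrier G" "Y \<in> carrier G" "\<And>w. Z w \<in> carrier G"
  shows "ev (tern G) (mapV (\<lambda>f. cat k (g \<circ> f) b) T) W w = tern G (ev (tern G) T Z (w \<circ> g)) B Y"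
proof (induction T)
  case (Sub f)
  then show ?case using assms(1)[of "g \<circ> f"] by (simp add: comp_def)
next
  case (Tern x y z)
  then show ?case
    by (simp add: comm_group.tern_tern[OF assms(2)] ev_closed[OF assms(2,5)] assms(3,4))
qed

text \<open>Lets a selector move whole blocks of \<open>p\<close> consecutive positions, keeping the
  offset inside the block.\<close>

definition blow :: "nat \<Rightarrow> (nat \<Rightarrow> nat) \<Rightarrow> nat \<Rightarrow> nat" where
  "blow p f x = p * f (x div p) + x mod p"

lemma blow_main: "q < p \<Longrightarrow> blow p f (p * j + q) = p * f j + q"
  by (simp add: blow_def)

lemma div_less_blocks: "x < p * n \<Longrightarrow> x div p < (n :: nat)"
  by (metis less_mult_imp_div_less mult.commute)

lemma block_less:
  assumes "(i :: nat) < j" "r < P" "P \<le> P'"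
  shows "P' * i + r < P' * j + s"
proof -
  have "P' * i + r < P' * (i + 1)" using assms by simp
  also have "\<dots> \<le> P' * j" using assms(1) by (intro mult_le_mono2) simp
  finally show ?thesis by simp
qed

lemma div_mod_less:
  assumes "(x :: nat) < y" shows "x div p < y div p \<or> (x div p = y div p \<and> x mod p < y mod p)"
  using assms div_le_mono[of x y p] by (metis div_mult_mod_eq le_neq_implies_less less_imp_le
      nat_add_left_cancel_less)

lemma increasing_blocks:
  assumes "increasing_into n m f" "p > 0" "c + p \<le> P"
  shows "increasing_into (p * n) (P * m) (\<lambda>x. P * f (x div p) + c + x mod p)"
  unfolding increasing_into_def
proof (intro allI impI conjI)
  fix y assume y: "y < p * n"
  then have yn: "y div p < n" by (rule div_less_blocks)
  then have "f (y div p) < m" using assms(1) unfolding increasing_into_def by blast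
  moreover have "c + y mod p < P" using assms(2,3) mod_less_divisor[of p y] by linarith
  ultimately show "P * f (y div p) + c + y mod p < P * m"
    using block_less[of "f (y div p)" m "c + y mod p" P P 0] by simp
  fix x assume x: "x < y"
  have cx: "c + x mod p < P" using assms(2,3) mod_less_divisor[of p x] by linarith
  show "P * f (x div p) + c + x mod p < P * f (y div p) + c + y mod p"
    using div_mod_less[OF x, of p]
  proof
    assume "x div p < y div p"
    then have "f (x div p) < f (y div p)" using assms(1) yn unfolding increasing_into_def by blast
    then show ?thesis
      using block_less[of "f (x div p)" "f (y div p)" "c + x mod p" P P "c + y mod p"] cx by simp
  qed simp
qed

lemma increasing_id: "n \<le> m \<Longrightarrow> increasing_into n m (\<lambda>j. j)"
  unfolding increasing_into_def by auto

lemma increasing_shift: "n + c \<le> m \<Longrightarrow> increasing_into n m (\<lambda>j. j + c)"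
  unfolding increasing_into_def by auto

lemma increasing_main: "q < p \<Longrightarrow> increasing_into n (p * n) (\<lambda>j. p * j + q)"
  unfolding increasing_into_def using block_less[of _ _ q p p] by (metis add_0_right le_refl)

text \<open>The family is recovered at one position of each block of length \<open>p\<close>, the
  one with offset \<open>q\<close>; the other positions are room for auxiliary entries. The identity
  is required uniformly in the group and in the family.\<close>

definition left_inverse :: "'u itself \<Rightarrow> nat \<Rightarrow> trm \<Rightarrow> nat \<Rightarrow> nat \<Rightarrow> trm \<Rightarrow> bool" where
  "left_inverse _ n E p q s \<longleftrightarrow>
    (\<forall>(G :: 'u monoid) (y :: (nat \<Rightarrow> 'u) \<Rightarrow> 'u) w.
      comm_group G \<longrightarrow> (\<forall>w. y w \<in> carrier G) \<longrightarrow> dep n y \<longrightarrow>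
      ev (tern G) s (ev (tern G) E y) w = y (\<lambda>j. w (p * j + q)))"

text \<open>
  If \<open>s\<close> is a left inverse of \<open>E\<close>, then so is \<open>y \<mapsto> s y (u) - E (s y) (v) + y (v)\<close>, where \<open>u\<close> and
  \<open>v\<close> are disjoint positions. Unlike \<open>s\<close>, this operator has a left inverse itself, namely \<open>W \<mapsto> W
  (u, v) - W (u, z) + E (W (-, z)) (v)\<close>.
\<close>

lemma left_inverse_step:
  fixes u :: "'u itself"
  assumes nm: "n > 0" "m > 0" "q < p" and E: "arity n m E" and s: "arity m (p * n) s"
    and inv: "left_inverse u n E p q s"
  obtains E' p' q' s' where
    "q' < p'" "arity m (p * n + p * m) E'" "arity (p * n + p * m) (p' * m) s'"
    "left_inverse u m E' p' q' s'" "left_inverse u n E p q E'"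
proof -
  \<comment> \<open>\<open>E\<close> after \<open>s\<close>. Here \<open>E\<close> acts on blocks,
    because \<open>s\<close> spends \<open>p\<close> positions on each index.\<close>
  define E1 where "E1 = comp_trm (mapV (blow p) E) s"
  define v where "v = (\<lambda>j. j + p * n)"
  define \<beta> where "\<beta> = (\<lambda>j. p * j + q)"
  define E' where "E' = Tern s (mapV ((\<circ>) v) E1) (Sub (v \<circ> \<beta>))"
  \<comment> \<open>A block of length \<open>p'\<close> has room for \<open>u\<close>, for one
    \<open>p\<close>-block of \<open>v\<close>, and for \<open>z\<close>. The positions
    \<open>u\<close> lie at the start of the first block, the \<open>p\<close>-blocks of
    \<open>v'\<close> are spread over all blocks at offset \<open>p * n\<close>, and
    \<open>z'\<close> lies at the end of the last block. This keeps \<open>u\<close> before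
    \<open>v'\<close> before \<open>z'\<close> and puts the recovered entry at offset
    \<open>p * n + q\<close>.\<close>
  define p' where "p' = p * n + p + p * m"
  define q' where "q' = p * n + q"
  define v' where "v' = (\<lambda>x. p' * (x div p) + p * n + x mod p)"
  define z' where "z' = (\<lambda>j. j + (p' * (m - 1) + p * n + p))"
  define s' where "s' = Tern (Sub (cat (p * n) (\<lambda>j. j) v')) (Sub (cat (p * n) (\<lambda>j. j) z'))
    (mapV (\<lambda>f. cat (p * n) (v' \<circ> f) z') (mapV (blow p) E))"
  have p: "p > 0" using nm(3) by simp
  have blowE: "arity (p * n) (p * m) (mapV (blow p) E)"
    using E
  proof (rule arity_mapV)
    fix f assume "increasing_into n m f"
    from increasing_blocks[OF this p, of 0 p] show "increasing_into (p * n) (p * m) (blow p f)"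
      by (simp add: blow_def[abs_def])
  qed
  have E1: "arity m (p * m) E1" unfolding E1_def using blowE s by (rule arity_comp)
  have iv: "increasing_into (p * m) (p * n + p * m) v"
    unfolding v_def by (rule increasing_shift) simp
  have i\<beta>: "increasing_into m (p * m) \<beta>" unfolding \<beta>_def by (rule increasing_main[OF nm(3)])
  have aE': "arity m (p * n + p * m) E'"
    unfolding E'_def arity.simps
  proof (intro conjI)
    show "arity m (p * n + p * m) s"
      using s by (rule arity_weaken) simp
    show "arity m (p * n + p * m) (mapV ((\<circ>) v) E1)"
      using E1 by (rule arity_mapV) (rule increasing_into_comp[OF _ iv])
    show "increasing_into m (p * n + p * m) (v \<circ> \<beta>)"
      by (rule increasing_into_comp[OF i\<beta> iv])
  qed
  have p'm: "p' * m = p' * (m - 1) + p'" using nm(2) by (cases m) simp_all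
  have iv': "increasing_into (p * m) (p' * m) v'"
    using increasing_blocks[OF increasing_id[of m m] p, of "p * n" p'] unfolding v'_def p'_def
        by simp
  have iz': "increasing_into (p * m) (p' * m) z'"
    unfolding z'_def by (rule increasing_shift) (simp add: p'm, simp add: p'_def)
  have iu: "increasing_into (p * n) (p' * m) (\<lambda>j. j)"
    by (rule increasing_id) (simp add: p'm, simp add: p'_def)
  have uv: "i < v' j" if "i < p * n" for i j using that unfolding v'_def by simp
  have uz: "i < z' j" if "i < p * n" for i j using that unfolding z'_def by simp
  have vz: "v' i < z' j" if "i < p * m" for i j
  proof -
    have "i div p \<le> m - 1" using div_less_blocks[OF that] by simp
    then have "p' * (i div p) \<le> p' * (m - 1)" by simp
    then show ?thesis unfolding v'_def z'_def using mod_less_divisor[OF p, of i] by linarith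
  qed
  have as': "arity (p * n + p * m) (p' * m) s'"
    unfolding s'_def arity.simps
  proof (intro conjI)
    show "increasing_into (p * n + p * m) (p' * m) (cat (p * n) (\<lambda>j. j) v')"
      by (rule increasing_into_cat[OF iu iv' uv])
    show "increasing_into (p * n + p * m) (p' * m) (cat (p * n) (\<lambda>j. j) z')"
      by (rule increasing_into_cat[OF iu iz' uz])
    show "arity (p * n + p * m) (p' * m) (mapV (\<lambda>f. cat (p * n) (v' \<circ> f) z') (mapV (blow p) E))"
    proof (rule arity_mapV[OF blowE])
      fix f assume f: "increasing_into (p * n) (p * m) f"
      show "increasing_into (p * n + p * m) (p' * m) (cat (p * n) (v' \<circ> f) z')"
      proof (rule increasing_into_cat[OF increasing_into_comp[OF f iv'] iz'])
        fix i j assume "i < p * n"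
        then show "(v' \<circ> f) i < z' j" using f vz unfolding increasing_into_def by simp
      qed
    qed
  qed
  \<comment> \<open>On a family that reads only the offset \<open>q\<close> of each block, the
    blown-up operator acts as the original one.\<close>
  have ev_blow: "ev h (mapV (blow p) T) z w = ev h T y (\<lambda>j. w (p * j + q))"
    if "\<And>w. z w = y (\<lambda>j. w (p * j + q))" for h T w and z y :: "(nat \<Rightarrow> 'u) \<Rightarrow> 'u"
    by (induction T) (simp_all add: that o_def blow_main[OF nm(3)])
  have inv1: "left_inverse u n E p q E'"
    unfolding left_inverse_def
  proof (intro allI impI)
    fix G :: "'u monoid" and y :: "(nat \<Rightarrow> 'u) \<Rightarrow> 'u" and w
    assume G: "comm_group G" and y: "\<forall>w. y w \<in> carrier G" "dep n y"
    let ?ev = "ev (tern G)"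
    have sE: "?ev s (?ev E y) w = y (\<lambda>j. w (p * j + q))" for w
      using inv G y unfolding left_inverse_def by blast
    have "?ev E1 (?ev E y) w = ?ev E y (\<lambda>j. w (p * j + q))" for w
      unfolding E1_def ev_comp by (rule ev_blow) (rule sE)
    then show "?ev E' (?ev E y) w = y (\<lambda>j. w (p * j + q))"
      unfolding E'_def ev.simps ev_ren sE
      using y ev_closed[OF G, of y E] comm_group.tern_same(1)[OF G]
      by (simp add: o_def \<beta>_def)
  qed
  have inv2: "left_inverse u m E' p' q' s'"
    unfolding left_inverse_def
  proof (intro allI impI)
    fix G :: "'u monoid" and y :: "(nat \<Rightarrow> 'u) \<Rightarrow> 'u" and w
    assume G: "comm_group G" and y: "\<forall>w. y w \<in> carrier G" "dep m y"
    let ?ev = "ev (tern G)"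
    have cl: "?ev T y w \<in> carrier G" for T w using ev_closed[OF G] y by blast
    have dep_s: "dep (p * n) (?ev s y)" using ev_dep[OF s y(2)] .
    have W: "?ev E' y (w \<circ> cat (p * n) a b) = tern G (?ev s y (w \<circ> a)) (?ev E1 y (w \<circ> b)) (y (w \<circ> b \<circ> \<beta>))"
      for w a b
    proof -
      have "?ev s y (w \<circ> cat (p * n) a b) = ?ev s y (w \<circ> a)"
        using dep_s unfolding dep_def by (auto simp: cat_def)
      moreover have "w \<circ> cat (p * n) a b \<circ> v = w \<circ> b"
        by (auto simp: cat_def v_def)
      ultimately show ?thesis unfolding E'_def ev.simps ev_ren by (simp add: comp_assoc[symmetric])
    qed
    have "?ev s' (?ev E' y) w = tern G
      (tern G (?ev s y w) (?ev E1 y (w \<circ> v')) (y (w \<circ> v' \<circ> \<beta>)))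
      (tern G (?ev s y w) (?ev E1 y (w \<circ> z')) (y (w \<circ> z' \<circ> \<beta>)))
      (tern G (?ev (mapV (blow p) E) (?ev s y) (w \<circ> v')) (?ev E1 y (w \<circ> z')) (y (w \<circ> z' \<circ> \<beta>)))"
      unfolding s'_def ev.simps
    proof (subst ev_cat[where Z = "?ev s y" and B = "?ev E1 y (w \<circ> z')" and Y = "y (w \<circ> z' \<circ> \<beta>)"])
      show "?ev E' y (w \<circ> cat (p * n) a z') = tern G (?ev s y (w \<circ> a)) (?ev E1 y (w \<circ> z')) (y (w \<circ> z' \<circ> \<beta>))" for a
        by (rule W)
      show "comm_group G" by (rule G)
    qed (use cl y W[of w "\<lambda>j. j"] in \<open>simp_all add: o_def\<close>)
    \<comment> \<open>\<open>E1\<close> at \<open>v'\<close> is the blown-up \<open>E\<close>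
      applied to the family \<open>s y\<close>, so the third term is the subtracted part of the
      first one, translated; \<open>tern_recover\<close> applies.\<close>
    also have "\<dots> = y (w \<circ> v' \<circ> \<beta>)"
      unfolding E1_def ev_comp[symmetric]
      by (rule comm_group.tern_recover[OF G]) (use cl y in auto)
    also have "w \<circ> v' \<circ> \<beta> = (\<lambda>j. w (p' * j + q'))"
      using nm(3) by (simp add: v'_def \<beta>_def q'_def comp_def add.assoc)
    finally show "?ev s' (?ev E' y) w = y (\<lambda>j. w (p' * j + q'))" .
  qed
  have "q' < p'" unfolding q'_def p'_def using nm(3) by simp
  then show thesis using that aE' as' inv1 inv2 by blast
qed

text \<open>
  For \<open>l < i < j < k\<close>, \<open>swap_trm\<close> is \<open>y (j, k) - y (l, k) + y (l, i)\<close>. From its values \<open>z\<close> one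
  recovers \<open>y (j, k)\<close> as \<open>z (l, i, j, k) - z (l, i, p, q) + z (l, k, p, q)\<close> if \<open>k < p < q\<close>. The
  positions 0, 1, 2, 7, 8, 9 of \<open>l, i, j, k, p, q\<close> put \<open>j\<close> and \<open>k\<close> at the places \<open>5 * 0 + 2\<close> and
  \<open>5 * 1 + 2\<close>.
\<close>

definition swap_trm :: trm where
  "swap_trm = Tern (Sub (\<lambda>j. if j = 0 then 2 else 3)) (Sub (\<lambda>j. if j = 0 then 0 else 3))
    (Sub (\<lambda>j. if j = 0 then 0 else 1))"

definition unswap_trm :: trm where
  "unswap_trm = Tern (Sub (\<lambda>j. [0, 1, 2, 7] ! j)) (Sub (\<lambda>j. [0, 1, 8, 9] ! j)) (Sub (\<lambda>j. [0, 7, 8, 9] ! j))"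

lemma arity_swap: "arity 2 4 swap_trm" "arity 4 10 unswap_trm"
  unfolding swap_trm_def unswap_trm_def arity.simps increasing_into_def
  by (auto simp: numeral_eq_Suc less_Suc_eq)

lemma left_inverse_swap: "left_inverse u 2 swap_trm 5 2 unswap_trm"
  unfolding left_inverse_def
proof (intro allI impI)
  fix G :: "'u monoid" and y :: "(nat \<Rightarrow> 'u) \<Rightarrow> 'u" and w
  assume G: "comm_group G" and y: "\<forall>w. y w \<in> carrier G" "dep 2 y"
  define Y where "Y a b = y (\<lambda>j. if j = 0 then a else b)" for a b
  have Y: "y w = Y (w 0) (w 1)" for w
    unfolding Y_def using y(2) unfolding dep_def by (auto simp: less_2_cases_iff)
  have "ev (tern G) unswap_trm (ev (tern G) swap_trm y) w = Y (w 2) (w 7)"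
    unfolding swap_trm_def unswap_trm_def ev.simps Y
    by (simp add: comm_group.tern_swap_recover[OF G] Y_def y(1))
  then show "ev (tern G) unswap_trm (ev (tern G) swap_trm y) w = y (\<lambda>j. w (5 * j + 2))"
    unfolding Y[of "\<lambda>j. w (5 * j + 2)"] by (simp add: numeral_2_eq_2)
qed

text \<open>A state holds an operator with a provisional left inverse \<open>s\<close>. The next
  state replaces \<open>s\<close> by the operator \<open>E'\<close> of
  \<open>left_inverse_step\<close>, which inverts the same operator and comes with a provisional
  left inverse of its own.\<close>

lemma operator_tower:
  fixes u :: "'u itself"
  obtains n :: "nat \<Rightarrow> nat" and p q :: "nat \<Rightarrow> nat" and T :: "nat \<Rightarrow> trm" where
    "n 0 = 2" "n 1 = 4" "T 0 = swap_trm" "\<And>k. arity (n k) (n (Suc k)) (T k)"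
    "\<And>k. increasing_into (n k) (n (Suc (Suc k))) (\<lambda>j. p k * j + q k)"
    "\<And>k. left_inverse u (n k) (T k) (p k) (q k) (T (Suc k))"
proof -
  define ok where "ok x \<longleftrightarrow> (case x of (n, m, E, p, q, s) \<Rightarrow>
    n > 0 \<and> m > 0 \<and> q < p \<and> arity n m E \<and> arity m (p * n) s \<and> left_inverse u n E p q s)" for x
  define nxt where "nxt x x' \<longleftrightarrow> (case x of (n, m, E, p, q, s) \<Rightarrow> case x' of (n', m', E', p', q', s') \<Rightarrow>
    n' = m \<and> m' = p * n + p * m \<and>
        left_inverse u n E p q E')" for x x' :: "nat \<times> nat \<times> trm \<times> nat \<times> nat \<times> trm"
  have "\<exists>X. \<forall>k. ok (X k) \<and> (k = 0 \<longrightarrow> X k = (2, 4, swap_trm, 5, 2, unswap_trm)) \<and>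
      nxt (X k) (X (Suc k))"
  proof -
    have "\<exists>X. \<forall>k. (ok (X k) \<and> (k = 0 \<longrightarrow> X k = (2, 4, swap_trm, 5, 2, unswap_trm))) \<and>
        nxt (X k) (X (Suc k))"
    proof (rule dependent_nat_choice)
      show "\<exists>x. ok x \<and> ((0 :: nat) = 0 \<longrightarrow> x = (2, 4, swap_trm, 5, 2, unswap_trm))"
        using arity_swap left_inverse_swap unfolding ok_def by auto
      fix x and k :: nat
      assume "ok x \<and> (k = 0 \<longrightarrow> x = (2, 4, swap_trm, 5, 2, unswap_trm))"
      then obtain n m E p q s where x: "x = (n, m, E, p, q, s)" "n > 0" "m > 0" "q < p"
        "arity n m E" "arity m (p * n) s" "left_inverse u n E p q s"
        unfolding ok_def by (cases x) auto
      obtain E' p' q' s' where "q' < p'" "arity m (p * n + p * m) E'"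
          "arity (p * n + p * m) (p' * m) s'"
        "left_inverse u m E' p' q' s'" "left_inverse u n E p q E'"
        by (rule left_inverse_step[OF x(2-7)])
      then have "ok (m, p * n + p * m, E', p', q', s') \<and> nxt x (m, p * n + p * m, E', p', q', s')"
        using x unfolding ok_def nxt_def by simp
      then show "\<exists>x'. (ok x' \<and> (Suc k = 0 \<longrightarrow> x' = (2, 4, swap_trm, 5, 2, unswap_trm))) \<and> nxt x x'"
        by blast
    qed
    then show ?thesis by simp
  qed
  then obtain X where X: "\<And>k. ok (X k)" "X 0 = (2, 4, swap_trm, 5, 2, unswap_trm)"
    "\<And>k. nxt (X k) (X (Suc k))" by blast
  define n where "n k = fst (X k)" for k
  define m where "m k = fst (snd (X k))" for k
  define T where "T k = fst (snd (snd (X k)))" for k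
  define p where "p k = fst (snd (snd (snd (X k))))" for k
  define q where "q k = fst (snd (snd (snd (snd (X k)))))" for k
  have *: "n (Suc k) = m k" "m (Suc k) = p k * n k + p k * m k"
      "left_inverse u (n k) (T k) (p k) (q k) (T (Suc k))"
    "arity (n k) (m k) (T k)" "q k < p k" for k
    using X(1)[of k] X(3)[of k] unfolding ok_def nxt_def n_def m_def T_def p_def q_def
    by (auto split: prod.splits)
  show thesis
  proof (rule that[of n T p q])
    show "n 0 = 2" "n 1 = 4" "T 0 = swap_trm"
      using X(2) *(1)[of 0] by (simp_all add: n_def m_def T_def)
    show "arity (n k) (n (Suc k)) (T k)" for k using * by simp
    show "left_inverse u (n k) (T k) (p k) (q k) (T (Suc k))" for k using * by simp
    show "increasing_into (n k) (n (Suc (Suc k))) (\<lambda>j. p k * j + q k)" for k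
      using increasing_main[OF *(5), of "n k" k] unfolding *(1,2) increasing_into_def
      by (auto intro: trans_less_add1)
  qed
qed


section \<open>Structures and their quantifier-free diagrams\<close>

lemma rstructureD:
  assumes "rstructure R M"
  shows "zer M \<in> univ M"
    "x \<in> univ M \<Longrightarrow> y \<in> univ M \<Longrightarrow> pls M (x, y) \<in> univ M"
    "a \<in> carrier R \<Longrightarrow> x \<in> univ M \<Longrightarrow> scl M (a, x) \<in> univ M"
  using assms unfolding rstructure_def by (auto simp: PiE_def Pi_def)

lemma rstr_eqI:
  fixes M M' :: "('r, 'u) rstr"
  assumes "rstructure R M" "rstructure R M'" "univ M = univ M'" "zer M = zer M'"
    and "\<And>x y. x \<in> univ M \<Longrightarrow> y \<in> univ M \<Longrightarrow> pls M (x, y) = pls M' (x, y)"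
    and "\<And>a x. a \<in> carrier R \<Longrightarrow> x \<in> univ M \<Longrightarrow> scl M (a, x) = scl M' (a, x)"
  shows "M = M'"
proof (rule rstr.equality)
  show "pls M = pls M'"
  proof (rule extensionalityI[of _ "univ M \<times> univ M"])
    show "pls M \<in> extensional (univ M \<times> univ M)" "pls M' \<in> extensional (univ M \<times> univ M)"
      using assms(1-3) unfolding rstructure_def PiE_def by simp_all
  qed (use assms in auto)
  show "scl M = scl M'"
  proof (rule extensionalityI[of _ "carrier R \<times> univ M"])
    show "scl M \<in> extensional (carrier R \<times> univ M)" "scl M' \<in> extensional (carrier R \<times> univ M)"
      using assms(1-3) unfolding rstructure_def PiE_def by simp_all
  qed (use assms in auto)
qed (use assms in auto)

lemma substructure_alt:
  "substructure R M N \<longleftrightarrow> rstructure R M \<and> rstructure R N \<and> univ M \<subseteq> univ N \<and> zer M = zer N \<and>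
    (\<forall>x \<in> univ M. \<forall>y \<in> univ M. pls M (x, y) = pls N (x, y)) \<and>
    (\<forall>a \<in> carrier R. \<forall>x \<in> univ M. scl M (a, x) = scl N (a, x))"
proof (cases "rstructure R M \<and> rstructure R N")
  case True
  then have ext: "pls M \<in> extensional (univ M \<times> univ M)" "scl M \<in> extensional (carrier R \<times> univ M)"
    unfolding rstructure_def PiE_def by simp_all
  have "pls M = restrict (pls N) (univ M \<times> univ M) \<longleftrightarrow>
      (\<forall>x \<in> univ M. \<forall>y \<in> univ M. pls M (x, y) = pls N (x, y))"
    by (rule iffI, simp, rule extensionalityI[OF ext(1)]) auto
  moreover have "scl M = restrict (scl N) (carrier R \<times> univ M) \<longleftrightarrow>
      (\<forall>a \<in> carrier R. \<forall>x \<in> univ M. scl M (a, x) = scl N (a, x))"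
    by (rule iffI, simp, rule extensionalityI[OF ext(2)]) auto
  ultimately show ?thesis unfolding substructure_def by blast
qed (auto simp: substructure_def)

lemma substructure_between:
  assumes "substructure R M0 N" "substructure R M1 N" "univ M0 \<subseteq> univ M1"
  shows "substructure R M0 M1"
  using assms unfolding substructure_alt by (simp add: subset_iff)

lemma rstr_iso_id: "rstructure R M \<Longrightarrow> rstr_iso R M M (\<lambda>x. x)"
  unfolding rstr_iso_def by (auto simp: bij_betw_def)

lemma rstr_iso_univ: "rstr_iso R M N f \<Longrightarrow> univ N = f ` univ M"
  unfolding rstr_iso_def bij_betw_def by simp

lemma rstr_iso_inj: "rstr_iso R M N f \<Longrightarrow> inj_on f (univ M)"
  unfolding rstr_iso_def bij_betw_def by simp

lemma rstr_iso_comp: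
  assumes "rstr_iso R M N f" "rstr_iso R N P g"
  shows "rstr_iso R M P (g \<circ> f)"
proof -
  have "\<And>x. x \<in> univ M \<Longrightarrow> f x \<in> univ N" using rstr_iso_univ[OF assms(1)] by blast
  then show ?thesis
    using assms bij_betw_trans[of f "univ M" "univ N" g "univ P"] unfolding rstr_iso_def by auto
qed

lemma rstr_iso_inv:
  assumes "rstr_iso R M N f"
  shows "rstr_iso R N M (inv_into (univ M) f)"
proof -
  let ?g = "inv_into (univ M) f"
  have M: "rstructure R M" and N: "rstructure R N" using assms unfolding rstr_iso_def by auto
  have bij: "bij_betw f (univ M) (univ N)" using assms unfolding rstr_iso_def by auto
  have g: "?g x \<in> univ M" "f (?g x) = x" if "x \<in> univ N" for x
    using that bij by (auto simp: bij_betw_def inv_into_into f_inv_into_f)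
  have gf: "?g (f x) = x" if "x \<in> univ M" for x
    using that bij by (simp add: bij_betw_def)
  have "?g (pls N (x, y)) = pls M (?g x, ?g y)" if "x \<in> univ N" "y \<in> univ N" for x y
    using assms g[OF that(1)] g[OF that(2)] gf[of "pls M (?g x, ?g y)"]
      rstructureD(2)[OF M, of "?g x" "?g y"] unfolding rstr_iso_def by force
  moreover have "?g (scl N (a, x)) = scl M (a, ?g x)" if "x \<in> univ N" "a \<in> carrier R" for a x
    using assms g[OF that(1)] gf[of "scl M (a, ?g x)"] that(2)
      rstructureD(3)[OF M that(2), of "?g x"] unfolding rstr_iso_def by force
  moreover have "?g (zer N) = zer M"
    using assms gf[of "zer M"] rstructureD(1)[OF M] unfolding rstr_iso_def by simp
  ultimately show ?thesis
    using M N bij_betw_inv_into[OF bij] unfolding rstr_iso_def by blast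
qed

lemma rstr_iso_cong:
  assumes "rstr_iso R M N f" "\<And>x. x \<in> univ M \<Longrightarrow> f x = g x"
  shows "rstr_iso R M N g"
proof -
  have M: "rstructure R M" using assms unfolding rstr_iso_def by auto
  show ?thesis
    using assms rstructureD[OF M] bij_betw_cong[of "univ M" f g "univ N"]
    unfolding rstr_iso_def by auto
qed

text \<open>Operations are \<open>undefined\<close> off the carrier, so the map determines the image
  structure. This turns isomorphisms that fix every element into equalities.\<close>

lemma rstr_iso_unique:
  assumes "rstr_iso R M N f" "rstr_iso R M N' f"
  shows "N = N'"
proof (rule rstr_eqI)
  show "rstructure R N" "rstructure R N'" using assms unfolding rstr_iso_def by auto
  show "univ N = univ N'" using assms rstr_iso_univ by metis
  show "zer N = zer N'" using assms unfolding rstr_iso_def by metis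
  fix x y assume "x \<in> univ N" "y \<in> univ N"
  then obtain x' y' where "x' \<in> univ M" "y' \<in> univ M" "x = f x'" "y = f y'"
    using rstr_iso_univ[OF assms(1)] by blast
  then show "pls N (x, y) = pls N' (x, y)" using assms unfolding rstr_iso_def by metis
next
  fix a x assume "a \<in> carrier R" "x \<in> univ N"
  moreover from this obtain x' where "x' \<in> univ M" "x = f x'"
    using rstr_iso_univ[OF assms(1)] by blast
  ultimately show "scl N (a, x) = scl N' (a, x)" using assms unfolding rstr_iso_def by metis
qed

lemma rstr_copy:
  fixes M :: "('r, 'u) rstr" and g :: "'u \<Rightarrow> 'u"
  assumes M: "rstructure R M" and inj: "inj_on g (univ M)"
  obtains M' where "rstr_iso R M M' g"
proof -
  let ?i = "inv_into (univ M) g"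
  define M' where "M' = \<lparr>univ = g ` univ M, zer = g (zer M),
    pls = (\<lambda>p \<in> g ` univ M \<times> g ` univ M. g (pls M (?i (fst p), ?i (snd p)))),
    scl = (\<lambda>p \<in> carrier R \<times> g ` univ M. g (scl M (fst p, ?i (snd p))))\<rparr>"
  have i: "?i (g x) = x" if "x \<in> univ M" for x using inj that by simp
  have "rstructure R M'"
    unfolding rstructure_def
  proof (intro conjI)
    have "|g ` univ M| <o |UNIV :: 'u set|"
      by (rule ordLeq_ordLess_trans[OF card_of_image]) (use M in \<open>simp add: rstructure_def\<close>)
    then show "|univ M'| <o |UNIV :: 'u set|" unfolding M'_def by simp
    show "zer M' \<in> univ M'" using rstructureD(1)[OF M] unfolding M'_def by simp
    show "pls M' \<in> univ M' \<times> univ M' \<rightarrow>\<^sub>E univ M'"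
      using rstructureD(2)[OF M] i unfolding M'_def by (auto simp: PiE_def Pi_def)
    show "scl M' \<in> carrier R \<times> univ M' \<rightarrow>\<^sub>E univ M'"
      using rstructureD(3)[OF M] i unfolding M'_def by (auto simp: PiE_def Pi_def)
  qed
  then have "rstr_iso R M M' g"
    using M inj i unfolding rstr_iso_def M'_def by (auto simp: bij_betw_def)
  then show thesis by (rule that)
qed

lemma rstr_iso_substructure:
  assumes sub: "substructure R M0 M" and iso: "rstr_iso R M M' f"
  obtains M0' where "rstr_iso R M0 M0' f" "substructure R M0' M'"
proof -
  have M0: "rstructure R M0" and us: "univ M0 \<subseteq> univ M" using sub unfolding substructure_alt by auto
  have inj: "inj_on f (univ M0)" using rstr_iso_inj[OF iso] us by (rule inj_on_subset)
  from rstr_copy[OF M0 inj] obtain M0' where M0': "rstr_iso R M0 M0' f" .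
  have "substructure R M0' M'"
    unfolding substructure_alt
  proof (intro conjI ballI)
    show "rstructure R M0'" "rstructure R M'" using M0' iso unfolding rstr_iso_def by auto
    show "univ M0' \<subseteq> univ M'" using us rstr_iso_univ[OF iso] rstr_iso_univ[OF M0'] by blast
    show "zer M0' = zer M'" using sub iso M0' unfolding substructure_alt rstr_iso_def by metis
    fix x y assume "x \<in> univ M0'" "y \<in> univ M0'"
    then obtain x' y' where "x' \<in> univ M0" "y' \<in> univ M0" "x = f x'" "y = f y'"
      using rstr_iso_univ[OF M0'] by blast
    then show "pls M0' (x, y) = pls M' (x, y)"
      using sub iso M0' us unfolding substructure_alt rstr_iso_def by (metis subset_iff)
  next
    fix a x assume "a \<in> carrier R" "x \<in> univ M0'"
    moreover from this obtain x' where "x' \<in> univ M0" "x = f x'"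
      using rstr_iso_univ[OF M0'] by blast
    ultimately show "scl M0' (a, x) = scl M' (a, x)"
      using sub iso M0' us unfolding substructure_alt rstr_iso_def by (metis subset_iff)
  qed
  with M0' show thesis by (rule that)
qed

lemma AEC_D:
  assumes "AEC R K"
  shows "M \<in> Models K \<Longrightarrow> rstructure R M"
    "M \<in> Models K \<Longrightarrow> sleq K M M"
    "sleq K M N \<Longrightarrow> sleq K N P \<Longrightarrow> sleq K M P"
    "sleq K M N \<Longrightarrow> substructure R M N"
    "sleq K M N \<Longrightarrow> M \<in> Models K"
    "sleq K M N \<Longrightarrow> N \<in> Models K"
    "M \<in> Models K \<Longrightarrow> rstr_iso R M N f \<Longrightarrow> N \<in> Models K"
    "sleq K M N \<Longrightarrow> rstr_iso R N N' f \<Longrightarrow> rstr_iso R M M' f \<Longrightarrow> sleq K M' N'"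
    "sleq K M0 M2 \<Longrightarrow> sleq K M1 M2 \<Longrightarrow> substructure R M0 M1 \<Longrightarrow> sleq K M0 M1"
proof -
  have po: "is_partial_order K" and sub: "\<forall>M N. sleq K M N \<longrightarrow> substructure R M N"
    and rs: "\<forall>M \<in> Models K. rstructure R M" and coh: "coherent R K"
    and inv: "\<forall>M N f. M \<in> Models K \<longrightarrow> rstr_iso R M N f \<longrightarrow> N \<in> Models K"
    "\<forall>M N M' N' f. sleq K M N \<longrightarrow> rstr_iso R N N' f \<longrightarrow> rstr_iso R M M' f \<longrightarrow> sleq K M' N'"
    using assms unfolding AEC_def iso_invariant_def by simp_all
  show "M \<in> Models K \<Longrightarrow> rstructure R M" using rs by simp
  show "M \<in> Models K \<Longrightarrow> sleq K M M" "sleq K M N \<Longrightarrow> sleq K N P \<Longrightarrow> sleq K M P"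
    "sleq K M N \<Longrightarrow> M \<in> Models K" "sleq K M N \<Longrightarrow> N \<in> Models K"
    using po unfolding is_partial_order_def by blast+
  show "sleq K M N \<Longrightarrow> substructure R M N" using sub by blast
  show "M \<in> Models K \<Longrightarrow> rstr_iso R M N f \<Longrightarrow> N \<in> Models K" using inv(1) by blast
  show "sleq K M N \<Longrightarrow> rstr_iso R N N' f \<Longrightarrow> rstr_iso R M M' f \<Longrightarrow> sleq K M' N'"
    using inv(2) by blast
  show "sleq K M0 M2 \<Longrightarrow> sleq K M1 M2 \<Longrightarrow> substructure R M0 M1 \<Longrightarrow> sleq K M0 M1"
    using coh unfolding coherent_def by blast
qed

lemma sleq_univ: "AEC R K \<Longrightarrow> sleq K M N \<Longrightarrow> univ M \<subseteq> univ N"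
  using AEC_D(4) unfolding substructure_alt by blast

lemma sleq_between:
  assumes "AEC R K" "sleq K M0 N" "sleq K M1 N" "univ M0 \<subseteq> univ M1"
  shows "sleq K M0 M1"
  using assms AEC_D(4)[OF assms(1)] AEC_D(9)[OF assms(1)] substructure_between by metis

lemma sleq_iso:
  assumes "AEC R K" "sleq K M0 M" "rstr_iso R M M' f"
  obtains M0' where "rstr_iso R M0 M0' f" "sleq K M0' M'"
proof -
  from rstr_iso_substructure[OF AEC_D(4)[OF assms(1,2)] assms(3)] obtain M0'
    where M0': "rstr_iso R M0 M0' f" by blast
  then show thesis using that AEC_D(8)[OF assms] by blast
qed

text \<open>Only equations that are linear in the coordinates, so that affine combinations preserve
  them. A diagram collects exactly the equations that hold, hence equality of diagrams also controls
  those that fail.\<close>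

datatype ('r, 'c) atom = Eq 'c 'c | Zero 'c | Add 'c 'c 'c | Scl 'r 'c 'c

primrec holds :: "('r, 'u) rstr \<Rightarrow> ('c \<Rightarrow> 'u) \<Rightarrow> ('r, 'c) atom \<Rightarrow> bool" where
  "holds M x (Eq a b) \<longleftrightarrow> x a = x b"
| "holds M x (Zero a) \<longleftrightarrow> x a = zer M"
| "holds M x (Add a b c) \<longleftrightarrow> pls M (x a, x b) = x c"
| "holds M x (Scl r a b) \<longleftrightarrow> scl M (r, x a) = x b"

definition atoms :: "('r, 'x) ring_scheme \<Rightarrow> 'c set \<Rightarrow> ('r, 'c) atom set" where
  "atoms R J = {\<phi>. set2_atom \<phi> \<subseteq> J \<and> set1_atom \<phi> \<subseteq> carrier R}"

definition diag :: "('r, 'x) ring_scheme \<Rightarrow> ('r, 'u) rstr \<Rightarrow> 'c set \<Rightarrow> ('c \<Rightarrow> 'u) \<Rightarrow> ('r, 'c) atom set" where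
  "diag R M J x = {\<phi> \<in> atoms R J. holds M x \<phi>}"

lemma mem_atoms [simp]:
  "Eq a b \<in> atoms R J \<longleftrightarrow> a \<in> J \<and> b \<in> J"
  "Zero a \<in> atoms R J \<longleftrightarrow> a \<in> J"
  "Add a b c \<in> atoms R J \<longleftrightarrow> a \<in> J \<and> b \<in> J \<and> c \<in> J"
  "Scl r a b \<in> atoms R J \<longleftrightarrow> r \<in> carrier R \<and> a \<in> J \<and> b \<in> J"
  unfolding atoms_def by auto

lemma atoms_mono: "J \<subseteq> J' \<Longrightarrow> atoms R J \<subseteq> atoms R J'"
  unfolding atoms_def by blast

lemma diag_subset: "diag R M J x \<subseteq> atoms R J"
  unfolding diag_def by blast

lemma diag_restrict: "J \<subseteq> J' \<Longrightarrow> diag R M J x = diag R M J' x \<inter> atoms R J"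
  unfolding diag_def using atoms_mono[of J J' R] by blast

lemma diag_cong:
  assumes "\<And>j. j \<in> J \<Longrightarrow> x j = y j"
  shows "diag R M J x = diag R M J y"
proof -
  have "holds M x \<phi> \<longleftrightarrow> holds M y \<phi>" if "\<phi> \<in> atoms R J" for \<phi>
    using that assms by (cases \<phi>) auto
  then show ?thesis unfolding diag_def by blast
qed

lemma diag_substructure:
  assumes "substructure R M N" "x ` J \<subseteq> univ M"
  shows "diag R M J x = diag R N J x"
proof -
  have x: "\<And>j. j \<in> J \<Longrightarrow> x j \<in> univ M" using assms(2) by blast
  have "holds M x \<phi> \<longleftrightarrow> holds N x \<phi>" if "\<phi> \<in> atoms R J" for \<phi>
    using that assms(1) x unfolding substructure_alt by (cases \<phi>) auto
  then show ?thesis unfolding diag_def by blast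
qed

lemma diag_iso:
  assumes "rstr_iso R M N f" "x ` J \<subseteq> univ M" "\<And>j. j \<in> J \<Longrightarrow> f (x j) = y j"
  shows "diag R M J x = diag R N J y"
proof -
  have M: "rstructure R M" using assms(1) unfolding rstr_iso_def by simp
  have x: "\<And>j. j \<in> J \<Longrightarrow> x j \<in> univ M" using assms(2) by blast
  have eq: "f a = f b \<longleftrightarrow> a = b" if "a \<in> univ M" "b \<in> univ M" for a b
    using rstr_iso_inj[OF assms(1)] that by (auto dest: inj_onD)
  have f: "f (zer M) = zer N" "\<And>a b. a \<in> univ M \<Longrightarrow> b \<in> univ M \<Longrightarrow> pls N (f a, f b) = f (pls M (a, b))"
    "\<And>r a. r \<in> carrier R \<Longrightarrow> a \<in> univ M \<Longrightarrow> scl N (r, f a) = f (scl M (r, a))"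
    using assms(1) unfolding rstr_iso_def by auto
  have "holds M x \<phi> \<longleftrightarrow> holds N y \<phi>" if "\<phi> \<in> atoms R J" for \<phi>
    using that
    by (cases \<phi>) (auto simp: assms(3)[symmetric] f(1)[symmetric] f(2,3) eq x rstructureD[OF M])
  then show ?thesis unfolding diag_def by blast
qed

lemma diag_same_D:
  assumes "diag R M J x = diag R N J' y \<inter> atoms R J" "\<phi> \<in> atoms R J" "holds M x \<phi>"
  shows "holds N y \<phi>"
  using assms unfolding diag_def by blast

text \<open>The map sends \<open>x j\<close> to \<open>y j\<close>: atoms \<open>Eq\<close> make it
  well defined and injective. The results of the operations are themselves listed, so the other
  atoms make it a homomorphism.\<close>

lemma diag_iso_ex:
  assumes M: "rstructure R M" and N: "rstructure R N"
    and x: "univ M = x ` J" and y: "univ N = y ` J" and d: "diag R M J x = diag R N J y"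
  obtains f where "rstr_iso R M N f" "\<And>j. j \<in> J \<Longrightarrow> f (x j) = y j"
proof -
  define f where "f z = y (SOME j. j \<in> J \<and> x j = z)" for z
  have h: "holds M x \<phi> \<longleftrightarrow> holds N y \<phi>" if "\<phi> \<in> atoms R J" for \<phi>
    using that d unfolding diag_def by blast
  have f: "f (x j) = y j" if "j \<in> J" for j
  proof -
    have "\<exists>j'. j' \<in> J \<and> x j' = x j" using that by blast
    from someI_ex[OF this] show ?thesis
      unfolding f_def using h[of "Eq (SOME j'. j' \<in> J \<and> x j' = x j) j"] that by simp
  qed
  have "bij_betw f (univ M) (univ N)"
    unfolding bij_betw_def
  proof
    show "inj_on f (univ M)" unfolding x
    proof (rule inj_onI)
      fix a b assume "a \<in> x ` J" "b \<in> x ` J" "f a = f b"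
      then obtain j k where "j \<in> J" "k \<in> J" "a = x j" "b = x k" "y j = y k" using f by force
      then show "a = b" using h[of "Eq j k"] by simp
    qed
    show "f ` univ M = univ N" unfolding x y using f by force
  qed
  moreover have "f (zer M) = zer N"
  proof -
    obtain j where j: "j \<in> J" "zer M = x j" using rstructureD(1)[OF M] unfolding x by blast
    then show ?thesis using h[of "Zero j"] f by simp
  qed
  moreover have "f (pls M (a, b)) = pls N (f a, f b)" if ab: "a \<in> univ M" "b \<in> univ M" for a b
  proof -
    obtain j k where j: "j \<in> J" "k \<in> J" "a = x j" "b = x k" using ab unfolding x by blast
    obtain l where l: "l \<in> J" "pls M (a, b) = x l" using rstructureD(2)[OF M ab] unfolding x
        by blast
    show ?thesis using h[of "Add j k l"] f j l by simp
  qed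
  moreover have "f (scl M (r, a)) = scl N (r, f a)" if ab: "r \<in> carrier R" "a \<in> univ M" for r a
  proof -
    obtain j where j: "j \<in> J" "a = x j" using ab unfolding x by blast
    obtain l where l: "l \<in> J" "scl M (r, a) = x l" using rstructureD(3)[OF M ab] unfolding x
        by blast
    show ?thesis using h[of "Scl r j l"] f j l ab by simp
  qed
  ultimately have "rstr_iso R M N f" unfolding rstr_iso_def using M N by blast
  then show thesis using that f by blast
qed

lemma diag_substructure_ex:
  assumes M: "rstructure R M" and N: "rstructure R N" and J: "J \<subseteq> J'"
    and x: "univ M = x ` J" and y: "univ N = x ` J'" and d: "diag R M J x = diag R N J' x \<inter> atoms R J"
  shows "substructure R M N"
  unfolding substructure_alt
proof (intro conjI ballI)
  show "zer M = zer N"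
  proof -
    obtain j where j: "j \<in> J" "zer M = x j" using rstructureD(1)[OF M] unfolding x by blast
    then show ?thesis using diag_same_D[OF d, of "Zero j"] by simp
  qed
  fix a b assume ab: "a \<in> univ M" "b \<in> univ M"
  then obtain j k where j: "j \<in> J" "k \<in> J" "a = x j" "b = x k" unfolding x by blast
  obtain l where l: "l \<in> J" "pls M (a, b) = x l" using rstructureD(2)[OF M ab] unfolding x by blast
  show "pls M (a, b) = pls N (a, b)" using diag_same_D[OF d, of "Add j k l"] j l by simp
next
  fix r a assume ab: "r \<in> carrier R" "a \<in> univ M"
  then obtain j where j: "j \<in> J" "a = x j" unfolding x by blast
  obtain l where l: "l \<in> J" "scl M (r, a) = x l" using rstructureD(3)[OF M ab] unfolding x by blast
  show "scl M (r, a) = scl N (r, a)" using diag_same_D[OF d, of "Scl r j l"] j l ab by simp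
qed (use assms in auto)

section \<open>Affine combinations preserve linear equations\<close>

definition add_group :: "('r, 'u) rstr \<Rightarrow> 'u monoid" where
  "add_group M = \<lparr>carrier = univ M, mult = (\<lambda>x y. pls M (x, y)), one = zer M\<rparr>"

lemma add_group_simps [simp]:
  "carrier (add_group M) = univ M" "x \<otimes>\<^bsub>add_group M\<^esub> y = pls M (x, y)"
  by (simp_all add: add_group_def)

lemma left_module_add_group: "left_module R M \<Longrightarrow> comm_group (add_group M)"
  unfolding left_module_def add_group_def by blast

lemma (in comm_group) tern_hom:
  assumes "\<And>x y. x \<in> carrier G \<Longrightarrow> y \<in> carrier G \<Longrightarrow> f (x \<otimes> y) = f x \<otimes> f y"
    and "\<And>x. x \<in> carrier G \<Longrightarrow> f x \<in> carrier G"
    and "x \<in> carrier G" "y \<in> carrier G" "z \<in> carrier G"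
  shows "f (tern G x y z) = tern G (f x) (f y) (f z)"
proof (rule tern_eqI[symmetric])
  have "f (tern G x y z) \<otimes> f y = f (x \<otimes> z)"
    using assms by (simp add: tern_mult flip: assms(1))
  then show "f x \<otimes> f z = f (tern G x y z) \<otimes> f y" using assms by simp
qed (use assms in auto)

lemma (in comm_group) tern_add:
  assumes "x \<in> carrier G" "y \<in> carrier G" "z \<in> carrier G" "x' \<in> carrier G" "y' \<in> carrier G"
      "z' \<in> carrier G"
  shows "tern G (x \<otimes> x') (y \<otimes> y') (z \<otimes> z') = tern G x y z \<otimes> tern G x' y' z'"
proof (rule tern_eqI)
  have "tern G x y z \<otimes> tern G x' y' z' \<otimes> (y \<otimes> y') =
      (tern G x y z \<otimes> y) \<otimes> (tern G x' y' z' \<otimes> y')"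
    using assms by (simp add: m_ac)
  also have "\<dots> = (x \<otimes> z) \<otimes> (x' \<otimes> z')" using assms by (simp only: tern_mult)
  also have "\<dots> = x \<otimes> x' \<otimes> (z \<otimes> z')" using assms by (simp add: m_ac)
  finally show "x \<otimes> x' \<otimes> (z \<otimes> z') = tern G x y z \<otimes> tern G x' y' z' \<otimes> (y \<otimes> y')" by simp
qed (use assms in auto)

text \<open>Here the module axioms enter: addition is commutative, so \<open>tern\<close> respects
  sums, and scalars act additively, so they commute with \<open>tern\<close>.\<close>

lemma holds_tern:
  assumes M: "left_module R M" and \<phi>: "\<phi> \<in> atoms R J"
    and cl: "\<And>j. x j \<in> univ M" "\<And>j. y j \<in> univ M" "\<And>j. z j \<in> univ M"
    and h: "holds M x \<phi>" "holds M y \<phi>" "holds M z \<phi>"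
  shows "holds M (\<lambda>j. tern (add_group M) (x j) (y j) (z j)) \<phi>"
proof -
  interpret comm_group "add_group M" using left_module_add_group[OF M] .
  have rs: "rstructure R M" using M unfolding left_module_def by blast
  show ?thesis
  proof (cases \<phi>)
    case (Eq a b)
    then show ?thesis using h by simp
  next
    case (Zero a)
    then show ?thesis using h tern_same(1)[of "zer M" "zer M"] rstructureD(1)[OF rs] by simp
  next
    case (Add a b c)
    then show ?thesis
      using h tern_add[of "x a" "y a" "z a" "x b" "y b" "z b"] cl by simp
  next
    case (Scl r a b)
    then have r: "r \<in> carrier R" using \<phi> by simp
    have "scl M (r, tern (add_group M) (x a) (y a) (z a)) =
      tern (add_group M) (scl M (r, x a)) (scl M (r, y a)) (scl M (r, z a))"
      by (rule tern_hom) (use cl r M rstructureD(3)[OF rs r] in \<open>auto simp: left_module_def\<close>)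
    then show ?thesis using h Scl by simp
  qed
qed

lemma holds_ev:
  assumes M: "left_module R M" and \<phi>: "\<phi> \<in> atoms R J" and cl: "\<And>w j. y w j \<in> univ M"
    and T: "arity n m T" and h: "\<And>f. increasing_into n m f \<Longrightarrow> holds M (y (w \<circ> f)) \<phi>"
  shows "holds M (\<lambda>j. ev (tern (add_group M)) T (\<lambda>w. y w j) w) \<phi>"
  using T
proof (induction T)
  case (Sub f)
  then show ?case using h by simp
next
  case (Tern a b c)
  have cl': "ev (tern (add_group M)) T (\<lambda>w. y w j) w \<in> univ M" for T j
    using ev_closed[OF left_module_add_group[OF assms(1)], of "\<lambda>w. y w j"] cl by simp
  show ?case unfolding ev.simps
    using Tern by (intro holds_tern[OF assms(1) \<phi>] cl') auto
qed

lemma ev_cong: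
  assumes "arity n m T" "\<And>f. increasing_into n m f \<Longrightarrow> y (w \<circ> f) = y' (w' \<circ> f)"
  shows "ev h T y w = ev h T y' w'"
  using assms by (induction T) auto


section \<open>Chains of models\<close>

text \<open>Repetitions are allowed, so that one index set serves all models of at most its
  size.\<close>

definition enumerates :: "('r, 'u) abstract_class \<Rightarrow> ('r, 'u) rstr \<Rightarrow> 'c set \<Rightarrow> ('c \<Rightarrow> 'u) \<Rightarrow> bool" where
  "enumerates K N J x \<longleftrightarrow> (\<exists>N0. sleq K N0 N \<and> univ N0 = x ` J)"

lemma univ_rstr_Union [simp]: "univ (rstr_Union R I M) = (\<Union>i \<in> I. univ (M i))"
  by (simp add: rstr_Union_def Let_def)

lemma limit_chain_union:
  assumes "AEC R K" "limit_chain K \<delta> M"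
  shows "\<exists>U. (\<forall>i \<in> Field \<delta>. sleq K (M i) U) \<and> univ U = (\<Union>i \<in> Field \<delta>. univ (M i))"
  using assms univ_rstr_Union[of R "Field \<delta>" M] unfolding AEC_def tarski_vaught_def by blast

context universe
begin

text \<open>Chains are indexed by well-orders on \<open>'u\<close>, so the order of the natural
  numbers is transported along an injection into \<open>'u\<close>.\<close>

lemma nat_chain_union:
  fixes B :: "nat \<Rightarrow> ('r, 'u) rstr"
  assumes K: "AEC R K" and B: "\<And>k. sleq K (B k) (B (Suc k))"
  shows "\<exists>U. (\<forall>k. sleq K (B k) U) \<and> univ U = (\<Union>k. univ (B k))"
proof -
  have "|UNIV :: nat set| \<le>o |UNIV :: 'u set|"
    using small_nat unfolding small_def by (rule ordLess_imp_ordLeq)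
  then obtain enc :: "nat \<Rightarrow> 'u" where enc: "inj enc" unfolding card_of_ordLeq[symmetric] by blast
  define \<delta> where "\<delta> = dir_image natLeq enc"
  define M where "M i = B (inv_into UNIV enc i)" for i
  have M: "M (enc k) = B k" for k unfolding M_def using enc by simp
  have F: "Field \<delta> = range enc" unfolding \<delta>_def by (simp add: dir_image_Field Field_natLeq)
  have le: "sleq K (B i) (B j)" if "i \<le> j" for i j
    using that by (induction rule: dec_induct) (use B AEC_D[OF K] in blast)+
  have "limit_chain K \<delta> M"
    unfolding limit_chain_def
  proof (intro conjI ballI allI impI)
    show "Well_order \<delta>" unfolding \<delta>_def
      by (rule Well_order_dir_image[OF natLeq_Well_order]) (use enc in \<open>simp add: Field_natLeq\<close>)
    show "|Field \<delta>| <o |UNIV :: 'u set|" unfolding F using small_image[OF small_nat, of enc]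
        by (simp add: small_def)
    show "Field \<delta> \<noteq> {}" unfolding F by simp
  next
    fix i assume "i \<in> Field \<delta>"
    then obtain k where k: "i = enc k" unfolding F by blast
    have "(enc k, enc (Suc k)) \<in> \<delta>" unfolding \<delta>_def dir_image_def natLeq_def by fastforce
    moreover have "enc (Suc k) \<noteq> i" using enc k by (simp add: inj_eq)
    ultimately show "\<exists>j. j \<noteq> i \<and> (i, j) \<in> \<delta>" using k by blast
  next
    fix i j assume "(i, j) \<in> \<delta>"
    then obtain a b where "i = enc a" "j = enc b" "a \<le> b"
      unfolding \<delta>_def dir_image_def natLeq_def by blast
    then show "sleq K (M i) (M j)" using M le by simp
  qed
  from limit_chain_union[OF K this] show ?thesis unfolding F using M by simp
qed

text \<open>If \<open>D\<close> has a greatest element, its model is the bound; otherwise the chain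
  has limit length and the union serves.\<close>

lemma chain_bound:
  fixes M :: "'u \<Rightarrow> ('r, 'u) rstr"
  assumes K: "AEC R K" and D: "small D" "D \<noteq> {}"
    and M: "\<And>i. i \<in> D \<Longrightarrow> M i \<in> Models K" "\<And>i j. i \<in> D \<Longrightarrow> j \<in> D \<Longrightarrow> i \<prec> j \<Longrightarrow> sleq K (M i) (M j)"
  shows "\<exists>U. \<forall>i \<in> D. sleq K (M i) U"
proof (cases "\<exists>m \<in> D. \<forall>i \<in> D. \<not> m \<prec> i")
  case True
  then obtain m where m: "m \<in> D" "\<And>i. i \<in> D \<Longrightarrow> i = m \<or> i \<prec> m" using lt_total by blast
  have "sleq K (M i) (M m)" if "i \<in> D" for i
    using m(2)[OF that] M(2)[OF that m(1)] AEC_D(2)[OF K M(1)[OF m(1)]] by blast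
  then show ?thesis by blast
next
  case False
  define \<delta> where "\<delta> = Restr |UNIV :: 'u set| D"
  have refl: "(x, x) \<in> |UNIV :: 'u set|" for x :: 'u
    using card_of_Well_order[of "UNIV :: 'u set"] Field_card_of[of "UNIV :: 'u set"]
    unfolding well_order_on_def linear_order_on_def partial_order_on_def preorder_on_def refl_on_def by auto
  have F: "Field \<delta> = D" unfolding \<delta>_def Field_def using refl by blast
  have "limit_chain K \<delta> M"
    unfolding limit_chain_def
  proof (intro conjI ballI allI impI)
    show "Well_order \<delta>" unfolding \<delta>_def by (rule Well_order_Restr[OF card_of_Well_order])
    show "|Field \<delta>| <o |UNIV :: 'u set|" unfolding F using D(1) by (simp add: small_def)
    show "Field \<delta> \<noteq> {}" unfolding F by (rule D(2))
  next
    fix i assume "i \<in> Field \<delta>"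
    then obtain j where "j \<in> D" "i \<prec> j" "i \<in> D" using False unfolding F by blast
    then have "j \<noteq> i \<and> (i, j) \<in> \<delta>" unfolding \<delta>_def lt_def by blast
    then show "\<exists>j. j \<noteq> i \<and> (i, j) \<in> \<delta>" by blast
  next
    fix i j assume "(i, j) \<in> \<delta>"
    then have "i \<in> D" "j \<in> D" "i = j \<or> i \<prec> j" unfolding \<delta>_def lt_def by auto
    then show "sleq K (M i) (M j)" using M AEC_D(2)[OF K] by blast
  qed
  from limit_chain_union[OF K this] show ?thesis unfolding F by blast
qed

text \<open>
  The even and the odd members of an increasing sequence of structures are \<open>\<preceq>\<close>-chains with the
  same union, so coherence gives \<open>\<preceq>\<close> between consecutive members.
\<close>

lemma interleaved_chains:
  fixes B :: "nat \<Rightarrow> ('r, 'u) rstr"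
  assumes K: "AEC R K" and B: "\<And>k. sleq K (B k) (B (Suc (Suc k)))"
    and sub: "\<And>k. substructure R (B k) (B (Suc k))"
  shows "sleq K (B 0) (B 1)"
proof -
  obtain U where U: "\<And>k. sleq K (B (2 * k)) U" "univ U = (\<Union>k. univ (B (2 * k)))"
    using nat_chain_union[OF K, of "\<lambda>k. B (2 * k)"] B by auto
  obtain U' where U': "\<And>k. sleq K (B (2 * k + 1)) U'" "univ U' = (\<Union>k. univ (B (2 * k + 1)))"
    using nat_chain_union[OF K, of "\<lambda>k. B (2 * k + 1)"] B by auto
  have mono: "univ (B k) \<subseteq> univ (B m)" if "k \<le> m" for k m
    by (rule lift_Suc_mono_le[of "\<lambda>k. univ (B k)", OF _ that])
      (use sub in \<open>simp only: substructure_alt\<close>)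
  note s = AEC_D(4)[OF K U(1)] AEC_D(4)[OF K U'(1)] sub
  have in_even: "\<exists>k. x \<in> univ (B (2 * k)) \<and> y \<in> univ (B (2 * k))" if xy: "x \<in> univ U"
      "y \<in> univ U" for x y
  proof -
    obtain i where "x \<in> univ (B (2 * i))" using xy(1) unfolding U(2) by (rule UN_E)
    moreover obtain j where "y \<in> univ (B (2 * j))" using xy(2) unfolding U(2) by (rule UN_E)
    ultimately have "x \<in> univ (B (2 * max i j))" "y \<in> univ (B (2 * max i j))"
      using mono[of "2 * i" "2 * max i j"] mono[of "2 * j" "2 * max i j"] by auto
    then show ?thesis by blast
  qed
  have "U = U'"
  proof (rule rstr_eqI)
    show "rstructure R U" "rstructure R U'" using s unfolding substructure_alt by blast+
    show "univ U = univ U'"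
    proof
      show "univ U \<subseteq> univ U'" unfolding U(2) U'(2) using mono[of "2 * k" "2 * k + 1" for k]
          by fastforce
      show "univ U' \<subseteq> univ U" unfolding U(2) U'(2)
      proof
        fix x assume "x \<in> (\<Union>k. univ (B (2 * k + 1)))"
        then obtain k where "x \<in> univ (B (2 * k + 1))" by blast
        then have "x \<in> univ (B (2 * (k + 1)))" using mono[of "2 * k + 1" "2 * (k + 1)"] by auto
        then show "x \<in> (\<Union>k. univ (B (2 * k)))" by blast
      qed
    qed
    show "zer U = zer U'" using s(1)[of 0] s(2)[of 0] s(3)[of 0] unfolding substructure_alt by simp
  next
    fix x y assume "x \<in> univ U" "y \<in> univ U"
    then obtain k where k: "x \<in> univ (B (2 * k))" "y \<in> univ (B (2 * k))" using in_even by blast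
    then show "pls U (x, y) = pls U' (x, y)"
      using s(1)[of k] s(2)[of k] s(3)[of "2 * k"] unfolding substructure_alt
          by (simp add: subset_iff)
  next
    fix a x assume a: "a \<in> carrier R" "x \<in> univ U"
    then obtain k where k: "x \<in> univ (B (2 * k))" using in_even by blast
    then show "scl U (a, x) = scl U' (a, x)"
      using s(1)[of k] s(2)[of k] s(3)[of "2 * k"] a(1) unfolding substructure_alt
          by (simp add: subset_iff)
  qed
  then show ?thesis
    using AEC_D(9)[OF K U(1)[of 0], of "B 1"] U'(1)[of 0] sub[of 0] by simp
qed

text \<open>Since \<open>real\<close> may use a different \<open>N\<close> for every stage, the
  stages are rebuilt on one set: the coordinates modulo the equations that \<open>p\<close>
  prescribes. There stage \<open>k\<close> is a model \<open>B k\<close> with diagram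
  \<open>p k\<close>; \<open>real\<close> gives \<preceq> two stages up, \<open>p\<close> gives a
  substructure one stage up, and \<open>interleaved_chains\<close> applies. A realisation of
  \<open>p 1\<close> in \<open>N\<close> then inherits the relation between \<open>B 0\<close> and
  \<open>B 1\<close>.\<close>

lemma tower_limit:
  fixes K :: "('r, 'u) abstract_class" and p :: "nat \<Rightarrow> ('r, 'c) atom set" and J :: "nat \<Rightarrow> 'c set"
  assumes K: "AEC R K" and J: "\<And>k. J k \<subseteq> J (Suc k)" "small (\<Union>k. J k)"
    and real: "\<And>k. \<exists>N x. enumerates K N (J (Suc (Suc k))) x \<and> enumerates K N (J k) x \<and>
      diag R N (J (Suc (Suc k))) x = p (Suc (Suc k))"
    and p: "\<And>k. p (Suc k) \<inter> atoms R (J k) = p k"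
    and N: "enumerates K N (J 1) x" "diag R N (J 1) x = p 1"
  shows "enumerates K N (J 0) x"
proof -
  have Jle: "J k \<subseteq> J m" if "k \<le> m" for k m
    by (rule lift_Suc_mono_le[of J, OF J(1) that])
  have ple: "p m \<inter> atoms R (J k) = p k" if "k \<le> m" for k m
    using that
  proof (induction rule: dec_induct)
    case base
    then show ?case using p[of k] by blast
  next
    case (step m)
    have "p (Suc m) \<inter> atoms R (J k) = (p (Suc m) \<inter> atoms R (J m)) \<inter> atoms R (J k)"
      using atoms_mono[OF Jle[OF step(1)], of R] by blast
    then show ?case using step(3) p[of m] by simp
  qed
  have model: "\<exists>N0 x. N0 \<in> Models K \<and> univ N0 = x ` J k \<and> diag R N0 (J k) x = p k" for k
  proof -
    obtain N x where N: "enumerates K N (J k) x" "diag R N (J (Suc (Suc k))) x = p (Suc (Suc k))"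
      using real[of k] by blast
    then obtain N0 where N0: "sleq K N0 N" "univ N0 = x ` J k" unfolding enumerates_def by blast
    have "diag R N0 (J k) x = diag R N (J k) x"
      using diag_substructure[OF AEC_D(4)[OF K N0(1)], of x "J k"] N0(2) by simp
    also have "\<dots> = p k"
      using diag_restrict[OF Jle[of k "Suc (Suc k)"], of R N x] N(2) ple[of k "Suc (Suc k)"] by simp
    finally show ?thesis using N0 AEC_D(5)[OF K] by blast
  qed
  \<comment> \<open>The identification of coordinates prescribed by the diagrams. By coherence of
    \<open>p\<close> it can be read off at any stage containing both coordinates.\<close>
  define E where "E j j' \<longleftrightarrow> (\<exists>k. Eq j j' \<in> p k)" for j j'
  have E: "E j j' \<longleftrightarrow> Eq j j' \<in> p k" if jj: "j \<in> J k" "j' \<in> J k" for j j' k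
  proof
    assume "E j j'"
    then obtain m where m: "Eq j j' \<in> p m" unfolding E_def by blast
    then have "Eq j j' \<in> p (max k m) \<inter> atoms R (J m)"
        by (simp only: ple[of m "max k m"] max.cobounded2)
    then have "Eq j j' \<in> p (max k m) \<inter> atoms R (J k)" using jj by simp
    then show "Eq j j' \<in> p k" by (simp only: ple[of k "max k m"] max.cobounded1)
  qed (auto simp: E_def)
  let ?J = "\<Union>k. J k"
  have common: "\<exists>k. j \<in> J k \<and> j' \<in> J k \<and> j'' \<in> J k" if j: "j \<in> ?J" "j' \<in> ?J" "j'' \<in> ?J" for j j' j''
  proof -
    obtain a b c where "j \<in> J a" "j' \<in> J b" "j'' \<in> J c" using j by blast
    moreover have "J i \<subseteq> J (a + b + c)" if "i \<in> {a, b, c}" for i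
      using that by (intro Jle) auto
    ultimately have "j \<in> J (a + b + c) \<and> j' \<in> J (a + b + c) \<and> j'' \<in> J (a + b + c)" by blast
    then show ?thesis by blast
  qed
  have E_refl: "E j j" if "j \<in> ?J" for j
  proof -
    obtain k where k: "j \<in> J k" using \<open>j \<in> ?J\<close> by blast
    obtain N0 :: "('r, 'u) rstr" and x where N0: "diag R N0 (J k) x = p k" using model[of k]
        by blast
    have "Eq j j \<in> diag R N0 (J k) x" using k by (simp add: diag_def)
    then show ?thesis unfolding E[OF k k] N0 .
  qed
  have E_eucl: "E j' j''" if "E j j'" "E j j''" "j \<in> ?J" "j' \<in> ?J" "j'' \<in> ?J" for j j' j''
  proof -
    obtain k where k: "j \<in> J k" "j' \<in> J k" "j'' \<in> J k" using common \<open>j \<in> ?J\<close> \<open>j' \<in> ?J\<close> \<open>j'' \<in> ?J\<close>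
        by blast
    obtain N0 :: "('r, 'u) rstr" and x where N0: "diag R N0 (J k) x = p k" using model[of k]
        by blast
    show ?thesis
      using that(1,2) k unfolding E[OF k(1,2)] E[OF k(1,3)] E[OF k(2,3)] N0[symmetric]
      by (simp add: diag_def)
  qed
  obtain enc :: "'c \<Rightarrow> 'u" where enc: "inj_on enc ?J"
    using ordLess_imp_ordLeq[OF J(2)[unfolded small_def]] unfolding card_of_ordLeq[symmetric]
        by blast
  define rep where "rep j = (SOME j'. j' \<in> ?J \<and> E j j')" for j
  have rep: "rep j \<in> ?J" "E j (rep j)" if "j \<in> ?J" for j
  proof -
    have "\<exists>j'. j' \<in> ?J \<and> E j j'" using E_refl that by blast
    from someI_ex[OF this] show "rep j \<in> ?J" "E j (rep j)" unfolding rep_def by auto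
  qed
  have rep_eq: "rep j = rep j' \<longleftrightarrow> E j j'" if j: "j \<in> ?J" "j' \<in> ?J" for j j'
  proof
    assume eq: "rep j = rep j'"
    have "E (rep j) j" using E_eucl[OF rep(2) E_refl] rep(1) j by blast
    moreover have "E (rep j) j'" using E_eucl[OF rep(2) E_refl] rep(1) j unfolding eq by blast
    ultimately show "E j j'" by (rule E_eucl) (rule rep(1)[OF j(1)] j)+
  next
    assume e: "E j j'"
    then have e': "E j' j" using E_eucl[OF e E_refl] j by blast
    have "(j'' \<in> ?J \<and> E j j'') \<longleftrightarrow> (j'' \<in> ?J \<and> E j' j'')" for j''
      using E_eucl[OF e _ j(1) j(2), of j''] E_eucl[OF e' _ j(2) j(1), of j''] by blast
    then show "rep j = rep j'" unfolding rep_def by simp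
  qed
  \<comment> \<open>A common enumeration for all stages: each class is named by the code of a chosen
    representative.\<close>
  define g where "g j = enc (rep j)" for j
  have g: "g j = g j' \<longleftrightarrow> Eq j j' \<in> p k" if j: "j \<in> J k" "j' \<in> J k" for j j' k
  proof -
    have jj: "j \<in> ?J" "j' \<in> ?J" using j by blast+
    have "g j = g j' \<longleftrightarrow> rep j = rep j'"
      unfolding g_def using enc rep(1)[OF jj(1)] rep(1)[OF jj(2)] by (auto dest: inj_onD)
    then show ?thesis using rep_eq[OF jj] E[OF j] by simp
  qed
  have "\<exists>B. B \<in> Models K \<and> univ B = g ` J k \<and> diag R B (J k) g = p k" for k
  proof -
    obtain N0 x where N0: "N0 \<in> Models K" "univ N0 = x ` J k" "diag R N0 (J k) x = p k"
      using model[of k] by blast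
    have xg: "x j = x j' \<longleftrightarrow> g j = g j'" if "j \<in> J k" "j' \<in> J k" for j j'
      using g[OF that] that unfolding N0(3)[symmetric] by (simp add: diag_def)
    define h where "h z = g (SOME j. j \<in> J k \<and> x j = z)" for z
    have h: "h (x j) = g j" if "j \<in> J k" for j
    proof -
      have "\<exists>j'. j' \<in> J k \<and> x j' = x j" using that by blast
      from someI_ex[OF this] show ?thesis unfolding h_def using xg[OF _ that] by blast
    qed
    have "inj_on h (univ N0)" unfolding N0(2) by (rule inj_onI) (use h xg in force)
    from rstr_copy[OF AEC_D(1)[OF K N0(1)] this] obtain B where B: "rstr_iso R N0 B h" .
    have "univ B = g ` J k" using rstr_iso_univ[OF B] h unfolding N0(2) by force
    moreover have "diag R B (J k) g = p k"
      using diag_iso[OF B, of x "J k" g] h N0(2,3) by simp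
    ultimately show ?thesis using AEC_D(7)[OF K N0(1) B] by blast
  qed
  then obtain B where B: "\<And>k. B k \<in> Models K" "\<And>k. univ (B k) = g ` J k"
      "\<And>k. diag R (B k) (J k) g = p k"
    by metis
  \<comment> \<open>Needed because \<open>B k\<close> and the part of \<open>B (k + 2)\<close> on
    the old coordinates come from different realisations; their common diagram makes them the same
    structure.\<close>
  have B_unique: "M = B k" if M: "M \<in> Models K" "univ M = g ` J k" "diag R M (J k) g = p k" for M k
  proof -
    have "diag R M (J k) g = diag R (B k) (J k) g" using M(3) B(3) by simp
    from diag_iso_ex[OF AEC_D(1)[OF K M(1)] AEC_D(1)[OF K B(1)] M(2) B(2) this]
    obtain f where f: "rstr_iso R M (B k) f" "\<And>j. j \<in> J k \<Longrightarrow> f (g j) = g j" by blast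
    have "rstr_iso R M (B k) (\<lambda>x. x)" using f(1) by (rule rstr_iso_cong) (use f(2) M(2) in auto)
    then show ?thesis using rstr_iso_unique[OF rstr_iso_id[OF AEC_D(1)[OF K M(1)]]] by blast
  qed
  have Bsub: "substructure R (B k) (B (Suc k))" for k
    by (rule diag_substructure_ex[OF AEC_D(1)[OF K B(1)] AEC_D(1)[OF K B(1)] J(1) B(2) B(2)])
      (simp add: B(3) p)
  have Ble: "sleq K (B k) (B (Suc (Suc k)))" for k
  proof -
    let ?k = "Suc (Suc k)"
    obtain N x where N: "enumerates K N (J ?k) x" "enumerates K N (J k) x"
        "diag R N (J ?k) x = p ?k"
      using real[of k] by blast
    then obtain N1 N0 where N1: "sleq K N1 N" "univ N1 = x ` J ?k" and N0: "sleq K N0 N"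
        "univ N0 = x ` J k"
      unfolding enumerates_def by blast
    have sub: "sleq K N0 N1"
      by (rule sleq_between[OF K N0(1) N1(1)]) (use N0(2) N1(2) Jle[of k ?k] in auto)
    have "diag R N1 (J ?k) x = diag R (B ?k) (J ?k) g"
      using diag_substructure[OF AEC_D(4)[OF K N1(1)], of x "J ?k"] N1(2) N(3) B(3) by simp
    from diag_iso_ex[OF AEC_D(1)[OF K AEC_D(5)[OF K N1(1)]] AEC_D(1)[OF K B(1)] N1(2) B(2) this]
    obtain f where f: "rstr_iso R N1 (B ?k) f" "\<And>j. j \<in> J ?k \<Longrightarrow> f (x j) = g j" by blast
    from sleq_iso[OF K sub f(1)] obtain M where M: "rstr_iso R N0 M f" "sleq K M (B ?k)" .
    have fk: "f (x j) = g j" if "j \<in> J k" for j using f(2) Jle[of k ?k] that by auto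
    have uM: "univ M = g ` J k" using rstr_iso_univ[OF M(1)] fk unfolding N0(2) by force
    have "diag R M (J k) g = diag R (B ?k) (J k) g"
      using diag_substructure[OF AEC_D(4)[OF K M(2)], of g "J k"] uM by simp
    also have "\<dots> = p k"
      using diag_restrict[OF Jle[of k ?k], of R "B ?k" g] B(3)[of ?k] ple[of k ?k] by simp
    finally have "M = B k" using B_unique AEC_D(5)[OF K M(2)] uM by blast
    then show ?thesis using M(2) by simp
  qed
  have B01: "sleq K (B 0) (B 1)" by (rule interleaved_chains[of R K B, OF K Ble Bsub])
  \<comment> \<open>The relation is carried over to \<open>N\<close> by the isomorphism from
    \<open>B 1\<close> to the model that \<open>x\<close> enumerates there.\<close>
  obtain N1 where N1: "sleq K N1 N" "univ N1 = x ` J 1" using N(1) unfolding enumerates_def by blast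
  have "diag R (B 1) (J 1) g = diag R N1 (J 1) x"
    using diag_substructure[OF AEC_D(4)[OF K N1(1)], of x "J 1"] N1(2) N(2) B(3)[of 1] by simp
  from diag_iso_ex[OF AEC_D(1)[OF K B(1)] AEC_D(1)[OF K AEC_D(5)[OF K N1(1)]] B(2) N1(2) this]
  obtain f where f: "rstr_iso R (B 1) N1 f" "\<And>j. j \<in> J 1 \<Longrightarrow> f (g j) = x j" by blast
  from sleq_iso[OF K B01 f(1)] obtain M where M: "rstr_iso R (B 0) M f" "sleq K M N1" .
  have "f (g j) = x j" if "j \<in> J 0" for j using f(2) Jle[of 0 1] that by auto
  then have "univ M = x ` J 0" using rstr_iso_univ[OF M(1)] unfolding B(2) by force
  then show ?thesis using AEC_D(3)[OF K M(2) N1(1)] unfolding enumerates_def by blast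
qed

end


section \<open>Towers of indiscernible families\<close>

context universe
begin

lemma small_atoms:
  assumes "small (carrier R)" "small J"
  shows "small (atoms R J)"
proof -
  have "atoms R J \<subseteq> (\<lambda>(a, b). Eq a b) ` (J \<times> J) \<union> Zero ` J \<union> (\<lambda>(a, b, c). Add a b c) ` (J \<times> J \<times> J) \<union>
      (\<lambda>(r, a, b). Scl r a b) ` (carrier R \<times> J \<times> J)"
  proof
    fix \<phi> assume "\<phi> \<in> atoms R J"
    then show "\<phi> \<in> (\<lambda>(a, b). Eq a b) ` (J \<times> J) \<union> Zero ` J \<union> (\<lambda>(a, b, c). Add a b c) ` (J \<times> J \<times> J) \<union>
      (\<lambda>(r, a, b). Scl r a b) ` (carrier R \<times> J \<times> J)"
      by (cases \<phi>) (auto simp: image_iff)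
  qed
  then show ?thesis
    by (rule small_mono[rotated]) (intro small_Un small_image small_Times assms)
qed

lemma inc_nth:
  "l \<in> inc W n \<longleftrightarrow> length l = n \<and> (\<forall>j < n. l ! j \<in> W \<and> (\<forall>i < j. l ! i \<prec> l ! j))"
  unfolding inc_def sorted_wrt_iff_nth_less by (auto simp: set_conv_nth)

lemma inc_sub:
  assumes "l \<in> inc W m" "increasing_into n m f"
  shows "map (nth l \<circ> f) [0..<n] \<in> inc W n"
  using assms unfolding inc_nth increasing_into_def by (auto dest: less_trans)

lemma inc_nonempty:
  assumes "infinite W"
  shows "\<exists>l. l \<in> inc W n"
  using assms
proof (induction n arbitrary: W)
  case 0
  then show ?case by simp
next
  case (Suc n)
  have "W \<noteq> {}" using Suc(2) by auto
  then obtain x where "x \<in> W" by blast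
  from lt_min[OF this] obtain z where z: "z \<in> W" "\<And>y. y \<in> W \<Longrightarrow> y = z \<or> z \<prec> y"
    using lt_total by blast
  have "infinite (W - {z})" using Suc(2) by simp
  from Suc(1)[OF this] obtain l where l: "l \<in> inc (W - {z}) n" ..
  have "z # l \<in> inc W (Suc n)"
    using l z unfolding inc_def by auto
  then show ?case ..
qed

end

text \<open>\<open>A\<close> is an index set of size \<kappa>: it indexes the tuples, bounds the
  Loewenheim-Skolem submodels, and enumerates them.\<close>

locale module_aec = universe u for u :: "'u itself" +
  fixes R :: "('r, 'x) ring_scheme" and K :: "('r, 'u) abstract_class" and A :: "'u set"
  assumes aec: "AEC R K" and modules: "M \<in> Models K \<Longrightarrow> left_module R M"
    and A: "infinite A" "small A" and small_R: "small (carrier R)"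
    and LS: "M \<in> Models K \<Longrightarrow> X \<subseteq> univ M \<Longrightarrow> |X| \<le>o |A| \<Longrightarrow>
      \<exists>M0. sleq K M0 M \<and> X \<subseteq> univ M0 \<and> |univ M0| \<le>o |A|"
begin

text \<open>A concrete witness that (x, y) and (y, x) have the same type in \<open>N\<close>: the
  isomorphism runs between \<preceq>-submodels.\<close>

definition swapped :: "('r, 'u) rstr \<Rightarrow> ('u \<Rightarrow> 'u) \<Rightarrow> ('u \<Rightarrow> 'u) \<Rightarrow> bool" where
  "swapped N x y \<longleftrightarrow> (\<exists>N0 N0' h. sleq K N0 N \<and> sleq K N0' N \<and> rstr_iso R N0 N0' h \<and>
    x ` A \<union> y ` A \<subseteq> univ N0 \<and> (\<forall>a \<in> A. h (x a) = y a \<and> h (y a) = x a))"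

lemma LS_enum:
  assumes "M \<in> Models K" "X \<subseteq> univ M" "|X| \<le>o |A|"
  shows "\<exists>M0 d. sleq K M0 M \<and> X \<subseteq> univ M0 \<and> univ M0 = d ` A"
proof -
  from LS[OF assms] obtain M0 where M0: "sleq K M0 M" "X \<subseteq> univ M0" "|univ M0| \<le>o |A|" by blast
  have "univ M0 \<noteq> {}" using rstructureD(1)[OF AEC_D(1)[OF aec AEC_D(5)[OF aec M0(1)]]] by blast
  then obtain d where "d ` A = univ M0" using card_of_ordLeq2[of "univ M0" A] M0(3) by blast
  then show ?thesis using M0 by blast
qed

end

section \<open>Stages of the construction and their unboundedness\<close>

locale tower = module_aec u R K A
  for u :: "'u itself" and R :: "('r, 'x) ring_scheme" and K :: "('r, 'u) abstract_class" and A :: "'u set" +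
  fixes n p q :: "nat \<Rightarrow> nat" and T :: "nat \<Rightarrow> trm"
  assumes n: "n 0 = 2" "n 1 = 4" and T0: "T 0 = swap_trm"
    and arity_T: "arity (n k) (n (Suc k)) (T k)"
    and main: "increasing_into (n k) (n (Suc (Suc k))) (\<lambda>j. p k * j + q k)"
    and linv: "left_inverse u (n k) (T k) (p k) (q k) (T (Suc k))"
begin

text \<open>
  Stage \<open>k\<close> of the construction is a family \<open>ys k\<close> of enumerations of models \<open>\<preceq> N\<close>, indexed by
  the increasing \<open>n k\<close>-tuples from \<open>W\<close>. At stage 0, level 0 of the coordinates lists \<open>e\<^sub>i\<close> and
  level 1 lists \<open>e\<^sub>j\<close>; the further levels list the elements added to obtain a model.
\<close>

definition coords :: "nat \<Rightarrow> (nat \<times> 'u) set" where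
  "coords k = {..k + 2} \<times> A"

lemma coords_Suc: "coords (Suc k) = coords k \<union> {k + 3} \<times> A"
  unfolding coords_def by auto

lemma card_coords: "|coords k| \<le>o |A|"
proof -
  have "|{..k + 2}| \<le>o |A|"
    using A(1) by (intro ordLess_imp_ordLeq finite_ordLess_infinite)
      (simp_all add: Field_card_of card_of_well_order_on)
  moreover have "|A| \<le>o |A|" by (rule ordLeq_refl[OF card_of_Card_order])
  ultimately show ?thesis unfolding coords_def
    using A(1) card_of_Card_order
        by (intro card_of_Times_ordLeq_infinite_Field) (simp_all add: Field_card_of)
qed

lemma small_coords: "small (coords k)"
  using small_ordLeq[OF A(2) card_coords] .

text \<open>Operators act on each coordinate separately; this presents one coordinate of a family in
  the form that \<open>ev\<close> expects.\<close>

definition fam :: "nat \<Rightarrow> ('u list \<Rightarrow> nat \<times> 'u \<Rightarrow> 'u) \<Rightarrow> nat \<times> 'u \<Rightarrow> (nat \<Rightarrow> 'u) \<Rightarrow> 'u" where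
  "fam m y c w = y (map w [0..<m]) c"

text \<open>Membership in \<open>univ N\<close> is demanded for all arguments, also outside
  \<open>W\<close> and the coordinates, because \<open>ev_closed\<close> speaks of total families.
  The remaining clauses concern \<open>W\<close> only and hence pass to subsets of
  \<open>W\<close>.\<close>

definition pre :: "nat \<Rightarrow> ('r, 'u) rstr \<times> ('u \<Rightarrow> 'u \<Rightarrow> 'u) \<times> (nat \<Rightarrow> 'u list \<Rightarrow> nat \<times> 'u \<Rightarrow> 'u) \<Rightarrow> 'u set \<Rightarrow> bool" where
  "pre k x W \<longleftrightarrow> (case x of (N, e, ys) \<Rightarrow>
    N \<in> Models K \<and> (\<forall>i a. e i a \<in> univ N) \<and>
    (\<forall>i \<in> W. \<forall>j \<in> W. i \<prec> j \<longrightarrow> \<not> swapped N (e i) (e j)) \<and>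
    (\<forall>i l c. ys i l c \<in> univ N) \<and>
    (\<forall>l \<in> inc W 2. \<forall>a \<in> A. ys 0 l (0, a) = e (l ! 0) a \<and> ys 0 l (1, a) = e (l ! 1) a) \<and>
    (\<forall>i \<le> k. \<forall>l \<in> inc W (n i). enumerates K N (coords i) (ys i l)) \<and>
    (\<forall>i < k. \<forall>l \<in> inc W (n (Suc i)). \<forall>c \<in> coords i.
      ys (Suc i) l c = ev (tern (add_group N)) (T i) (fam (n i) (ys i) c) (nth l)))"

definition types_ok :: "nat \<Rightarrow> (nat \<Rightarrow> ('r, nat \<times> 'u) atom set) \<Rightarrow>
    ('r, 'u) rstr \<times> ('u \<Rightarrow> 'u \<Rightarrow> 'u) \<times> (nat \<Rightarrow> 'u list \<Rightarrow> nat \<times> 'u \<Rightarrow> 'u) \<Rightarrow> 'u set \<Rightarrow> bool" where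
  "types_ok k P x W \<longleftrightarrow> (\<forall>i \<le> k. \<forall>l \<in> inc W (n i). diag R (fst x) (coords i) (snd (snd x) i l) = P i)"

text \<open>The diagrams \<open>P\<close> are fixed while the model and the families may depend on
  the required length; this is the invariant that survives infinitely many stages.\<close>

definition unbounded :: "nat \<Rightarrow> (nat \<Rightarrow> ('r, nat \<times> 'u) atom set) \<Rightarrow> bool" where
  "unbounded k P \<longleftrightarrow> (\<forall>S :: 'u set. small S \<longrightarrow> (\<exists>x W. pre k x W \<and> types_ok k P x W \<and> |S| \<le>o |W| ))"

lemma pre_mono: "pre k x W \<Longrightarrow> W' \<subseteq> W \<Longrightarrow> pre k x W'"
  using inc_mono[of W' W] unfolding pre_def
  by (cases x) (simp add: subset_iff)

lemma types_ok_mono: "types_ok k P x W \<Longrightarrow> W' \<subseteq> W \<Longrightarrow> types_ok k P x W'"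
  using inc_mono[of W' W] unfolding types_ok_def by blast

lemma small_Q: "small (Pow (atoms R (coords k)))"
  by (intro small_Pow small_atoms small_R small_coords)

text \<open>The old coordinates receive the image under \<open>T k\<close>, and the new level
  \<open>k + 3\<close> lists a Loewenheim-Skolem model containing this image.\<close>

lemma pre_Suc:
  assumes "pre k (N, e, ys) W"
  shows "\<exists>y. pre (Suc k) (N, e, ys(Suc k := y)) W"
proof -
  have N: "N \<in> Models K" and ys: "\<And>i l c. ys i l c \<in> univ N"
    using assms unfolding pre_def by auto
  have G: "comm_group (add_group N)" by (rule left_module_add_group[OF modules[OF N]])
  define E where "E l c = ev (tern (add_group N)) (T k) (fam (n k) (ys k) c) (nth l)" for l c
  have E: "E l c \<in> univ N" for l c
    using ev_closed[OF G, of "fam (n k) (ys k) c"] ys unfolding E_def fam_def by simp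
  have "\<exists>M0 d. sleq K M0 N \<and> E l ` coords k \<subseteq> univ M0 \<and> univ M0 = d ` A" for l
    by (rule LS_enum[OF N]) (use E card_coords card_of_image ordLeq_transitive in blast)+
  then obtain M0 d where M0: "\<And>l. sleq K (M0 l) N" "\<And>l. E l ` coords k \<subseteq> univ (M0 l)"
      "\<And>l. univ (M0 l) = d l ` A"
    by metis
  have d_in: "d l a \<in> univ N" if "a \<in> A" for l a
    using sleq_univ[OF aec M0(1)[of l]] that unfolding M0(3) by blast
  \<comment> \<open>\<open>zer N\<close> is a default that keeps the family total with values in
    \<open>N\<close>.\<close>
  define y where "y l c = (if c \<in> coords k then E l c else if snd c \<in> A then d l (snd c) else zer N)" for l c
  have yc: "y l c = E l c" if "c \<in> coords k" for l c unfolding y_def using that by simp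
  have y_in: "y l c \<in> univ N" for l c
    using E d_in rstructureD(1)[OF AEC_D(1)[OF aec N]] unfolding y_def by simp
  have "y l ` coords (Suc k) = univ (M0 l)" for l
  proof -
    have "y l ` coords k = E l ` coords k" using yc by auto
    moreover have "y l ` ({k + 3} \<times> A) = d l ` A"
    proof -
      have "y l (k + 3, a) = d l a" if "a \<in> A" for a unfolding y_def coords_def using that by simp
      then show ?thesis by force
    qed
    ultimately show ?thesis using M0(2)[of l] unfolding coords_Suc image_Un M0(3) by blast
  qed
  then have "enumerates K N (coords (Suc k)) (y l)" for l
    unfolding enumerates_def using M0(1)[of l] by metis
  then have "pre (Suc k) (N, e, ys(Suc k := y)) W"
    using assms y_in yc unfolding pre_def E_def by (auto simp: le_Suc_eq less_Suc_eq)
  then show ?thesis by blast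
qed

text \<open>The colour of a tuple is the diagram of the new stage at that tuple. Passing to a
  homogeneous subset of \<open>W\<close> leaves the earlier diagrams as they were.\<close>

lemma unbounded_Suc:
  assumes "unbounded k P"
  shows "\<exists>Q. unbounded (Suc k) (P(Suc k := Q))"
proof -
  have "\<exists>Q. \<forall>S :: 'u set. small S \<longrightarrow> (\<exists>x W. (pre (Suc k) x W \<and> types_ok k P x W) \<and> |S| \<le>o |W| \<and>
    (\<forall>l \<in> inc W (n (Suc k)). diag R (fst x) (coords (Suc k)) (snd (snd x) (Suc k) l) = Q))"
  proof (rule homogenize[OF _ _ _ small_Q[of "Suc k"]])
    fix x W W' assume "pre (Suc k) x W \<and> types_ok k P x W" "W' \<subseteq> W"
    then show "pre (Suc k) x W' \<and> types_ok k P x W'" using pre_mono types_ok_mono by blast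
  next
    fix S :: "'u set" assume "small S"
    then obtain x W where x: "pre k x W" "types_ok k P x W" "|S| \<le>o |W|"
      using assms unfolding unbounded_def by blast
    obtain N e ys where xe: "x = (N, e, ys)" by (cases x)
    obtain y where y: "pre (Suc k) (N, e, ys(Suc k := y)) W" using pre_Suc x(1) unfolding xe
        by blast
    have "types_ok k P (N, e, ys(Suc k := y)) W" using x(2) unfolding types_ok_def xe by simp
    then show "\<exists>x W. (pre (Suc k) x W \<and> types_ok k P x W) \<and> |S| \<le>o |W|" using y x(3) by blast
  next
    fix x W l
    show "diag R (fst x) (coords (Suc k)) (snd (snd x) (Suc k) l) \<in> Pow (atoms R (coords (Suc k)))"
      using diag_subset by blast
  qed
  then obtain Q where Q: "\<And>S :: 'u set. small S \<Longrightarrow> \<exists>x W. (pre (Suc k) x W \<and> types_ok k P x W) \<and>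
      |S| \<le>o |W| \<and>
    (\<forall>l \<in> inc W (n (Suc k)). diag R (fst x) (coords (Suc k)) (snd (snd x) (Suc k) l) = Q)" by blast
  have "unbounded (Suc k) (P(Suc k := Q))"
    unfolding unbounded_def
  proof (intro allI impI)
    fix S :: "'u set" assume "small S"
    from Q[OF this] obtain x W where x: "pre (Suc k) x W" "types_ok k P x W" "|S| \<le>o |W|"
      "\<And>l. l \<in> inc W (n (Suc k)) \<Longrightarrow> diag R (fst x) (coords (Suc k)) (snd (snd x) (Suc k) l) = Q"
          by blast
    have "types_ok (Suc k) (P(Suc k := Q)) x W"
      using x(2,4) unfolding types_ok_def by (auto simp: le_Suc_eq)
    then show "\<exists>x W. pre (Suc k) x W \<and> types_ok (Suc k) (P(Suc k := Q)) x W \<and> |S| \<le>o |W|"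
      using x by blast
  qed
  then show ?thesis ..
qed

definition no_swap :: bool where
  "no_swap \<longleftrightarrow> (\<forall>S :: 'u set. small S \<longrightarrow> (\<exists>N \<in> Models K. \<exists>W e. |S| \<le>o |W| \<and>
      (\<forall>i \<in> W. \<forall>a \<in> A. e i a \<in> univ N) \<and>
    (\<forall>i \<in> W. \<forall>j \<in> W. i \<prec> j \<longrightarrow> \<not> swapped N (e i) (e j))))"

lemma pre_0:
  assumes N: "N \<in> Models K" and e: "\<And>i a. i \<in> W \<Longrightarrow> a \<in> A \<Longrightarrow> e i a \<in> univ N"
    and ns: "\<And>i j. i \<in> W \<Longrightarrow> j \<in> W \<Longrightarrow> i \<prec> j \<Longrightarrow> \<not> swapped N (e i) (e j)"
  shows "\<exists>x. pre 0 x W"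
proof -
  have z: "zer N \<in> univ N" by (rule rstructureD(1)[OF AEC_D(1)[OF aec N]])
  \<comment> \<open>The given tuples matter only on \<open>W\<close> and \<open>A\<close>; the
    default value makes them total without affecting \<open>swapped\<close>.\<close>
  define e' where "e' i a = (if i \<in> W \<and> a \<in> A then e i a else zer N)" for i a
  have e': "e' i a \<in> univ N" for i a unfolding e'_def using e z by simp
  have ns': "\<not> swapped N (e' i) (e' j)" if "i \<in> W" "j \<in> W" "i \<prec> j" for i j
  proof -
    have "swapped N (e' i) (e' j) \<longleftrightarrow> swapped N (e i) (e j)"
      unfolding swapped_def e'_def using that by (simp cong: image_cong)
    then show ?thesis using ns[OF that] by simp
  qed
  have "\<exists>M0 d. sleq K M0 N \<and> e' (l ! 0) ` A \<union> e' (l ! 1) ` A \<subseteq> univ M0 \<and> univ M0 = d ` A" for l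
  proof (rule LS_enum[OF N])
    show "e' (l ! 0) ` A \<union> e' (l ! 1) ` A \<subseteq> univ N" using e' by blast
    show "|e' (l ! 0) ` A \<union> e' (l ! 1) ` A| \<le>o |A|"
      using A(1) card_of_image[of _ A] card_of_Card_order
      by (intro card_of_Un_ordLeq_infinite_Field) (simp_all add: Field_card_of)
  qed
  then obtain M0 d where M0: "\<And>l. sleq K (M0 l) N"
    "\<And>l. e' (l ! 0) ` A \<union> e' (l ! 1) ` A \<subseteq> univ (M0 l)" "\<And>l. univ (M0 l) = d l ` A"
    by metis
  have d_in: "d l a \<in> univ N" if "a \<in> A" for l a
    using sleq_univ[OF aec M0(1)[of l]] that unfolding M0(3) by blast
  \<comment> \<open>Levels 0 and 1 list the two tuples, level 2 lists a model containing
    both.\<close>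
  define y where "y l c = (if fst c = 0 then e' (l ! 0) (snd c) else if fst c = 1 then e' (l ! 1) (snd c)
    else if snd c \<in> A then d l (snd c) else zer N)" for l and c :: "nat \<times> 'u"
  have y_in: "y l c \<in> univ N" for l c
    using e' d_in z unfolding y_def by simp
  have y01: "y l (0, a) = e' (l ! 0) a" "y l (1, a) = e' (l ! 1) a" for l a unfolding y_def
      by simp_all
  have "y l ` coords 0 = univ (M0 l)" for l
  proof -
    have "coords 0 = {0} \<times> A \<union> {1} \<times> A \<union> {2} \<times> A" unfolding coords_def by auto
    moreover have im: "f ` ({i} \<times> A) = (\<lambda>a. f (i, a)) ` A" for f :: "nat \<times> 'u \<Rightarrow> 'u" and i by auto
    have "y l ` ({0} \<times> A) = e' (l ! 0) ` A" "y l ` ({1} \<times> A) = e' (l ! 1) ` A"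
      unfolding im y01 by simp_all
    moreover have "y l ` ({2} \<times> A) = d l ` A"
      unfolding im by (rule image_cong) (simp_all add: y_def)
    ultimately show ?thesis using M0(2)[of l] unfolding M0(3) by (simp add: image_Un Un_absorb1)
  qed
  then have "enumerates K N (coords 0) (y l)" for l
    unfolding enumerates_def using M0(1)[of l] by metis
  then have "pre 0 (N, e', \<lambda>i. y) W"
    using N e' ns' y_in y01 unfolding pre_def by auto
  then show ?thesis ..
qed

lemma unbounded_0:
  assumes no_swap
  shows "\<exists>P. unbounded 0 P"
proof -
  have "\<exists>Q. \<forall>S :: 'u set. small S \<longrightarrow> (\<exists>x W. pre 0 x W \<and> |S| \<le>o |W| \<and>
    (\<forall>l \<in> inc W (n 0). diag R (fst x) (coords 0) (snd (snd x) 0 l) = Q))"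
  proof (rule homogenize[OF _ _ _ small_Q[of 0]])
    fix S :: "'u set" assume "small S"
    then obtain N where N: "N \<in> Models K" "\<exists>W e. |S| \<le>o |W| \<and> (\<forall>i \<in> W. \<forall>a \<in> A. e i a \<in> univ N) \<and>
      (\<forall>i \<in> W. \<forall>j \<in> W. i \<prec> j \<longrightarrow> \<not> swapped N (e i) (e j))"
      using assms unfolding no_swap_def by blast
    then obtain W e where W: "|S| \<le>o |W|" "\<forall>i \<in> W. \<forall>a \<in> A. e i a \<in> univ N"
      "\<forall>i \<in> W. \<forall>j \<in> W. i \<prec> j \<longrightarrow> \<not> swapped N (e i) (e j)" by blast
    have "\<exists>x. pre 0 x W" by (rule pre_0[where e = e, OF N(1)]) (use W(2,3) in simp_all)
    then show "\<exists>x W. pre 0 x W \<and> |S| \<le>o |W|" using W(1) by blast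
  next
    show "pre 0 x W'" if "pre 0 x W" "W' \<subseteq> W" for x W W' using pre_mono that by blast
    show "diag R (fst x) (coords 0) (snd (snd x) 0 l) \<in> Pow (atoms R (coords 0))" for x l
      using diag_subset by blast
  qed
  then obtain Q where Q: "\<And>S :: 'u set. small S \<Longrightarrow> \<exists>x W. pre 0 x W \<and> |S| \<le>o |W| \<and>
    (\<forall>l \<in> inc W (n 0). diag R (fst x) (coords 0) (snd (snd x) 0 l) = Q)" by blast
  have unb: "unbounded 0 (\<lambda>_. Q)"
    unfolding unbounded_def
  proof (intro allI impI)
    fix S :: "'u set" assume "small S"
    from Q[OF this] obtain x W where x: "pre 0 x W" "|S| \<le>o |W|"
      "\<And>l. l \<in> inc W (n 0) \<Longrightarrow> diag R (fst x) (coords 0) (snd (snd x) 0 l) = Q" by blast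
    then have "types_ok 0 (\<lambda>_. Q) x W" unfolding types_ok_def by simp
    then show "\<exists>x W. pre 0 x W \<and> types_ok 0 (\<lambda>_. Q) x W \<and> |S| \<le>o |W|" using x by blast
  qed
  show ?thesis by (rule exI[of _ "\<lambda>_. Q"]) (rule unb)
qed

text \<open>Each step changes only the entry of the new stage, so the diagonal of the chosen
  sequence agrees with its \<open>k\<close>-th member up to stage \<open>k\<close>.\<close>

lemma unbounded_all:
  assumes no_swap
  shows "\<exists>P. \<forall>k. unbounded k P"
proof -
  have "\<exists>F. \<forall>k. unbounded k (F k) \<and> (\<exists>Q. F (Suc k) = (F k)(Suc k := Q))"
    by (rule dependent_nat_choice) (use unbounded_0[OF assms] unbounded_Suc in blast)+
  then obtain F where F: "\<And>k. unbounded k (F k)" "\<And>k. \<exists>Q. F (Suc k) = (F k)(Suc k := Q)" by blast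
  have F_eq: "F k i = F i i" if "i \<le> k" for i k
    using that
  proof (induction rule: dec_induct)
    case (step m)
    obtain Q where "F (Suc m) = (F m)(Suc m := Q)" using F(2)[of m] by blast
    then have "F (Suc m) i = F m i" using step(1) by simp
    then show ?case using step(3) by simp
  qed simp
  have "unbounded k (\<lambda>i. F i i)" for k
  proof -
    have "types_ok k (F k) x W \<longleftrightarrow> types_ok k (\<lambda>i. F i i) x W" for x W
      unfolding types_ok_def using F_eq[of _ k] by simp
    then show ?thesis using F(1)[of k] unfolding unbounded_def by simp
  qed
  then show ?thesis by blast
qed

end

section \<open>Comparison of neighbouring stages and the swap\<close>

context tower
begin

lemma dep_fam: "dep m (fam m y c)"
proof -
  have "map w [0..<m] = map w' [0..<m]" if "\<forall>i < m. w i = w' i" for w w' :: "nat \<Rightarrow> 'u"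
    using that by simp
  then show ?thesis unfolding dep_def fam_def by metis
qed

lemma fam_comp: "fam m y c (w \<circ> f) = y (map (w \<circ> f) [0..<m]) c"
  by (simp add: fam_def)

lemma realization:
  assumes "unbounded k P"
  obtains N e ys W where "pre k (N, e, ys) W" "types_ok k P (N, e, ys) W" "infinite W"
proof -
  obtain x W where x: "pre k x W" "types_ok k P x W" "|A| \<le>o |W|"
    using assms A(2) unfolding unbounded_def by blast
  then have "infinite W" using A(1) card_of_ordLeq_infinite by blast
  then show thesis using x that by (cases x) blast
qed

context
  fixes k N e ys W
  assumes pre: "pre k (N, e, ys) W"
begin

lemma pre_N: "N \<in> Models K"
  and pre_ys: "ys i l c \<in> univ N"
  and pre_e: "e i' a \<in> univ N"
  and pre_swap: "i' \<in> W \<Longrightarrow> j' \<in> W \<Longrightarrow> i' \<prec> j' \<Longrightarrow> \<not> swapped N (e i') (e j')"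
  and pre_01: "l \<in> inc W 2 \<Longrightarrow> a \<in> A \<Longrightarrow> ys 0 l (0, a) = e (l ! 0) a"
    "l \<in> inc W 2 \<Longrightarrow> a \<in> A \<Longrightarrow> ys 0 l (1, a) = e (l ! 1) a"
  and pre_enum: "j \<le> k \<Longrightarrow> l \<in> inc W (n j) \<Longrightarrow> enumerates K N (coords j) (ys j l)"
  and pre_ev: "j < k \<Longrightarrow> l \<in> inc W (n (Suc j)) \<Longrightarrow> c \<in> coords j \<Longrightarrow>
      ys (Suc j) l c = ev (tern (add_group N)) (T j) (fam (n j) (ys j) c) (nth l)"
proof -
  note P = pre[unfolded pre_def prod.case]
  note P1 = P[THEN conjunct1] P[THEN conjunct2, THEN conjunct1] P[THEN conjunct2, THEN conjunct2,
      THEN conjunct2, THEN conjunct1]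
  note P2 = P[THEN conjunct2, THEN conjunct2, THEN conjunct1] P[THEN conjunct2, THEN conjunct2,
      THEN conjunct2, THEN conjunct2, THEN conjunct1]
  note P3 = P[THEN conjunct2, THEN conjunct2, THEN conjunct2, THEN conjunct2, THEN conjunct2,
      THEN conjunct1]
  note P4 = P[THEN conjunct2, THEN conjunct2, THEN conjunct2, THEN conjunct2, THEN conjunct2,
      THEN conjunct2]
  show "N \<in> Models K" "ys i l c \<in> univ N" "e i' a \<in> univ N" using P1 by blast+
  show "i' \<in> W \<Longrightarrow> j' \<in> W \<Longrightarrow> i' \<prec> j' \<Longrightarrow> \<not> swapped N (e i') (e j')"
    "l \<in> inc W 2 \<Longrightarrow> a \<in> A \<Longrightarrow> ys 0 l (0, a) = e (l ! 0) a"
    "l \<in> inc W 2 \<Longrightarrow> a \<in> A \<Longrightarrow> ys 0 l (1, a) = e (l ! 1) a"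
    using P2 by blast+
  show "j \<le> k \<Longrightarrow> l \<in> inc W (n j) \<Longrightarrow> enumerates K N (coords j) (ys j l)" using P3 by blast
  show "j < k \<Longrightarrow> l \<in> inc W (n (Suc j)) \<Longrightarrow> c \<in> coords j \<Longrightarrow>
      ys (Suc j) l c = ev (tern (add_group N)) (T j) (fam (n j) (ys j) c) (nth l)" using P4 by blast
qed

text \<open>The left inverse \<open>T (j + 1)\<close> cancels \<open>T j\<close>. Hence the old
  coordinates of stage \<open>j + 2\<close> list a member of stage \<open>j\<close>, and with it a
  model \<preceq> \<open>N\<close>.\<close>

lemma pre_twice:
  assumes j: "Suc j < k" and l: "l \<in> inc W (n (Suc (Suc j)))" and c: "c \<in> coords j"
  shows "ys (Suc (Suc j)) l c = ys j (map (nth l \<circ> (\<lambda>i. p j * i + q j)) [0..<n j]) c"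
proof -
  let ?ev = "ev (tern (add_group N))"
  have c': "c \<in> coords (Suc j)" using c by (simp add: coords_Suc)
  have "ys (Suc (Suc j)) l c = ?ev (T (Suc j)) (fam (n (Suc j)) (ys (Suc j)) c) (nth l)"
    by (rule pre_ev[OF j l c'])
  also have "\<dots> = ?ev (T (Suc j)) (?ev (T j) (fam (n j) (ys j) c)) (nth l)"
  proof (rule ev_cong[OF arity_T])
    fix f assume f: "increasing_into (n (Suc j)) (n (Suc (Suc j))) f"
    let ?l = "map (nth l \<circ> f) [0..<n (Suc j)]"
    have "fam (n (Suc j)) (ys (Suc j)) c (nth l \<circ> f) = ?ev (T j) (fam (n j) (ys j) c) (nth ?l)"
      unfolding fam_comp by (rule pre_ev[OF _ inc_sub[OF l f] c]) (use j in simp)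
    also have "\<dots> = ?ev (T j) (fam (n j) (ys j) c) (nth l \<circ> f)"
    proof -
      have "\<forall>i < n (Suc j). ?l ! i = (nth l \<circ> f) i" by simp
      then show ?thesis using ev_dep[OF arity_T[of j] dep_fam, of "tern (add_group N)" "ys j" c]
        unfolding dep_def by blast
    qed
    finally show "fam (n (Suc j)) (ys (Suc j)) c (nth l \<circ> f) = ?ev (T j) (fam (n j) (ys j) c) (nth l \<circ> f)" .
  qed
  also have "\<dots> = fam (n j) (ys j) c (\<lambda>i. l ! (p j * i + q j))"
    using linv[of j] left_module_add_group[OF modules[OF pre_N]] dep_fam pre_ys
    unfolding left_inverse_def by (simp add: fam_def)
  finally show ?thesis by (simp add: fam_def comp_def)
qed

text \<open>One direction only: equations that hold throughout stage \<open>j\<close> survive the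
  operator. That no new equations arise on the old coordinates needs the left inverse.\<close>

lemma diag_ev:
  assumes j: "j < k" and l: "l \<in> inc W (n (Suc j))" and J: "J \<subseteq> coords j" and at: "P \<subseteq> atoms R J"
    and P: "\<And>l. l \<in> inc W (n j) \<Longrightarrow> P \<subseteq> diag R N J (ys j l)"
  shows "P \<subseteq> diag R N J (ys (Suc j) l)"
proof
  fix \<phi> assume \<phi>: "\<phi> \<in> P"
  have a: "\<phi> \<in> atoms R J" using \<phi> at by blast
  have "holds N (\<lambda>c. ev (tern (add_group N)) (T j) (\<lambda>w. fam (n j) (ys j) c w) (nth l)) \<phi>"
  proof (rule holds_ev[OF modules[OF pre_N] a _ arity_T])
    show "fam (n j) (ys j) c w \<in> univ N" for w c unfolding fam_def by (rule pre_ys)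
    fix f assume "increasing_into (n j) (n (Suc j)) f"
    from P[OF inc_sub[OF l this]] \<phi>
    show "holds N (\<lambda>c. fam (n j) (ys j) c (nth l \<circ> f)) \<phi>" unfolding fam_comp diag_def by auto
  qed
  then have "\<phi> \<in> diag R N J (\<lambda>c. ev (tern (add_group N)) (T j) (fam (n j) (ys j) c) (nth l))"
    using a unfolding diag_def by simp
  also have "\<dots> = diag R N J (ys (Suc j) l)"
    by (rule diag_cong) (use pre_ev[OF j l] J in force)
  finally show "\<phi> \<in> diag R N J (ys (Suc j) l)" .
qed

end

text \<open>Preservation gives one inclusion. For the other, an equation of stage
  \<open>k + 1\<close> is preserved to stage \<open>k + 2\<close>, where the old coordinates list
  stage \<open>k\<close> at a subsequence and so have diagram \<open>P k\<close>.\<close>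

lemma types_coherent:
  assumes "unbounded (Suc (Suc k)) P"
  shows "P (Suc k) \<inter> atoms R (coords k) = P k"
proof -
  obtain N e ys W where pre: "pre (Suc (Suc k)) (N, e, ys) W" and ok: "types_ok (Suc (Suc k)) P (N, e, ys) W"
    and W: "infinite W" using realization[OF assms] .
  have ty: "diag R N (coords i) (ys i l) = P i" if "i \<le> Suc (Suc k)" "l \<in> inc W (n i)" for i l
    using ok that unfolding types_ok_def by simp
  have sub: "coords k \<subseteq> coords (Suc k)" by (auto simp: coords_Suc)
  have J: "diag R N (coords k) x = diag R N (coords (Suc k)) x \<inter> atoms R (coords k)" for x
    by (rule diag_restrict[OF sub])
  obtain l1 where l1: "l1 \<in> inc W (n (Suc k))" using inc_nonempty[OF W] by blast
  obtain l2 where l2: "l2 \<in> inc W (n (Suc (Suc k)))" using inc_nonempty[OF W] by blast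
  obtain l0 where "l0 \<in> inc W (n k)" using inc_nonempty[OF W] by blast
  then have at: "P k \<subseteq> atoms R (coords k)" using ty[of k l0] diag_subset[of R N "coords k"
      "ys k l0"] by simp
  have "P k \<subseteq> diag R N (coords k) (ys (Suc k) l1)"
    by (rule diag_ev[OF pre _ l1]) (use ty at in simp_all)
  then have 1: "P k \<subseteq> P (Suc k) \<inter> atoms R (coords k)"
    unfolding J using ty[OF _ l1] by simp
  have "P (Suc k) \<inter> atoms R (coords k) \<subseteq> diag R N (coords k) (ys (Suc (Suc k)) l2)"
  proof (rule diag_ev[OF pre _ l2 sub Int_lower2])
    show "P (Suc k) \<inter> atoms R (coords k) \<subseteq> diag R N (coords k) (ys (Suc k) l)"
      if "l \<in> inc W (n (Suc k))" for l unfolding J using ty[OF _ that] by simp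
  qed simp
  also have "\<dots> = diag R N (coords k) (ys k (map (nth l2 \<circ> (\<lambda>i. p k * i + q k)) [0..<n k]))"
    by (rule diag_cong) (rule pre_twice[OF pre _ l2], auto)
  also have "\<dots> = P k" by (rule ty[OF _ inc_sub[OF l2 main]]) simp
  finally show ?thesis using 1 by blast
qed

text \<open>Provides the \<preceq>-step of length two that the limit construction requires.\<close>

lemma types_realized:
  assumes "unbounded (Suc (Suc k)) P"
  shows "\<exists>N x. enumerates K N (coords (Suc (Suc k))) x \<and> enumerates K N (coords k) x \<and>
    diag R N (coords (Suc (Suc k))) x = P (Suc (Suc k))"
proof -
  obtain N e ys W where pre: "pre (Suc (Suc k)) (N, e, ys) W" and ok: "types_ok (Suc (Suc k)) P (N, e, ys) W"
    and W: "infinite W" using realization[OF assms] .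
  obtain l where l: "l \<in> inc W (n (Suc (Suc k)))" using inc_nonempty[OF W] by blast
  let ?l = "map (nth l \<circ> (\<lambda>i. p k * i + q k)) [0..<n k]"
  have "enumerates K N (coords k) (ys k ?l)"
    by (rule pre_enum[OF pre _ inc_sub[OF l main]]) simp
  moreover have "ys (Suc (Suc k)) l ` coords k = ys k ?l ` coords k"
    by (rule image_cong) (auto intro!: pre_twice[OF pre _ l])
  ultimately have "enumerates K N (coords k) (ys (Suc (Suc k)) l)" unfolding enumerates_def by simp
  moreover have "enumerates K N (coords (Suc (Suc k))) (ys (Suc (Suc k)) l)"
    by (rule pre_enum[OF pre _ l]) simp
  moreover have "diag R N (coords (Suc (Suc k))) (ys (Suc (Suc k)) l) = P (Suc (Suc k))"
    using ok l unfolding types_ok_def by simp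
  ultimately show ?thesis by blast
qed

text \<open>For l0, l1, l2, l3 increasing, the swap operator makes stage 1 list e(l2) and e(l1) on
  levels 0 and 1, while stage 0 at (l1, l2) lists e(l1) and e(l2). Both have diagram
  \<open>P 0\<close> on \<open>coords 0\<close>, so matching coordinates exchanges the two
  tuples.\<close>

lemma not_no_swap: "\<not> no_swap"
proof
  assume no_swap
  then obtain P where P: "\<And>k. unbounded k P" using unbounded_all by blast
  obtain N e ys W where pre: "pre 1 (N, e, ys) W" and ok: "types_ok 1 P (N, e, ys) W" and W: "infinite W"
    using realization[OF P[of 1]] .
  obtain l where l: "l \<in> inc W 4" using inc_nonempty[OF W] by blast
  let ?x = "ys 1 l"
  have ty: "diag R N (coords i) (ys i l) = P i" if "i \<le> 1" "l \<in> inc W (n i)" for i l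
    using ok that unfolding types_ok_def by simp
  have sm: "small (\<Union>k. coords k)"
    by (rule small_UN[OF small_nat]) (rule small_coords)
  \<comment> \<open>By construction stage 1 enumerates a model on \<open>coords 1\<close> only. That
    its part on \<open>coords 0\<close> is a model \<preceq> \<open>N\<close> as well is what the
    infinite tower yields.\<close>
  have enum1: "enumerates K N (coords 0) ?x"
  proof (rule tower_limit[OF aec _ sm, of P N ?x])
    show "coords k \<subseteq> coords (Suc k)" for k by (auto simp: coords_Suc)
    show "P (Suc k) \<inter> atoms R (coords k) = P k" for k by (rule types_coherent[OF P])
    show "enumerates K N (coords 1) ?x" using pre_enum[OF pre, of 1 l] l n by simp
    show "diag R N (coords 1) ?x = P 1" using ty[of 1 l] l n by simp
  qed (rule types_realized[OF P])
  have lts: "l ! 0 \<prec> l ! 1" "l ! 0 \<prec> l ! 3" "l ! 1 \<prec> l ! 2" "l ! 2 \<prec> l ! 3"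
    and lW: "l ! 0 \<in> W" "l ! 1 \<in> W" "l ! 2 \<in> W" "l ! 3 \<in> W"
    using l unfolding inc_nth by auto
  have two: "[a, b] \<in> inc W 2" if "a \<in> W" "b \<in> W" "a \<prec> b" for a b
    using that unfolding inc_def by simp
  let ?x' = "ys 0 [l ! 1, l ! 2]"
  have l': "[l ! 1, l ! 2] \<in> inc W (n 0)" unfolding n by (rule two) (use lW lts in auto)
  have enum0: "enumerates K N (coords 0) ?x'" by (rule pre_enum[OF pre _ l']) simp
  have G: "comm_group (add_group N)" by (rule left_module_add_group[OF modules[OF pre_N[OF pre]]])
  have up: "[0..<2] = [0, 1 :: nat]" by (simp add: numeral_2_eq_2)
  have ev0: "?x (i, a) = tern (add_group N) (ys 0 [l ! 2, l ! 3] (i, a)) (ys 0 [l ! 0, l ! 3] (i, a)) (ys 0 [l ! 0, l ! 1] (i, a))"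
    if "i \<le> 1" "a \<in> A" for i a
    using pre_ev[OF pre, of 0 l "(i, a)"] l n that
    by (simp add: T0 swap_trm_def fam_def up coords_def)
  have y0: "ys 0 [v, w] (0, a) = e v a" and y1: "ys 0 [v, w] (1, a) = e w a"
    if "v \<in> W" "w \<in> W" "v \<prec> w" "a \<in> A" for v w a
    using pre_01[OF pre two[OF that(1-3)] that(4)] by simp_all
  have x0: "?x (0, a) = e (l ! 2) a" and x1: "?x (1, a) = e (l ! 1) a" if a: "a \<in> A" for a
  proof -
    have e: "e v a \<in> carrier (add_group N)" for v using pre_e[OF pre] by simp
    show "?x (0, a) = e (l ! 2) a"
      unfolding ev0[OF zero_le a] y0[OF lW(3,4) lts(4) a] y0[OF lW(1,4) lts(2) a] y0[OF lW(1,2) lts(1) a]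
      by (rule comm_group.tern_same(1)[OF G e e])
    show "?x (1, a) = e (l ! 1) a"
      unfolding ev0[OF order_refl a] y1[OF lW(3,4) lts(4) a] y1[OF lW(1,4) lts(2) a] y1[OF lW(1,2) lts(1) a]
      by (rule comm_group.tern_same(2)[OF G e e])
  qed
  have x'0: "?x' (0, a) = e (l ! 1) a" and x'1: "?x' (1, a) = e (l ! 2) a" if "a \<in> A" for a
    using y0[OF lW(2,3) lts(3) that] y1[OF lW(2,3) lts(3) that] by simp_all
  obtain N0 where N0: "sleq K N0 N" "univ N0 = ?x' ` coords 0" using enum0
      unfolding enumerates_def by blast
  obtain N1 where N1: "sleq K N1 N" "univ N1 = ?x ` coords 0" using enum1
      unfolding enumerates_def by blast
  have "diag R N0 (coords 0) ?x' = P 0"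
    using diag_substructure[OF AEC_D(4)[OF aec N0(1)], of ?x' "coords 0"] N0(2) ty[OF _ l'] by simp
  moreover have "diag R N1 (coords 0) ?x = P 0"
  proof -
    have "diag R N1 (coords 0) ?x = diag R N (coords 0) ?x"
      using diag_substructure[OF AEC_D(4)[OF aec N1(1)], of ?x "coords 0"] N1(2) by simp
    also have "\<dots> = diag R N (coords 1) ?x \<inter> atoms R (coords 0)"
      by (rule diag_restrict) (auto simp: coords_def)
    also have "\<dots> = P 0" using ty[of 1 l] l n types_coherent[OF P, of 0] by simp
    finally show ?thesis .
  qed
  ultimately obtain f where f: "rstr_iso R N0 N1 f" "\<And>c. c \<in> coords 0 \<Longrightarrow> f (?x' c) = ?x c"
    using diag_iso_ex[OF AEC_D(1)[OF aec AEC_D(5)[OF aec N0(1)]] AEC_D(1)[OF aec AEC_D(5)[OF aec N1(1)]]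
        N0(2) N1(2)] by metis
  have c: "(0, a) \<in> coords 0" "(1, a) \<in> coords 0" if "a \<in> A" for a using that
      by (simp_all add: coords_def)
  have "swapped N (e (l ! 1)) (e (l ! 2))"
    unfolding swapped_def
  proof (intro exI conjI ballI)
    show "e (l ! 1) ` A \<union> e (l ! 2) ` A \<subseteq> univ N0"
      unfolding N0(2) using c x'0 x'1 by (auto simp: image_iff) metis+
    fix a assume a: "a \<in> A"
    show "f (e (l ! 1) a) = e (l ! 2) a" using f(2)[OF c(1)[OF a]] x'0[OF a] x0[OF a] by simp
    show "f (e (l ! 2) a) = e (l ! 1) a" using f(2)[OF c(2)[OF a]] x'1[OF a] x1[OF a] by simp
  qed (rule N0(1) N1(1) f(1))+
  then show False using pre_swap[OF pre] lW lts by blast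
qed

end

context module_aec
begin

lemma swap_theorem:
  "\<exists>S :: 'u set. small S \<and> (\<forall>N \<in> Models K. \<forall>W e. |S| \<le>o |W| \<longrightarrow>
    (\<forall>i \<in> W. \<forall>a \<in> A. e i a \<in> univ N) \<longrightarrow> (\<exists>i \<in> W. \<exists>j \<in> W. i \<prec> j \<and> swapped N (e i) (e j)))"
proof -
  obtain n p q T where ops: "n 0 = 2" "n 1 = 4" "T 0 = swap_trm" "\<And>k. arity (n k) (n (Suc k)) (T k)"
    "\<And>k. increasing_into (n k) (n (Suc (Suc k))) (\<lambda>j. p k * j + q k)"
    "\<And>k. left_inverse u (n k) (T k) (p k) (q k) (T (Suc k))"
    by (rule operator_tower[of u]) (rule that, assumption+)
  interpret tower u R K A n p q T
    by unfold_locales (fact ops)+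
  from not_no_swap show ?thesis unfolding no_swap_def by blast
qed

end


section \<open>Half graphs\<close>

context universe
begin

text \<open>
  Shelah's argument that many types give a half graph: if \<open>c \<in> X\<close> splits over every small subset
  of a set \<open>C\<close> of size \<open>\<mu>\<close> in which all small parts of the functions \<open>f x\<close> are realised, then a
  half graph can be built by recursion. Otherwise every \<open>f c\<close> is determined by a sequence in \<open>C\<close>
  and a function on the set of colour patterns over that sequence, and there are only \<open>\<mu>\<close> of
  those.
\<close>

lemma half_graph:
  fixes f :: "'c \<Rightarrow> 'y \<Rightarrow> 't" and V :: "'u set" and \<mu> :: "'m rel"
  assumes \<mu>: "Cinfinite \<mu>" and V: "V \<noteq> {}"
    and pow: "\<mu> ^c |V| \<le>o \<mu>" and pow2: "|Func (Func V Q) Q| \<le>o \<mu>" and Q: "|Q| \<le>o \<mu>"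
    and Y: "|Y| \<le>o \<mu>" and X: "\<not> |X| \<le>o \<mu>"
    and f: "\<And>x y. x \<in> X \<Longrightarrow> y \<in> Y \<Longrightarrow> f x y \<in> Q"
    and sep: "\<And>x x'. x \<in> X \<Longrightarrow> x' \<in> X \<Longrightarrow> x \<noteq> x' \<Longrightarrow> \<exists>y \<in> Y. f x y \<noteq> f x' y"
  shows "\<exists>c a b. (\<forall>i \<in> V. c i \<in> X \<and> a i \<in> Y \<and> b i \<in> Y) \<and>
    (\<forall>i \<in> V. \<forall>j \<in> V. j \<prec> i \<longrightarrow> f (c j) (a i) = f (c j) (b i)) \<and>
    (\<forall>i \<in> V. \<forall>j \<in> V. \<not> i \<prec> j \<longrightarrow> f (c i) (a j) \<noteq> f (c i) (b j))"
proof -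
  have Fin: "infinite (Field \<mu>)" "Card_order \<mu>" using \<mu> unfolding cinfinite_def by simp_all
  have times: "|Z \<times> Z'| \<le>o \<mu>" if "|Z| \<le>o \<mu>" "|Z'| \<le>o \<mu>" for Z :: "'z set" and Z' :: "'z' set"
    by (rule card_of_Times_ordLeq_infinite_Field[OF Fin(1) that Fin(2)])
  have func: "|Func V Z| \<le>o \<mu>" if "|Z| \<le>o \<mu>" for Z :: "'z set"
  proof -
    have "|Z| ^c |V| \<le>o \<mu> ^c |V|" by (rule cexp_mono1[OF that card_of_Card_order])
    then show ?thesis using pow ordLeq_transitive unfolding cexp_def Field_card_of by blast
  qed
  have fin: "|Z| \<le>o \<mu>" if "finite Z" for Z :: "'z set"
    using Fin that by (intro ordLess_imp_ordLeq finite_ordLess_infinite)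
      (simp_all add: Field_card_of card_of_well_order_on card_order_on_well_order_on)
  obtain x0 where x0: "x0 \<in> X" using X fin[of "{}"] by fastforce
  have "\<exists>x1 \<in> X. x1 \<noteq> x0"
  proof (rule ccontr)
    assume "\<not> ?thesis"
    then have "X \<subseteq> {x0}" by blast
    then show False using X fin[of X] finite_subset by blast
  qed
  then obtain y0 where y0: "y0 \<in> Y" using sep x0 by blast
  define agree where "agree c ab c' \<longleftrightarrow> (\<forall>j \<in> V. f c' (fst (ab j)) = f c (fst (ab j)) \<and>
      f c' (snd (ab j)) = f c (snd (ab j)))"
    for c c' and ab :: "'u \<Rightarrow> 'y \<times> 'y"
  define pat where "pat c ab = (\<lambda>j. if j \<in> V then (f c (fst (ab j)), f c (snd (ab j))) else undefined)"
    for c and ab :: "'u \<Rightarrow> 'y \<times> 'y"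
  define sel where "sel z = (SOME c. c \<in> X \<and> pat c (fst z) = snd z)"
      for z :: "('u \<Rightarrow> 'y \<times> 'y) \<times> ('u \<Rightarrow> 't \<times> 't)"
  define D where "D = Func V (Y \<times> Y) \<times> Func V (Q \<times> Q)"
  \<comment> \<open>One element of \<open>X\<close> for each sequence of pairs and each colour
    pattern that \<open>X\<close> realises over it; the intersection removes the choices made for
    patterns that do not occur.\<close>
  define C where "C = sel ` D \<inter> X"
  have "|D| \<le>o \<mu>" unfolding D_def by (intro times func Y Q)
  moreover have "|C| \<le>o |D|"
    unfolding C_def using card_of_mono1[OF Int_lower1] card_of_image ordLeq_transitive by blast
  ultimately have C_card: "|C| \<le>o \<mu>" using ordLeq_transitive by blast
  have CX: "C \<subseteq> X" unfolding C_def by blast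
  have C_real: "\<exists>c' \<in> C. agree c ab c'" if c: "c \<in> X" and ab: "\<And>j. j \<in> V \<Longrightarrow> ab j \<in> Y \<times> Y" for c ab
  proof -
    define ab' where "ab' = (\<lambda>j. if j \<in> V then ab j else undefined)"
    have "ab' \<in> Func V (Y \<times> Y)" unfolding ab'_def Func_def using ab by simp
    moreover have "pat c ab' \<in> Func V (Q \<times> Q)"
      unfolding pat_def ab'_def Func_def using ab f[OF c] by (auto simp: mem_Times_iff)
    ultimately have d: "(ab', pat c ab') \<in> D" unfolding D_def by simp
    let ?c = "sel (ab', pat c ab')"
    have "\<exists>c'. c' \<in> X \<and> pat c' (fst (ab', pat c ab')) = snd (ab', pat c ab')" using c by auto
    from someI_ex[OF this] have s: "?c \<in> X" "pat ?c ab' = pat c ab'" unfolding sel_def by simp_all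
    have "agree c ab ?c" unfolding agree_def
    proof
      fix j assume j: "j \<in> V"
      have "pat ?c ab' j = pat c ab' j" using s(2) by simp
      then show "f ?c (fst (ab j)) = f c (fst (ab j)) \<and> f ?c (snd (ab j)) = f c (snd (ab j))"
        using j unfolding pat_def ab'_def by simp
    qed
    then show ?thesis using s(1) d unfolding C_def by blast
  qed
  obtain c0 where c0: "c0 \<in> C" using C_real[OF x0, of "\<lambda>_. (y0, y0)"] y0 by blast
  \<comment> \<open>This \<open>c\<close> splits over every \<open>V\<close>-sequence from
    \<open>C\<close> and is the element that the recursion imitates.\<close>
  have "\<exists>c \<in> X. \<forall>d. (\<forall>j \<in> V. d j \<in> C) \<longrightarrow>
    (\<exists>y \<in> Y. \<exists>y' \<in> Y. (\<forall>j \<in> V. f (d j) y = f (d j) y') \<and> f c y \<noteq> f c y')"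
  proof (rule ccontr)
    assume "\<not> ?thesis"
    then have "\<forall>c \<in> X. \<exists>d. (\<forall>j \<in> V. d j \<in> C) \<and>
      (\<forall>y \<in> Y. \<forall>y' \<in> Y. (\<forall>j \<in> V. f (d j) y = f (d j) y') \<longrightarrow> f c y = f c y')" by metis
    then obtain d where d: "\<And>c j. c \<in> X \<Longrightarrow> j \<in> V \<Longrightarrow> d c j \<in> C"
      "\<And>c y y'. c \<in> X \<Longrightarrow> y \<in> Y \<Longrightarrow> y' \<in> Y \<Longrightarrow> (\<And>j. j \<in> V \<Longrightarrow> f (d c j) y = f (d c j) y') \<Longrightarrow> f c y = f c y'"
      by metis
    define row where "row c y = (\<lambda>j. if j \<in> V then f (d c j) y else undefined)" for c y
    \<comment> \<open>\<open>G c\<close> reads \<open>f c y\<close> off the row of colours of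
      \<open>y\<close> over the sequence \<open>d c\<close>. Any \<open>y\<close> with that row may
      be used, as \<open>c\<close> does not split over \<open>d c\<close>; \<open>y0\<close> covers
      rows that do not occur.\<close>
    define G where "G c = (\<lambda>s. if s \<in> Func V Q
      then f c (if \<exists>y \<in> Y. row c y = s then SOME y. y \<in> Y \<and>
          row c y = s else y0) else undefined)" for c
    define d' where "d' c = (\<lambda>j. if j \<in> V then d c j else undefined)" for c
    have row: "row c y \<in> Func V Q" if "c \<in> X" "y \<in> Y" for c y
      unfolding row_def Func_def using f[OF subsetD[OF CX d(1)[OF that(1)]] that(2)] by auto
    have sm: "(SOME y'. y' \<in> Y \<and> row c y' = s) \<in> Y" "row c (SOME y'. y' \<in> Y \<and> row c y' = s) = s"
      if "\<exists>y \<in> Y. row c y = s" for c s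
    proof -
      have "\<exists>y'. y' \<in> Y \<and> row c y' = s" using that by blast
      from someI_ex[OF this] show "(SOME y'. y' \<in> Y \<and> row c y' = s) \<in> Y"
        "row c (SOME y'. y' \<in> Y \<and> row c y' = s) = s" by simp_all
    qed
    have G: "G c (row c y) = f c y" if c: "c \<in> X" and y: "y \<in> Y" for c y
    proof -
      let ?y = "SOME y'. y' \<in> Y \<and> row c y' = row c y"
      have ex: "\<exists>y' \<in> Y. row c y' = row c y" using y by blast
      have "f c ?y = f c y"
      proof (rule d(2)[OF c sm(1)[OF ex] y])
        fix j assume "j \<in> V"
        then show "f (d c j) ?y = f (d c j) y" using fun_cong[OF sm(2)[OF ex], of j]
            unfolding row_def by simp
      qed
      then show ?thesis unfolding G_def using row[OF c y] ex by simp
    qed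
    have G_in: "G c \<in> Func (Func V Q) Q" if c: "c \<in> X" for c
      unfolding G_def Func_def using f[OF c] sm(1) y0 by auto
    have d'_in: "d' c \<in> Func V C" if c: "c \<in> X" for c
      unfolding d'_def Func_def using d(1)[OF c] by simp
    have "inj_on (\<lambda>c. (d' c, G c)) X"
    proof (rule inj_onI, rule ccontr)
      fix c c' assume c: "c \<in> X" "c' \<in> X" "(d' c, G c) = (d' c', G c')" "c \<noteq> c'"
      then obtain y where y: "y \<in> Y" "f c y \<noteq> f c' y" using sep by blast
      have "row c y = row c' y"
      proof
        fix j
        have "d' c j = d' c' j" using c(3) by simp
        then show "row c y j = row c' y j" unfolding row_def d'_def by (cases "j \<in> V") simp_all
      qed
      then show False using G[OF c(1) y(1)] G[OF c(2) y(1)] c(3) y(2) by simp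
    qed
    moreover have "(\<lambda>c. (d' c, G c)) ` X \<subseteq> Func V C \<times> Func (Func V Q) Q" using G_in d'_in by auto
    ultimately have "|X| \<le>o |Func V C \<times> Func (Func V Q) Q|" unfolding card_of_ordLeq[symmetric]
        by blast
    moreover have "|Func V C \<times> Func (Func V Q) Q| \<le>o \<mu>" by (intro times func C_card pow2)
    ultimately show False using X ordLeq_transitive by blast
  qed
  then obtain c where c: "c \<in> X" "\<And>d. (\<And>j. j \<in> V \<Longrightarrow> d j \<in> C) \<Longrightarrow>
    \<exists>y y'. y \<in> Y \<and> y' \<in> Y \<and> (\<forall>j \<in> V. f (d j) y = f (d j) y') \<and> f c y \<noteq> f c y'" by metis
  \<comment> \<open>At step \<open>i\<close> a pair (a, b) is chosen that \<open>c\<close> separates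
    and no earlier choice from \<open>C\<close> does; then \<open>c'\<close> in \<open>C\<close>
    imitates \<open>c\<close> on this pair and on all earlier ones.\<close>
  define ok where "ok g i z \<longleftrightarrow> (case z of (a, b, c') \<Rightarrow> a \<in> Y \<and> b \<in> Y \<and> c' \<in> C \<and> f c a \<noteq> f c b \<and>
    f c' a = f c a \<and> f c' b = f c b \<and> (\<forall>j \<in> V. j \<prec> i \<longrightarrow> (case g j of (a', b', c'') \<Rightarrow>
      f c'' a = f c'' b \<and> f c' a' = f c a' \<and> f c' b' = f c b')))"
    for g :: "'u \<Rightarrow> 'y \<times> 'y \<times> 'c" and i z
  define g where "g = wfrec {(x, y). x \<prec> y} (\<lambda>g i. SOME z. ok g i z)"
  have g: "g i = (SOME z. ok g i z)" for i
  proof -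
    have "g i = (SOME z. ok (cut g {(x, y). x \<prec> y} i) i z)"
      unfolding g_def by (rule wfrec[OF wf_lt])
    moreover have "ok (cut g {(x, y). x \<prec> y} i) i z \<longleftrightarrow> ok g i z" for z
      unfolding ok_def by (simp add: cut_apply)
    ultimately show ?thesis by simp
  qed
  have ok: "i \<in> V \<longrightarrow> ok g i (g i)" for i
  proof (induction i rule: lt_induct)
    case (less i)
    define a where "a j = fst (g j)" for j
    define b where "b j = fst (snd (g j))" for j
    define c' where "c' j = snd (snd (g j))" for j
    have gj: "g j = (a j, b j, c' j)" for j unfolding a_def b_def c'_def by simp
    have IH: "a j \<in> Y" "b j \<in> Y" "c' j \<in> C" if "j \<in> V" "j \<prec> i" for j
      using less[OF that(2)] that(1) unfolding ok_def gj by simp_all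
    have "\<exists>z. ok g i z" if i: "i \<in> V"
    proof -
      define d where "d j = (if j \<prec> i then c' j else c0)" for j
      have "d j \<in> C" if "j \<in> V" for j unfolding d_def using IH(3)[OF that] c0 by simp
      from c(2)[of d, OF this] obtain y y' where y: "y \<in> Y" "y' \<in> Y"
          "\<forall>j \<in> V. f (d j) y = f (d j) y'" "f c y \<noteq> f c y'"
        by blast
      \<comment> \<open>The new pair fills all places from \<open>i\<close> on, in particular
        \<open>i\<close> itself, so that \<open>z\<close> imitates \<open>c\<close> on the new pair
        too.\<close>
      define ab where "ab j = (if j \<prec> i then (a j, b j) else (y, y'))" for j
      have "ab j \<in> Y \<times> Y" if "j \<in> V" for j unfolding ab_def using IH[OF that] y by simp
      from C_real[OF c(1), of ab, OF this] obtain z where z: "z \<in> C" "agree c ab z" by blast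
      have z1: "f z y = f c y" "f z y' = f c y'" using z(2) i unfolding agree_def ab_def by force+
      have z2: "f z (a j) = f c (a j) \<and> f z (b j) = f c (b j)" if "j \<in> V" "j \<prec> i" for j
        using z(2) that unfolding agree_def ab_def by force
      have z3: "f (c' j) y = f (c' j) y'" if "j \<in> V" "j \<prec> i" for j
        using y(3) that unfolding d_def by force
      have "ok g i (y, y', z)" unfolding ok_def gj using y z(1) z1 z2 z3 by simp
      then show ?thesis ..
    qed
    then show ?case using g[of i] someI_ex[of "ok g i"] by simp
  qed
  define a where "a j = fst (g j)" for j
  define b where "b j = fst (snd (g j))" for j
  define c' where "c' j = snd (snd (g j))" for j
  have gj: "g j = (a j, b j, c' j)" for j unfolding a_def b_def c'_def by simp
  have ok1: "a i \<in> Y" "b i \<in> Y" "c' i \<in> C" "f c (a i) \<noteq> f c (b i)" "f (c' i) (a i) = f c (a i)"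
      "f (c' i) (b i) = f c (b i)"
    if "i \<in> V" for i using ok[of i] that unfolding ok_def gj by simp_all
  have ok2: "f (c' j) (a i) = f (c' j) (b i)" "f (c' i) (a j) = f c (a j)"
      "f (c' i) (b j) = f c (b j)"
    if "i \<in> V" "j \<in> V" "j \<prec> i" for i j using ok[of i] that unfolding ok_def gj by simp_all
  have "f (c' i) (a j) \<noteq> f (c' i) (b j)" if ij: "i \<in> V" "j \<in> V" "\<not> i \<prec> j" for i j
  proof (cases "i = j")
    case True
    then show ?thesis using ok1[OF ij(1)] by simp
  next
    case False
    then have "j \<prec> i" using lt_total ij(3) by blast
    then show ?thesis using ok2(2,3)[OF ij(1,2)] ok1(4)[OF ij(2)] by simp
  qed
  note nsym = this
  show ?thesis
  proof (intro exI conjI ballI impI)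
    fix i assume i: "i \<in> V"
    show "c' i \<in> X" "a i \<in> Y" "b i \<in> Y" using ok1(1-3)[OF i] CX by blast+
  next
    fix i j assume ij: "i \<in> V" "j \<in> V"
    show "j \<prec> i \<Longrightarrow> f (c' j) (a i) = f (c' j) (b i)" by (rule ok2(1)[OF ij])
    show "\<not> i \<prec> j \<Longrightarrow> f (c' i) (a j) \<noteq> f (c' i) (b j)" by (rule nsym[OF ij])
  qed
qed

end


section \<open>Amalgamation and types of tuples\<close>

lemma rstr_iso_K_embedding:
  assumes "AEC R K" "M \<in> Models K" "rstr_iso R M N f"
  shows "K_embedding R K M N f"
  unfolding K_embedding_def
  by (intro exI[of _ N] conjI assms(3) AEC_D(2)[OF assms(1) AEC_D(7)[OF assms]])

lemma sleq_K_embedding: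
  assumes "AEC R K" "sleq K M N"
  shows "K_embedding R K M N (\<lambda>x. x)"
  unfolding K_embedding_def
  by (intro exI[of _ M] conjI assms(2) rstr_iso_id[OF AEC_D(1)[OF assms(1) AEC_D(5)[OF assms]]])

lemma K_embedding_comp:
  assumes K: "AEC R K" and f: "K_embedding R K M N f" and g: "K_embedding R K N P g"
  shows "K_embedding R K M P (g \<circ> f)"
proof -
  obtain M' where M': "rstr_iso R M M' f" "sleq K M' N" using f unfolding K_embedding_def by blast
  obtain N' where N': "rstr_iso R N N' g" "sleq K N' P" using g unfolding K_embedding_def by blast
  from sleq_iso[OF K M'(2) N'(1)] obtain M'' where "rstr_iso R M' M'' g" "sleq K M'' N'" .
  then show ?thesis
    unfolding K_embedding_def
    by (intro exI[of _ M''] conjI rstr_iso_comp[OF M'(1)] AEC_D(3)[OF K _ N'(2)])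
qed

lemma K_embedding_univ: "AEC R K \<Longrightarrow> K_embedding R K M N f \<Longrightarrow> f ` univ M \<subseteq> univ N"
  unfolding K_embedding_def using rstr_iso_univ sleq_univ by metis

lemma K_embedding_inj: "K_embedding R K M N f \<Longrightarrow> inj_on f (univ M)"
  unfolding K_embedding_def using rstr_iso_inj by blast

text \<open>The target serves as its own amalgam, with the identity as second embedding.\<close>

lemma ortp_embedding:
  assumes K: "AEC R K" and N: "N1 \<in> Models K" "N2 \<in> Models K" and f: "K_embedding R K N1 N2 f"
    and B: "B \<subseteq> univ N1" "\<And>x. x \<in> B \<Longrightarrow> f x = x" and b: "b \<in> univ N1"
  shows "ortp R K b B N1 = ortp R K (f b) B N2"
proof -
  have im: "f ` univ N1 \<subseteq> univ N2" by (rule K_embedding_univ[OF K f])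
  have B2: "B \<subseteq> univ N2"
  proof
    fix x assume x: "x \<in> B"
    then have "f x \<in> univ N2" using im B(1) by blast
    then show "x \<in> univ N2" using B(2)[OF x] by simp
  qed
  have "((b, B, N1), (f b, B, N2)) \<in> E_prime R K"
    unfolding E_prime_def
    by (intro CollectI exI[of _ b] exI[of _ "f b"] exI[of _ B] exI[of _ N1] exI[of _ N2] exI[of _ f]
        exI[of _ "\<lambda>x. x"] conjI refl N B(1) B2 b f K_embedding_id[OF K N(2)])
      (use B(2) b im in auto)
  then show ?thesis unfolding ortp_def by (intro ortp_eqI) blast
qed

context universe
begin

text \<open>The complement of a small set is as large as \<open>'u\<close>, so the remaining
  elements of \<open>X\<close> can be sent there.\<close>

lemma inj_extend:
  fixes g :: "'u \<Rightarrow> 'u"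
  assumes X: "small X" "S \<subseteq> X" and g: "inj_on g S"
  shows "\<exists>h. inj_on h X \<and> (\<forall>x \<in> S. h x = g x)"
proof -
  have "small (g ` S)" using small_image[OF small_mono[OF X]] .
  then have "\<not> small (- (g ` S))"
    using small_Un[of "g ` S" "- (g ` S)"] ordLess_irreflexive[of "|UNIV :: 'u set|"]
    unfolding small_def Compl_partition by blast
  then have "|UNIV :: 'u set| \<le>o |- (g ` S)|"
    unfolding small_def using not_ordLess_iff_ordLeq[OF card_of_Well_order card_of_Well_order]
        by blast
  then have "|X| \<le>o |- (g ` S)|"
    using ordLeq_transitive[OF ordLess_imp_ordLeq[OF X(1)[unfolded small_def]]] by blast
  then obtain j where j: "inj_on j X" "j ` X \<subseteq> - (g ` S)" unfolding card_of_ordLeq[symmetric]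
      by blast
  let ?h = "\<lambda>x. if x \<in> S then g x else j x"
  have "inj_on ?h X"
  proof (rule inj_onI)
    fix x y assume xy: "x \<in> X" "y \<in> X" "?h x = ?h y"
    have "j x \<notin> g ` S" "j y \<notin> g ` S" using j(2) xy(1,2) by blast+
    then have "j x \<noteq> g y" if "y \<in> S" for y using that by blast
    moreover have "j y \<noteq> g x" if "x \<in> S" for x using \<open>j y \<notin> g ` S\<close> that by blast
    ultimately show "x = y" using xy g j(1) by (auto split: if_splits dest: inj_onD) metis
  qed
  then show ?thesis by (intro exI[of _ ?h]) simp
qed

text \<open>Replaces a model by a copy with prescribed names on \<open>S\<close>; this is how
  embeddings are turned into inclusions.\<close>

lemma rename:
  fixes K :: "('r, 'u) abstract_class"
  assumes K: "AEC R K" and N: "N \<in> Models K" and S: "S \<subseteq> univ N" and g: "inj_on g S"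
  shows "\<exists>N' h. rstr_iso R N N' h \<and> N' \<in> Models K \<and> (\<forall>x \<in> S. h x = g x)"
proof -
  have "small (univ N)" using AEC_D(1)[OF K N] unfolding rstructure_def small_def by blast
  from inj_extend[OF this S g] obtain h where h: "inj_on h (univ N)" "\<forall>x \<in> S. h x = g x" by blast
  from rstr_copy[OF AEC_D(1)[OF K N] h(1)] obtain N' where "rstr_iso R N N' h" .
  then show ?thesis using h(2) AEC_D(7)[OF K N] by blast
qed

text \<open>The amalgam is renamed so that the first embedding becomes the inclusion. Then it
  extends \<open>N1\<close> itself, as iterated amalgamation requires.\<close>

lemma amalgamate_over:
  fixes K :: "('r, 'u) abstract_class"
  assumes K: "AEC R K" and ap: "amalgamation R K" and M: "sleq K M N1" "sleq K M N2"
  shows "\<exists>N f. sleq K N1 N \<and> K_embedding R K N2 N f \<and> (\<forall>x \<in> univ M. f x = x)"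
proof -
  obtain N0 f1 f2 where N0: "N0 \<in> Models K" "K_embedding R K N1 N0 f1" "K_embedding R K N2 N0 f2"
    "\<forall>x \<in> univ M. f1 x = f2 x"
    using ap M unfolding amalgamation_def by blast
  obtain N1' where N1': "rstr_iso R N1 N1' f1" "sleq K N1' N0" using N0(2)
      unfolding K_embedding_def by blast
  let ?g = "inv_into (univ N1) f1"
  have inj: "inj_on f1 (univ N1)" by (rule rstr_iso_inj[OF N1'(1)])
  have u: "univ N1' = f1 ` univ N1" by (rule rstr_iso_univ[OF N1'(1)])
  have "inj_on ?g (univ N1')" unfolding u by (rule inj_on_inv_into) simp
  from rename[OF K N0(1) sleq_univ[OF K N1'(2)] this] obtain N h
    where h: "rstr_iso R N0 N h" "N \<in> Models K" "\<forall>x \<in> univ N1'. h x = ?g x" by blast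
  have hf: "(h \<circ> f1) x = x" if "x \<in> univ N1" for x using h(3) inj that unfolding u by simp
  from sleq_iso[OF K N1'(2) h(1)] obtain N1'' where N1'': "rstr_iso R N1' N1'' h" "sleq K N1'' N" .
  have "rstr_iso R N1 N1'' (\<lambda>x. x)"
    by (rule rstr_iso_cong[OF rstr_iso_comp[OF N1'(1) N1''(1)] hf])
  then have "N1'' = N1"
    using rstr_iso_unique rstr_iso_id[OF AEC_D(1)[OF K AEC_D(6)[OF K M(1)]]] by blast
  then have "sleq K N1 N" using N1''(2) by simp
  moreover have "K_embedding R K N2 N (h \<circ> f2)"
    by (rule K_embedding_comp[OF K N0(3) rstr_iso_K_embedding[OF K N0(1) h(1)]])
  moreover have "(h \<circ> f2) x = x" if "x \<in> univ M" for x
    using N0(4) hf sleq_univ[OF K M(1)] that by (metis comp_apply subsetD)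
  ultimately show ?thesis by blast
qed

text \<open>By recursion, step \<open>i\<close> amalgamates over \<open>M\<close> a bound of the
  earlier models with a model realising \<open>t i\<close>. The sequence need not be continuous,
  because \<open>chain_bound\<close> supplies a bound at every step.\<close>

lemma realize_types:
  fixes K :: "('r, 'u) abstract_class" and V :: "'u set"
  assumes K: "AEC R K" and ap: "amalgamation R K" and M: "M \<in> Models K" and V: "small V" "V \<noteq> {}"
    and t: "\<And>i. i \<in> V \<Longrightarrow> t i \<in> types_over R K M"
  shows "\<exists>N. sleq K M N \<and> (\<forall>i \<in> V. \<exists>b \<in> univ N. t i = ortp R K b (univ M) N)"
proof -
  define good where "good F i N \<longleftrightarrow> sleq K M N \<and> (\<forall>j \<in> V. j \<prec> i \<longrightarrow> sleq K (F j) N) \<and>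
    (\<exists>b \<in> univ N. t i = ortp R K b (univ M) N)" for F i N
  define F where "F = wfrec {(x, y). x \<prec> y} (\<lambda>F i. SOME N. good F i N)"
  have F: "F i = (SOME N. good F i N)" for i
  proof -
    have "F i = (SOME N. good (cut F {(x, y). x \<prec> y} i) i N)"
      unfolding F_def by (rule wfrec[OF wf_lt])
    moreover have "good (cut F {(x, y). x \<prec> y} i) i N \<longleftrightarrow> good F i N" for N
      unfolding good_def by (simp add: cut_apply)
    ultimately show ?thesis by simp
  qed
  have good: "i \<in> V \<longrightarrow> good F i (F i)" for i
  proof (induction i rule: lt_induct)
    case (less i)
    have "\<exists>N. good F i N" if i: "i \<in> V"
    proof -
      let ?D = "{j \<in> V. j \<prec> i}"
      have "\<exists>U. sleq K M U \<and> (\<forall>j \<in> ?D. sleq K (F j) U)"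
      proof (cases "?D = {}")
        case True
        show ?thesis using AEC_D(2)[OF K M] by (intro exI[of _ M]) (use True in blast)
      next
        case False
        have IH: "good F j (F j)" if "j \<in> ?D" for j using less that by blast
        have "\<exists>U. \<forall>j \<in> ?D. sleq K (F j) U"
        proof (rule chain_bound[OF K small_mono[OF V(1)] False])
          show "F j \<in> Models K" if "j \<in> ?D" for j
            using IH[OF that] AEC_D(6)[OF K] unfolding good_def by blast
          show "sleq K (F j) (F j')" if "j \<in> ?D" "j' \<in> ?D" "j \<prec> j'" for j j'
            using IH[OF that(2)] that unfolding good_def by blast
        qed blast
        then obtain U where U: "\<And>j. j \<in> ?D \<Longrightarrow> sleq K (F j) U" by blast
        obtain j where j: "j \<in> ?D" using False by blast
        have "sleq K M (F j)" using IH[OF j] unfolding good_def by blast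
        then have "sleq K M U" using AEC_D(3)[OF K _ U[OF j]] by blast
        then show ?thesis using U by blast
      qed
      then obtain U where U: "sleq K M U" "\<And>j. j \<in> ?D \<Longrightarrow> sleq K (F j) U" by blast
      obtain b N2 where b: "t i = ortp R K b (univ M) N2" "sleq K M N2" "b \<in> univ N2"
        using t[OF i] unfolding types_over_def by blast
      obtain N f where N: "sleq K U N" "K_embedding R K N2 N f" "\<forall>x \<in> univ M. f x = x"
        using amalgamate_over[OF K ap U(1) b(2)] by blast
      have "t i = ortp R K (f b) (univ M) N"
        unfolding b(1)
        by (rule ortp_embedding[OF K AEC_D(6)[OF K b(2)] AEC_D(6)[OF K N(1)] N(2) sleq_univ[OF K b(2)] _ b(3)])
          (use N(3) in blast)
      moreover have "f b \<in> univ N" using K_embedding_univ[OF K N(2)] b(3) by blast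
      moreover have "sleq K M N" by (rule AEC_D(3)[OF K U(1) N(1)])
      moreover have "sleq K (F j) N" if "j \<in> V" "j \<prec> i" for j
        using AEC_D(3)[OF K U(2) N(1)] that by blast
      ultimately show ?thesis unfolding good_def by blast
    qed
    then show ?case using F[of i] someI_ex[of "good F i"] by simp
  qed
  have "\<exists>U. \<forall>i \<in> V. sleq K (F i) U"
  proof (rule chain_bound[OF K V])
    show "F j \<in> Models K" if "j \<in> V" for j
      using good[of j] that AEC_D(6)[OF K] unfolding good_def by blast
    show "sleq K (F j) (F j')" if "j \<in> V" "j' \<in> V" "j \<prec> j'" for j j'
      using good[of j'] that unfolding good_def by blast
  qed
  then obtain U where U: "\<And>i. i \<in> V \<Longrightarrow> sleq K (F i) U" by blast
  have real: "sleq K M U \<and> (\<exists>b \<in> univ U. t i = ortp R K b (univ M) U)" if i: "i \<in> V" for i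
  proof -
    obtain b where b: "b \<in> univ (F i)" "t i = ortp R K b (univ M) (F i)" and MF: "sleq K M (F i)"
      using good[of i] i unfolding good_def by blast
    have "t i = ortp R K b (univ M) U"
      unfolding b(2)
      by (rule ortp_embedding[OF K AEC_D(6)[OF K MF] AEC_D(6)[OF K U[OF i]] sleq_K_embedding[OF K U[OF i]]
          sleq_univ[OF K MF] _ b(1)]) simp
    then show ?thesis using AEC_D(3)[OF K MF U[OF i]] sleq_univ[OF K U[OF i]] b(1) by blast
  qed
  then show ?thesis using V(2) by blast
qed

end

section \<open>Types of tuples with moving parameters\<close>

context module_aec
begin

text \<open>In contrast to \<open>ortp\<close>, embeddings may move the parameters \<open>a\<close>
  along with \<open>c\<close>. This is needed because a swap moves them.\<close>

definition tuple_emb :: "(('r, 'u) rstr \<times> 'u \<times> ('u \<Rightarrow> 'u)) rel" where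
  "tuple_emb = {((N1, c1, a1), (N2, c2, a2)). N1 \<in> Models K \<and> N2 \<in> Models K \<and> c1 \<in> univ N1 \<and>
      a1 ` A \<subseteq> univ N1 \<and>
    (\<exists>f. K_embedding R K N1 N2 f \<and> f c1 = c2 \<and> (\<forall>i \<in> A. f (a1 i) = a2 i))}"

definition tuple_eq :: "(('r, 'u) rstr \<times> 'u \<times> ('u \<Rightarrow> 'u)) rel" where
  "tuple_eq = (tuple_emb \<union> tuple_emb\<inverse>)\<^sup>*"

lemma tuple_eq_emb: "x \<in> tuple_emb \<Longrightarrow> x \<in> tuple_eq"
  unfolding tuple_eq_def by blast

lemma tuple_eq_trans: "(x, y) \<in> tuple_eq \<Longrightarrow> (y, z) \<in> tuple_eq \<Longrightarrow> (x, z) \<in> tuple_eq"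
  unfolding tuple_eq_def by (rule rtrancl_trans)

lemma tuple_eq_sym: "(x, y) \<in> tuple_eq \<Longrightarrow> (y, x) \<in> tuple_eq"
  unfolding tuple_eq_def
  using sym_rtrancl[OF sym_Un_converse[of tuple_emb]] by (rule symD)

lemma tuple_embI:
  assumes "sleq K N0 N" "c \<in> univ N0" "a ` A \<subseteq> univ N0"
  shows "((N0, c, a), (N, c, a)) \<in> tuple_eq"
  by (rule tuple_eq_emb)
    (use assms AEC_D(5,6)[OF aec assms(1)] sleq_K_embedding[OF aec assms(1)] in \<open>force simp: tuple_emb_def\<close>)

lemma tuple_isoI:
  assumes "N \<in> Models K" "rstr_iso R N N' h" "c \<in> univ N" "a ` A \<subseteq> univ N" "h c = c'"
      "\<And>i. i \<in> A \<Longrightarrow> h (a i) = a' i"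
  shows "((N, c, a), (N', c', a')) \<in> tuple_eq"
  by (rule tuple_eq_emb)
    (use assms AEC_D(7)[OF aec assms(1,2)] rstr_iso_K_embedding[OF aec assms(1,2)] in \<open>auto simp: tuple_emb_def\<close>)

lemma tuple_eq_transport:
  assumes eq: "((N1, c1, a1), t) \<in> tuple_eq"
    and N1: "N1 \<in> Models K" "c1 \<in> univ N1" "a1 ` A \<subseteq> univ N1"
  shows "\<exists>N2 c2 a2 h N2'. t = (N2, c2, a2) \<and> N2 \<in> Models K \<and> c2 \<in> univ N2 \<and> a2 ` A \<subseteq> univ N2 \<and>
      rstr_iso R N2 N2' h \<and> (\<forall>i \<in> A. h (a2 i) = a1 i) \<and>
      ortp R K (h c2) (a1 ` A) N2' = ortp R K c1 (a1 ` A) N1"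
  using eq unfolding tuple_eq_def
proof (induction rule: rtrancl_induct)
  case base
  show ?case
    by (intro exI[of _ N1] exI[of _ c1] exI[of _ a1] exI[of _ "\<lambda>x. x"] conjI refl N1
        rstr_iso_id AEC_D(1)[OF aec N1(1)]) simp_all
next
  case (step y t)
  from step(3) obtain N2 c2 a2 h N2' where y: "y = (N2, c2, a2)"
    and N2: "N2 \<in> Models K" "c2 \<in> univ N2" "a2 ` A \<subseteq> univ N2"
    and h: "rstr_iso R N2 N2' h" "\<forall>i \<in> A. h (a2 i) = a1 i"
    "ortp R K (h c2) (a1 ` A) N2' = ortp R K c1 (a1 ` A) N1" by blast
  obtain N3 c3 a3 where t: "t = (N3, c3, a3)" by (cases t)
  have N2': "N2' \<in> Models K" by (rule AEC_D(7)[OF aec N2(1) h(1)])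
  have hu: "univ N2' = h ` univ N2" by (rule rstr_iso_univ[OF h(1)])
  have hinj: "inj_on h (univ N2)" by (rule rstr_iso_inj[OF h(1)])
  have hc: "h c2 \<in> univ N2'" unfolding hu using N2(2) by blast
  have hB: "a1 ` A \<subseteq> univ N2'"
  proof
    fix x assume "x \<in> a1 ` A"
    then obtain i where i: "i \<in> A" "x = h (a2 i)" using h(2) by auto
    then show "x \<in> univ N2'" unfolding hu using N2(3) by blast
  qed
  from step(2) have "(y, t) \<in> tuple_emb \<or> (t, y) \<in> tuple_emb" by blast
  then show ?case
  proof
    assume "(y, t) \<in> tuple_emb"
    then obtain f where N3: "N3 \<in> Models K" and f: "K_embedding R K N2 N3 f" "f c2 = c3"
        "\<forall>i \<in> A. f (a2 i) = a3 i"
      unfolding y t tuple_emb_def by blast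
    have finj: "inj_on f (univ N2)" by (rule K_embedding_inj[OF f(1)])
    have fu: "f ` univ N2 \<subseteq> univ N3" by (rule K_embedding_univ[OF aec f(1)])
    let ?i = "inv_into (univ N2) f"
    have "inj_on (h \<circ> ?i) (f ` univ N2)"
      by (intro comp_inj_on inj_on_inv_into) (use hinj in \<open>simp_all add: inj_on_inv_into finj\<close>)
    \<comment> \<open>\<open>N3\<close> is renamed so that \<open>N2'\<close> embeds into the copy
      by the identity.\<close>
    from rename[OF aec N3 fu this] obtain N3' h3 where h3: "rstr_iso R N3 N3' h3" "N3' \<in> Models K"
      "\<forall>x \<in> f ` univ N2. h3 x = (h \<circ> ?i) x" by blast
    have h3f: "h3 (f x) = h x" if "x \<in> univ N2" for x using h3(3) that finj by simp
    let ?e = "h3 \<circ> f \<circ> inv_into (univ N2) h"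
    have "K_embedding R K N2' N2 (inv_into (univ N2) h)"
      by (rule rstr_iso_K_embedding[OF aec N2' rstr_iso_inv[OF h(1)]])
    then have e: "K_embedding R K N2' N3' ?e"
      using K_embedding_comp[OF aec K_embedding_comp[OF aec _ f(1)] rstr_iso_K_embedding[OF aec N3 h3(1)]]
      by (simp add: comp_assoc)
    have ex: "?e x = x" if "x \<in> univ N2'" for x
      using that h3f hinj unfolding hu by auto
    have "ortp R K (h c2) (a1 ` A) N2' = ortp R K (?e (h c2)) (a1 ` A) N3'"
      by (rule ortp_embedding[OF aec N2' h3(2) e hB _ hc]) (use ex hB in blast)
    also have "?e (h c2) = h3 c3" using ex[OF hc] h3f[OF N2(2)] f(2) by simp
    finally have "ortp R K (h3 c3) (a1 ` A) N3' = ortp R K c1 (a1 ` A) N1" using h(3) by simp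
    moreover have "h3 (a3 i) = a1 i" if i: "i \<in> A" for i
    proof -
      have "a2 i \<in> univ N2" using N2(3) i by blast
      then show ?thesis using h3f[of "a2 i"] f(3) h(2) i by simp
    qed
    moreover have "c3 \<in> univ N3" using fu f(2) N2(2) by blast
    moreover have "a3 ` A \<subseteq> univ N3"
    proof
      fix x assume "x \<in> a3 ` A"
      then obtain i where i: "i \<in> A" "x = f (a2 i)" using f(3) by auto
      then show "x \<in> univ N3" using fu N2(3) by blast
    qed
    ultimately show ?case unfolding t using N3 h3(1) by blast
  next
    assume "(t, y) \<in> tuple_emb"
    then obtain f where N3: "N3 \<in> Models K" "c3 \<in> univ N3" "a3 ` A \<subseteq> univ N3"
      and f: "K_embedding R K N3 N2 f" "f c3 = c2" "\<forall>i \<in> A. f (a3 i) = a2 i"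
      unfolding y t tuple_emb_def by blast
    have finj: "inj_on f (univ N3)" by (rule K_embedding_inj[OF f(1)])
    have fu: "f ` univ N3 \<subseteq> univ N2" by (rule K_embedding_univ[OF aec f(1)])
    have hf: "K_embedding R K N3 N2' (h \<circ> f)"
      by (rule K_embedding_comp[OF aec f(1) rstr_iso_K_embedding[OF aec N2(1) h(1)]])
    \<comment> \<open>In this direction \<open>N3\<close> is renamed along its embedding into
      \<open>N2'\<close>, so that the copy embeds into \<open>N2'\<close> by the identity.\<close>
    from rename[OF aec N3(1) order_refl K_embedding_inj[OF hf]] obtain N3' h3
      where h3: "rstr_iso R N3 N3' h3" "N3' \<in> Models K" "\<forall>x \<in> univ N3. h3 x = (h \<circ> f) x" by blast
    have h3u: "univ N3' = h3 ` univ N3" by (rule rstr_iso_univ[OF h3(1)])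
    let ?e = "(h \<circ> f) \<circ> inv_into (univ N3) h3"
    have e: "K_embedding R K N3' N2' ?e"
      by (rule K_embedding_comp[OF aec rstr_iso_K_embedding[OF aec h3(2) rstr_iso_inv[OF h3(1)]] hf])
    have ex: "?e x = x" if "x \<in> univ N3'" for x
    proof -
      from that obtain z where z: "z \<in> univ N3" "x = h3 z" unfolding h3u by blast
      have "inv_into (univ N3) h3 x = z" unfolding z(2)
          by (rule inv_into_f_f[OF rstr_iso_inj[OF h3(1)] z(1)])
      then show ?thesis using h3(3) z by simp
    qed
    have a: "h3 (a3 i) = a1 i" if i: "i \<in> A" for i
    proof -
      have "a3 i \<in> univ N3" using N3(3) i by blast
      then show ?thesis using h3(3) f(3) h(2) i by simp
    qed
    have hB3: "a1 ` A \<subseteq> univ N3'"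
    proof
      fix x assume "x \<in> a1 ` A"
      then obtain i where i: "i \<in> A" "x = h3 (a3 i)" using a by auto
      then show "x \<in> univ N3'" unfolding h3u using N3(3) by blast
    qed
    have hc3: "h3 c3 \<in> univ N3'" unfolding h3u using N3(2) by blast
    have "ortp R K (h3 c3) (a1 ` A) N3' = ortp R K (?e (h3 c3)) (a1 ` A) N2'"
      by (rule ortp_embedding[OF aec h3(2) N2' e hB3 _ hc3]) (use ex hB3 in blast)
    also have "?e (h3 c3) = h c2" using ex[OF hc3] h3(3) N3(2) f(2) by simp
    finally have "ortp R K (h3 c3) (a1 ` A) N3' = ortp R K c1 (a1 ` A) N1" using h(3) by simp
    then show ?case unfolding t using N3 h3(1) a by blast
  qed
qed

text \<open>With equal parameters at both ends, the transporting isomorphism fixes them pointwise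
  and itself witnesses equality of the types.\<close>

lemma tuple_eq_ortp:
  assumes eq: "((N, c, a), (N, c', a)) \<in> tuple_eq"
    and N: "N \<in> Models K" "c \<in> univ N" "a ` A \<subseteq> univ N"
  shows "ortp R K c (a ` A) N = ortp R K c' (a ` A) N"
proof -
  from tuple_eq_transport[OF eq N] obtain h N' where c': "c' \<in> univ N" and h: "rstr_iso R N N' h"
    "\<forall>i \<in> A. h (a i) = a i" "ortp R K (h c') (a ` A) N' = ortp R K c (a ` A) N" by blast
  have "ortp R K c' (a ` A) N = ortp R K (h c') (a ` A) N'"
    by (rule ortp_embedding[OF aec N(1) AEC_D(7)[OF aec N(1) h(1)] rstr_iso_K_embedding[OF aec N(1) h(1)] N(3) _ c'])
      (use h(2) in auto)
  then show ?thesis using h(3) by simp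
qed

text \<open>
  Every tuple of length \<open>|A|\<close> is equivalent to one in a model on a subset of \<open>A\<close>, which bounds
  the number of types.
\<close>

definition canonical :: "(('r, 'u) rstr \<times> 'u \<times> ('u \<Rightarrow> 'u)) set" where
  "canonical = {S \<in> Models K. univ S \<subseteq> A} \<times> A \<times> Func A A"

text \<open>A class is represented by its canonical members, so all types are subsets of one small
  set, whatever \<open>N\<close> is.\<close>

definition tuple_type :: "('r, 'u) rstr \<Rightarrow> 'u \<Rightarrow> ('u \<Rightarrow> 'u) \<Rightarrow> (('r, 'u) rstr \<times> 'u \<times> ('u \<Rightarrow> 'u)) set" where
  "tuple_type N c a = {t \<in> canonical. (t, (N, c, a)) \<in> tuple_eq}"

lemma small_canonical: "small canonical"
proof -
  define code where "code S = (univ S, zer S, {(x, y, z). x \<in> univ S \<and> y \<in> univ S \<and>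
      z = pls S (x, y)},
    {(r, x, z). r \<in> carrier R \<and> x \<in> univ S \<and> z = scl S (r, x)})" for S :: "('r, 'u) rstr"
  let ?X = "{S \<in> Models K. univ S \<subseteq> A}"
  have "inj_on code ?X"
  proof (rule inj_onI)
    fix S S' assume S: "S \<in> ?X" "S' \<in> ?X" "code S = code S'"
    note c0 = S(3)[unfolded code_def prod.inject]
    note c = c0[THEN conjunct1] c0[THEN conjunct2, THEN conjunct1] c0[THEN conjunct2,
        THEN conjunct2, THEN conjunct1]
      c0[THEN conjunct2, THEN conjunct2, THEN conjunct2]
    show "S = S'"
    proof (rule rstr_eqI)
      show "rstructure R S" "rstructure R S'" using AEC_D(1)[OF aec] S(1,2) by blast+
      show "pls S (x, y) = pls S' (x, y)" if "x \<in> univ S" "y \<in> univ S" for x y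
      proof -
        have "(x, y, pls S (x, y)) \<in> {(x, y, z). x \<in> univ S \<and> y \<in> univ S \<and> z = pls S (x, y)}"
            using that by simp
        then show ?thesis unfolding c(3) by simp
      qed
      show "scl S (r, x) = scl S' (r, x)" if "r \<in> carrier R" "x \<in> univ S" for r x
      proof -
        have "(r, x, scl S (r, x)) \<in> {(r, x, z). r \<in> carrier R \<and> x \<in> univ S \<and> z = scl S (r, x)}"
            using that by simp
        then show ?thesis unfolding c(4) by simp
      qed
    qed (use c in auto)
  qed
  moreover have "code ` ?X \<subseteq> Pow A \<times> A \<times> Pow (A \<times> A \<times> A) \<times> Pow (carrier R \<times> A \<times> A)"
  proof
    fix x assume "x \<in> code ` ?X"
    then obtain S where S: "S \<in> Models K" "univ S \<subseteq> A" "x = code S" by blast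
    note rs = rstructureD[OF AEC_D(1)[OF aec S(1)]]
    show "x \<in> Pow A \<times> A \<times> Pow (A \<times> A \<times> A) \<times> Pow (carrier R \<times> A \<times> A)"
      unfolding S(3) code_def using rs S(2) by auto
  qed
  ultimately have "|?X| \<le>o |Pow A \<times> A \<times> Pow (A \<times> A \<times> A) \<times> Pow (carrier R \<times> A \<times> A)|"
    unfolding card_of_ordLeq[symmetric] by blast
  then have "small ?X"
    by (rule small_ordLeq[rotated]) (intro small_Times small_Pow A(2) small_R)
  then show ?thesis unfolding canonical_def by (intro small_Times small_Func A(2))
qed

text \<open>A Loewenheim-Skolem submodel around the tuple is copied onto a subset of
  \<open>A\<close>. Consequently no class has an empty representation, and equal
  \<open>tuple_type\<close> implies equivalence.\<close>

lemma canonical_ex: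
  assumes N: "N \<in> Models K" "c \<in> univ N" "a ` A \<subseteq> univ N"
  shows "\<exists>t \<in> canonical. (t, (N, c, a)) \<in> tuple_eq"
proof -
  have "|a ` A| \<le>o |A|" "|{c}| \<le>o |A|"
    using card_of_image A(1) card_of_singl_ordLeq[of A c] by (auto simp: finite.emptyI)
  then have "|insert c (a ` A)| \<le>o |A|"
    using card_of_Un_ordLeq_infinite_Field[of "|A|" "{c}" "a ` A", OF _ _ _ card_of_Card_order] A(1)
    by (simp add: Field_card_of)
  then obtain N0 where N0: "sleq K N0 N" "insert c (a ` A) \<subseteq> univ N0" "|univ N0| \<le>o |A|"
    using LS[OF N(1), of "insert c (a ` A)"] N(2,3) by blast
  then obtain g where g: "inj_on g (univ N0)" "g ` univ N0 \<subseteq> A"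
    unfolding card_of_ordLeq[symmetric] by blast
  have N0K: "N0 \<in> Models K" by (rule AEC_D(5)[OF aec N0(1)])
  from rstr_copy[OF AEC_D(1)[OF aec N0K] g(1)] obtain S where S: "rstr_iso R N0 S g" .
  define s where "s = (\<lambda>i. if i \<in> A then g (a i) else undefined)"
  have "((N0, c, a), (S, g c, s)) \<in> tuple_eq"
    by (rule tuple_isoI[OF N0K S]) (use N0(2) in \<open>auto simp: s_def\<close>)
  moreover have "((N0, c, a), (N, c, a)) \<in> tuple_eq"
      by (rule tuple_embI[OF N0(1)]) (use N0(2) in auto)
  moreover have "g (a i) \<in> A" if "i \<in> A" for i using g(2) N0(2) that by blast
  then have "(S, g c, s) \<in> canonical"
    unfolding canonical_def s_def Func_def
    using AEC_D(7)[OF aec N0K S] rstr_iso_univ[OF S] g(2) N0(2) by auto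
  ultimately show ?thesis using tuple_eq_sym tuple_eq_trans by blast
qed

lemma tuple_type_eqI: "((N, c, a), (N', c', a')) \<in> tuple_eq \<Longrightarrow>
    tuple_type N c a = tuple_type N' c' a'"
  unfolding tuple_type_def using tuple_eq_sym tuple_eq_trans by blast

lemma tuple_type_ortp:
  assumes eq: "tuple_type N c a = tuple_type N c' a"
    and N: "N \<in> Models K" "c \<in> univ N" "c' \<in> univ N" "a ` A \<subseteq> univ N"
  shows "ortp R K c (a ` A) N = ortp R K c' (a ` A) N"
proof -
  obtain t where t: "t \<in> canonical" "(t, (N, c, a)) \<in> tuple_eq" using canonical_ex[OF N(1,2,4)]
      by blast
  then have "t \<in> tuple_type N c' a" using eq unfolding tuple_type_def by blast
  then have "(t, (N, c', a)) \<in> tuple_eq" unfolding tuple_type_def by blast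
  from tuple_eq_trans[OF tuple_eq_sym[OF t(2)] this] show ?thesis
      by (rule tuple_eq_ortp[OF _ N(1,2,4)])
qed

text \<open>The zigzag goes down from \<open>N\<close> to \<open>N0\<close>, across by
  \<open>h\<close>, and up from \<open>N0'\<close> to \<open>N\<close>.\<close>

lemma tuple_type_swapped:
  assumes "sleq K N0 N" "sleq K N0' N" "rstr_iso R N0 N0' h" "c \<in> univ N0" "a ` A \<subseteq> univ N0"
    "h c = c'" "\<And>i. i \<in> A \<Longrightarrow> h (a i) = a' i"
  shows "tuple_type N c a = tuple_type N c' a'"
proof -
  have u: "univ N0' = h ` univ N0" by (rule rstr_iso_univ[OF assms(3)])
  have c': "c' \<in> univ N0'" unfolding u using assms(4,6) by blast
  have a': "a' ` A \<subseteq> univ N0'"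
  proof
    fix x assume "x \<in> a' ` A"
    then obtain i where "i \<in> A" "x = h (a i)" using assms(7) by auto
    then show "x \<in> univ N0'" unfolding u using assms(5) by blast
  qed
  show ?thesis
    by (rule tuple_type_eqI[OF tuple_eq_trans[OF tuple_eq_sym[OF tuple_embI[OF assms(1,4,5)]]
      tuple_eq_trans[OF tuple_isoI[OF AEC_D(5)[OF aec assms(1)] assms(3-7)] tuple_embI[OF assms(2) c' a']]]])
qed

end


section \<open>Stability\<close>

lemma almost_stable_trivial: "almost_stable_in R K \<mu>"
  unfolding almost_stable_in_def
proof (intro allI impI)
  fix M N assume "M \<in> Models K \<and> N \<in> Models K \<and> |univ M| =o \<mu> \<and> |univ N| =o \<mu> \<and> sleq K M N"
  then have N: "|univ N| =o \<mu>" by blast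
  have "types_in R K M N = (\<lambda>c. ortp R K c (univ M) N) ` univ N"
    unfolding types_in_def by blast
  then have "|types_in R K M N| \<le>o |univ N|" by (simp add: card_of_image)
  then show "|types_in R K M N| \<le>o \<mu>" using N by (rule ordLeq_ordIso_trans)
qed

lemma cardinals_below_ex:
  fixes \<xi> :: "'u rel"
  assumes \<xi>: "Card_order \<xi>" and V: "|V| <o \<xi>"
  obtains \<sigma> where "\<sigma> \<in> cardinals_below \<xi>" "|V| =o \<sigma>"
proof -
  obtain a where a: "a \<in> Field \<xi>" "|V| =o Restr \<xi> (underS \<xi> a)"
    using V \<xi> ordLess_iff_ordIso_Restr[of \<xi> "|V|"] card_of_Well_order card_order_on_well_order_on
        by blast
  have "Card_order (Restr \<xi> (underS \<xi> a))"
    by (rule Card_order_ordIso[OF card_of_Card_order ordIso_symmetric[OF a(2)]])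
  then show thesis using that[of "Restr \<xi> (underS \<xi> a)"] a unfolding cardinals_below_def by blast
qed

lemma card_of_Sigma_fibre:
  assumes "i \<in> I"
  shows "|B i| \<le>o |SIGMA i : I. B i|"
proof -
  have "inj_on (Pair i) (B i)" "Pair i ` B i \<subseteq> (SIGMA i : I. B i)" using assms
      by (auto intro: inj_onI)
  then show ?thesis unfolding card_of_ordLeq[symmetric] by blast
qed

text \<open>Up to equipotence |V| is one of the cardinals over which both sums run, and a sum
  dominates each of its terms.\<close>

lemma mu_bounds:
  fixes \<xi> \<mu> :: "'u rel" and V :: "'u set"
  assumes \<xi>: "Card_order \<xi>" and V: "|V| <o \<xi>" and \<mu>: "Card_order \<mu>"
      "\<mu> =o power_less \<mu> \<xi> +c sum_double_exp \<xi>"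
  shows "\<mu> ^c |V| \<le>o \<mu>" "ctwo ^c (ctwo ^c |V| ) \<le>o \<mu>"
proof -
  obtain \<sigma> where \<sigma>: "\<sigma> \<in> cardinals_below \<xi>" "|V| =o \<sigma>" using cardinals_below_ex[OF \<xi> V] .
  have \<sigma>C: "Card_order \<sigma>" using \<sigma>(1) unfolding cardinals_below_def by blast
  have F: "r =o |Field r|" if "Card_order r" for r :: "'z rel"
    using card_of_Field_ordIso[OF that] by (rule ordIso_symmetric)
  have "\<mu> ^c |V| =o \<mu> ^c \<sigma>" by (rule cexp_cong2[OF \<sigma>(2) \<mu>(1) card_of_Card_order])
  also have "\<mu> ^c \<sigma> =o |Field (\<mu> ^c \<sigma>)|" by (rule F[OF Card_order_cexp])
  finally have "\<mu> ^c |V| =o |Field (\<mu> ^c \<sigma>)|" .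
  moreover have "|Field (\<mu> ^c \<sigma>)| \<le>o power_less \<mu> \<xi>"
    unfolding power_less_def using \<sigma>(1) by (rule card_of_Sigma_fibre)
  moreover have "power_less \<mu> \<xi> \<le>o power_less \<mu> \<xi> +c sum_double_exp \<xi>"
    unfolding power_less_def by (rule ordLeq_csum1[OF card_of_Card_order])
  ultimately have "\<mu> ^c |V| \<le>o power_less \<mu> \<xi> +c sum_double_exp \<xi>"
    using ordIso_ordLeq_trans ordLeq_transitive by blast
  then show "\<mu> ^c |V| \<le>o \<mu>" using ordIso_symmetric[OF \<mu>(2)] by (rule ordLeq_ordIso_trans)
  have "ctwo ^c |V| =o ctwo ^c \<sigma>" by (rule cexp_cong2[OF \<sigma>(2) Card_order_ctwo card_of_Card_order])
  then have "ctwo ^c (ctwo ^c |V| ) =o ctwo ^c (ctwo ^c \<sigma>)"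
    by (rule cexp_cong2[OF _ Card_order_ctwo Card_order_cexp])
  also have "ctwo ^c (ctwo ^c \<sigma>) =o |Field (ctwo ^c (ctwo ^c \<sigma>))|" by (rule F[OF Card_order_cexp])
  finally have "ctwo ^c (ctwo ^c |V| ) =o |Field (ctwo ^c (ctwo ^c \<sigma>))|" .
  moreover have "|Field (ctwo ^c (ctwo ^c \<sigma>))| \<le>o sum_double_exp \<xi>"
    unfolding sum_double_exp_def using \<sigma>(1) by (rule card_of_Sigma_fibre)
  moreover have "sum_double_exp \<xi> \<le>o power_less \<mu> \<xi> +c sum_double_exp \<xi>"
    unfolding sum_double_exp_def by (rule ordLeq_csum2[OF card_of_Card_order])
  ultimately have "ctwo ^c (ctwo ^c |V| ) \<le>o power_less \<mu> \<xi> +c sum_double_exp \<xi>"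
    using ordIso_ordLeq_trans ordLeq_transitive by blast
  then show "ctwo ^c (ctwo ^c |V| ) \<le>o \<mu>" using ordIso_symmetric[OF \<mu>(2)]
      by (rule ordLeq_ordIso_trans)
qed

lemma card_Func_cexp: "|Func A B| = |B| ^c |A|"
  unfolding cexp_def Field_card_of ..

text \<open>A base of size at most |V| is absorbed by the exponent: first |Q| to the power |V| is at
  most the power of two, then the same argument is used one exponential higher.\<close>

lemma card_Func_Func:
  assumes V: "infinite V" and Q: "|Q| \<le>o |V|" "Q \<noteq> {}"
  shows "|Func (Func V Q) Q| \<le>o ctwo ^c (ctwo ^c |V| )"
proof -
  have Vi: "Cinfinite |V|" using V card_of_Card_order[of V]
      by (simp add: cinfinite_def Field_card_of)
  let ?p = "ctwo ^c |V|"
  have pC: "Card_order ?p" by (rule Card_order_cexp)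
  have Vp: "|V| \<le>o ?p" by (rule ordLess_imp_ordLeq[OF ordLess_ctwo_cexp[OF card_of_Card_order]])
  have pi: "Cinfinite ?p" using cinfinite_mono[OF Vp] Vi pC by blast
  have pp: "?p \<le>o ctwo ^c ?p" by (rule ordLess_imp_ordLeq[OF ordLess_ctwo_cexp[OF pC]])
  have Qp: "|Q| \<le>o ?p" by (rule ordLeq_transitive[OF Q(1) Vp])
  have "|Q| ^c |V| \<le>o ?p ^c |V|" by (rule cexp_mono1[OF Qp card_of_Card_order])
  also have "?p ^c |V| =o ?p"
    by (rule cexp_cprod_ordLeq[OF Card_order_ctwo Vi Cinfinite_Cnotzero[OF Vi] ordLeq_refl[OF card_of_Card_order]])
  finally have P: "|Func V Q| \<le>o ?p" unfolding card_Func_cexp .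
  have "Func V Q \<noteq> {}"
  proof -
    obtain q where "q \<in> Q" using Q(2) by blast
    then have "(\<lambda>x. if x \<in> V then q else undefined) \<in> Func V Q" unfolding Func_def by simp
    then show ?thesis by blast
  qed
  then have "\<not> |Func V Q| =o (czero :: 'z rel)" by (simp add: card_of_ordIso_czero_iff_empty)
  then have "|Q| ^c |Func V Q| \<le>o (ctwo ^c ?p) ^c ?p"
    by (intro cexp_mono[OF ordLeq_transitive[OF Qp pp] P] card_of_Card_order)
       (simp add: card_of_ordIso_czero_iff_empty)
  also have "(ctwo ^c ?p) ^c ?p =o ctwo ^c ?p"
    by (rule cexp_cprod_ordLeq[OF Card_order_ctwo pi Cinfinite_Cnotzero[OF pi] ordLeq_refl[OF pC]])
  finally show ?thesis unfolding card_Func_cexp .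
qed

context module_aec
begin

text \<open>Locality separates the two types over a set of size at most |A|. Such a set is listed by
  an \<open>A\<close>-tuple, and equal tuple types would give equal types over it.\<close>

lemma ortp_separated:
  assumes loc: "is_local R K |A|" and M: "sleq K M N"
    and x: "x \<in> univ N" "x' \<in> univ N" "ortp R K x (univ M) N \<noteq> ortp R K x' (univ M) N"
  shows "\<exists>a \<in> Func A (univ M). tuple_type N x a \<noteq> tuple_type N x' a"
proof -
  have N: "N \<in> Models K" and MK: "M \<in> Models K" using AEC_D(5,6)[OF aec M] by blast+
  have MN: "univ M \<subseteq> univ N" by (rule sleq_univ[OF aec M])
  have tr: "type_restrict R K (ortp R K z B N) B' = ortp R K z B' N"
    if "z \<in> univ N" "B' \<subseteq> B" "B \<subseteq> univ M" for z B B'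
    using type_restrict_ortp[OF aec N that(1,2)] that(3) MN by blast
  have ty: "ortp R K z (univ M) N \<in> types_over R K M" if "z \<in> univ N" for z
    unfolding types_over_def using M that by blast
  from loc[unfolded is_local_def, rule_format, OF MK ty[OF x(1)] ty[OF x(2)] x(3)]
  obtain M0 where M0: "M0 \<subseteq> univ M" "|M0| \<le>o |A|"
    "type_restrict R K (ortp R K x (univ M) N) M0 \<noteq> type_restrict R K (ortp R K x' (univ M) N) M0"
    by blast
  \<comment> \<open>\<open>zer M\<close> makes the set nonempty, so that \<open>A\<close> maps onto
    it.\<close>
  let ?B = "insert (zer M) M0"
  have zM: "zer M \<in> univ M" by (rule rstructureD(1)[OF AEC_D(1)[OF aec MK]])
  have B: "?B \<subseteq> univ M" using M0(1) zM by blast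
  have "A \<noteq> {}" using A(1) by auto
  then have "|{zer M}| \<le>o |A|" by (rule card_of_singl_ordLeq)
  then have "|?B| \<le>o |A|"
    using card_of_Un_ordLeq_infinite_Field[of "|A|" "{zer M}" M0,
        OF _ _ M0(2) card_of_Card_order] A(1)
    by (simp add: Field_card_of)
  then obtain d where d: "d ` A = ?B" using card_of_ordLeq2[of ?B A] by blast
  define a where "a = (\<lambda>i. if i \<in> A then d i else undefined)"
  have aB: "a ` A = ?B" using d unfolding a_def by auto
  then have aA: "a ` A \<subseteq> univ M" using B by simp
  have "a \<in> Func A (univ M)" unfolding Func_def using aA unfolding a_def by auto
  moreover have "tuple_type N x a \<noteq> tuple_type N x' a"
  proof
    assume "tuple_type N x a = tuple_type N x' a"
    then have "ortp R K x ?B N = ortp R K x' ?B N"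
      using tuple_type_ortp[of N x a x'] N x(1,2) aA MN unfolding aB[symmetric] by blast
    then have "type_restrict R K (ortp R K x ?B N) M0 = type_restrict R K (ortp R K x' ?B N) M0"
        by simp
    then have "ortp R K x M0 N = ortp R K x' M0 N" using tr[OF x(1) _ B] tr[OF x(2) _ B] by blast
    then show False using M0(3) tr[OF x(1) M0(1) order_refl] tr[OF x(2) M0(1) order_refl] by simp
  qed
  ultimately show ?thesis by blast
qed

text \<open>The triple (c, a, b) with index \<open>i\<close> is coded as one \<open>A\<close>-tuple
  \<open>e i\<close>. A swap of \<open>e i\<close> and \<open>e j\<close> gives (c i, a j) the type
  of (c j, a i), and likewise for \<open>b\<close>; this contradicts \<open>eq\<close> and
  \<open>neq\<close>.\<close>

lemma no_half_graph:
  fixes S :: "'u set"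
  assumes S: "\<And>N W e. N \<in> Models K \<Longrightarrow> |S| \<le>o |W| \<Longrightarrow> (\<And>i a. i \<in> W \<Longrightarrow> a \<in> A \<Longrightarrow> e i a \<in> univ N) \<Longrightarrow>
      \<exists>i \<in> W. \<exists>j \<in> W. i \<prec> j \<and> swapped N (e i) (e j)"
    and N: "N \<in> Models K" and V: "|S| \<le>o |V|"
    and c: "\<And>i. i \<in> V \<Longrightarrow> c i \<in> univ N" and a: "\<And>i z. i \<in> V \<Longrightarrow> z \<in> A \<Longrightarrow> a i z \<in> univ N"
    and b: "\<And>i z. i \<in> V \<Longrightarrow> z \<in> A \<Longrightarrow> b i z \<in> univ N"
    and eq: "\<And>i j. i \<in> V \<Longrightarrow> j \<in> V \<Longrightarrow> i \<prec> j \<Longrightarrow> tuple_type N (c i) (a j) = tuple_type N (c i) (b j)"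
    and neq: "\<And>i j. i \<in> V \<Longrightarrow> j \<in> V \<Longrightarrow> i \<prec> j \<Longrightarrow> tuple_type N (c j) (a i) \<noteq> tuple_type N (c j) (b i)"
  shows False
proof -
  have "|{..2 :: nat} \<times> A| \<le>o |A|"
  proof (rule card_of_Times_ordLeq_infinite_Field[OF _ _ _ card_of_Card_order])
    show "infinite (Field |A| )" using A(1) by (simp add: Field_card_of)
    show "|{..2 :: nat}| \<le>o |A|"
      using A(1) by (intro ordLess_imp_ordLeq finite_ordLess_infinite)
        (simp_all add: Field_card_of card_of_well_order_on)
    show "|A| \<le>o |A|" by (rule ordLeq_refl[OF card_of_Card_order])
  qed
  moreover have ne: "A \<noteq> {}" using A(1) by auto
  then have "{..2 :: nat} \<times> A \<noteq> {}" by auto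
  ultimately obtain \<pi> where \<pi>: "\<pi> ` A = {..2 :: nat} \<times> A"
      using card_of_ordLeq2[of "{..2 :: nat} \<times> A" A] by blast
  \<comment> \<open>\<pi> maps \<open>A\<close> onto three copies of \<open>A\<close>: copy 0
    repeats the single element \<open>c i\<close>, copies 1 and 2 list \<open>a i\<close> and
    \<open>b i\<close>.\<close>
  define e where "e i z = (if fst (\<pi> z) = 0 then c i else if fst (\<pi> z) = 1 then a i (snd (\<pi> z)) else b i (snd (\<pi> z)))"
    for i z
  have \<pi>A: "snd (\<pi> z) \<in> A" if "z \<in> A" for z
  proof -
    have "\<pi> z \<in> {..2 :: nat} \<times> A" using that \<pi> by blast
    then show ?thesis by (simp add: mem_Times_iff)
  qed
  have "e i z \<in> univ N" if "i \<in> V" "z \<in> A" for i z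
    unfolding e_def using c a b that \<pi>A by simp
  then have "\<exists>i \<in> V. \<exists>j \<in> V. i \<prec> j \<and> swapped N (e i) (e j)" by (rule S[OF N V])
  then obtain i j where ij: "i \<in> V" "j \<in> V" "i \<prec> j" "swapped N (e i) (e j)" by blast
  from ij(4)[unfolded swapped_def] obtain N0 N0' h where N0: "sleq K N0 N" "sleq K N0' N"
      "rstr_iso R N0 N0' h"
    "e i ` A \<union> e j ` A \<subseteq> univ N0" and h: "\<forall>z \<in> A. h (e i z) = e j z \<and> h (e j z) = e i z" by blast
  have ex: "\<exists>z \<in> A. \<pi> z = (k, z')" if "k \<le> 2" "z' \<in> A" for k z'
  proof -
    have "(k, z') \<in> \<pi> ` A" using that unfolding \<pi> by simp
    then show ?thesis by force
  qed
  obtain z0 where z0: "z0 \<in> A" using ne by blast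
  obtain y0 where y0: "y0 \<in> A" "\<pi> y0 = (0, z0)" using ex[of 0, OF _ z0] by auto
  have ec: "e v y0 = c v" for v unfolding e_def by (simp add: y0)
  have ea: "\<exists>y \<in> A. \<forall>v. e v y = a v z" if z: "z \<in> A" for z
  proof -
    obtain y where y: "y \<in> A" "\<pi> y = (1, z)" using ex[of 1, OF _ z] by auto
    then have "e v y = a v z" for v unfolding e_def by simp
    then show ?thesis using y(1) by blast
  qed
  have eb: "\<exists>y \<in> A. \<forall>v. e v y = b v z" if z: "z \<in> A" for z
  proof -
    obtain y where y: "y \<in> A" "\<pi> y = (2, z)" using ex[of 2, OF _ z] by auto
    then have "e v y = b v z" for v unfolding e_def by simp
    then show ?thesis using y(1) by blast
  qed
  have hc: "h (c i) = c j" "c i \<in> univ N0"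
    using N0(4) h y0(1) unfolding ec[symmetric] by blast+
  have ha: "h (a j z) = a i z \<and> a j z \<in> univ N0" if z: "z \<in> A" for z
  proof -
    obtain y where y: "y \<in> A" "\<forall>v. e v y = a v z" using ea[OF z] by blast
    have "h (e j y) = e i y" "e j y \<in> univ N0" using h N0(4) y(1) by blast+
    then show ?thesis using y(2) by simp
  qed
  have hb: "h (b j z) = b i z \<and> b j z \<in> univ N0" if z: "z \<in> A" for z
  proof -
    obtain y where y: "y \<in> A" "\<forall>v. e v y = b v z" using eb[OF z] by blast
    have "h (e j y) = e i y" "e j y \<in> univ N0" using h N0(4) y(1) by blast+
    then show ?thesis using y(2) by simp
  qed
  have "tuple_type N (c i) (a j) = tuple_type N (c j) (a i)"
    by (rule tuple_type_swapped[OF N0(1-3) hc(2) _ hc(1)]) (use ha in auto)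
  moreover have "tuple_type N (c i) (b j) = tuple_type N (c j) (b i)"
    by (rule tuple_type_swapped[OF N0(1-3) hc(2) _ hc(1)]) (use hb in auto)
  ultimately show False using eq[OF ij(1-3)] neq[OF ij(1-3)] by simp
qed

text \<open>With more than \<mu> types over \<open>M\<close>, a model realising that many would
  carry a half graph indexed by \<open>?V\<close>. This is longer than the swap theorem
  admits.\<close>

lemma stable_if_amalgamation:
  assumes loc: "is_local R K |A|"
  shows "\<exists>\<xi> :: 'u rel. cardinal \<xi> \<and> |A| <o \<xi> \<and> (amalgamation R K \<longrightarrow>
    (\<forall>\<mu> :: 'u rel. cardinal \<mu> \<and> \<mu> =o power_less \<mu> \<xi> +c sum_double_exp \<xi> \<longrightarrow> stable_in R K \<mu>))"
proof -
  let ?Q = "Pow canonical"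
  obtain S :: "'u set" where S: "small S" "\<forall>N \<in> Models K. \<forall>W e. |S| \<le>o |W| \<longrightarrow>
    (\<forall>i \<in> W. \<forall>a \<in> A. e i a \<in> univ N) \<longrightarrow> (\<exists>i \<in> W. \<exists>j \<in> W. i \<prec> j \<and> swapped N (e i) (e j))"
    using swap_theorem by blast
  obtain C :: "'u set" where C: "|?Q| =o |C|" using small_copy[OF small_Pow[OF small_canonical]] .
  have "small C" using small_ordLeq[OF small_Pow[OF small_canonical] ordIso_imp_ordLeq[OF ordIso_symmetric[OF C]]] .
  then have "small (S \<union> A \<union> C)" by (intro small_Un S(1) A(2))
  \<comment> \<open>\<open>S\<close> is the length at which swaps occur, \<open>A\<close> makes the
    index set infinite and bounds the tuples, \<open>C\<close> bounds the number of tuple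
    types.\<close>
  then obtain v where v: "|S \<union> A \<union> C| <o |{y. y \<prec> v}|" by (rule small_ordLess_below)
  let ?V = "{y. y \<prec> v}"
  have sub: "|Z| \<le>o |?V|" if "Z \<subseteq> S \<union> A \<union> C" for Z
    using card_of_mono1[OF that] ordLess_imp_ordLeq[OF v] ordLeq_transitive by blast
  have SV: "|S| \<le>o |?V|" and AV: "|A| \<le>o |?V|" and CV: "|C| \<le>o |?V|" by (rule sub, blast)+
  have QV: "|?Q| \<le>o |?V|" by (rule ordIso_ordLeq_trans[OF C CV])
  have Vinf: "infinite ?V" using A(1) card_of_ordLeq_infinite[OF AV] by blast
  \<comment> \<open>\<xi> is |X|, the size of the power set of \<open>?V\<close>, so that |?V|
    itself lies below \<xi>.\<close>
  obtain X :: "'u set" where X: "|Pow ?V| =o |X|" using small_copy[OF small_Pow[OF small_below]] .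
  have sX: "small X" using small_ordLeq[OF small_Pow[OF small_below] ordIso_imp_ordLeq[OF ordIso_symmetric[OF X]]] .
  have VX: "|?V| <o |X|" by (rule ordLess_ordIso_trans[OF card_of_Pow X])
  have "stable_in R K \<mu>"
    if ap: "amalgamation R K" and \<mu>: "cardinal \<mu>"
        "\<mu> =o power_less \<mu> |X| +c sum_double_exp |X|" for \<mu> :: "'u rel"
  proof -
    have \<mu>C: "Card_order \<mu>" and \<mu>s: "\<mu> <o |UNIV :: 'u set|" using \<mu>(1)
        unfolding cardinal_def by blast+
    note bounds = mu_bounds[OF card_of_Card_order VX \<mu>C \<mu>(2)]
    have V\<mu>: "|?V| \<le>o \<mu>"
    proof -
      have "|?V| \<le>o ctwo ^c |?V|"
          by (rule ordLess_imp_ordLeq[OF ordLess_ctwo_cexp[OF card_of_Card_order]])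
      moreover have "ctwo ^c |?V| \<le>o ctwo ^c (ctwo ^c |?V| )"
        by (rule ordLess_imp_ordLeq[OF ordLess_ctwo_cexp[OF Card_order_cexp]])
      ultimately show ?thesis by (rule ordLeq_transitive[OF ordLeq_transitive bounds(2)])
    qed
    have \<mu>i: "Cinfinite \<mu>"
      using cinfinite_mono[OF V\<mu>] Vinf \<mu>C by (simp add: cinfinite_def Field_card_of)
    show ?thesis unfolding stable_in_def
    proof (intro ballI impI, rule ccontr)
      fix M assume M: "M \<in> Models K" "|univ M| =o \<mu>" "\<not> |types_over R K M| \<le>o \<mu>"
      have "\<mu> <o |types_over R K M|"
        using M(3) \<mu>C not_ordLeq_iff_ordLess[OF card_order_on_well_order_on[OF \<mu>C] card_of_Well_order] by blast
      \<comment> \<open>Only a successor cardinal's worth of types is kept: more than \<mu>, yet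
        indexed by a small subset of \<open>'u\<close> as \<open>realize_types\<close>
        requires.\<close>
      then have suc: "cardSuc \<mu> \<le>o |types_over R K M|"
        using cardSuc_ordLess_ordLeq[OF \<mu>C card_of_Card_order] by blast
      have F: "|Field \<mu>| =o \<mu>" by (rule card_of_Field_ordIso[OF \<mu>C])
      have sF: "small (Field \<mu>)" unfolding small_def by (rule ordIso_ordLess_trans[OF F \<mu>s])
      have "\<mu> <o |Pow (Field \<mu>)|"
          by (rule ordIso_ordLess_trans[OF ordIso_symmetric[OF F] card_of_Pow])
      then have "cardSuc \<mu> \<le>o |Pow (Field \<mu>)|"
          using cardSuc_ordLess_ordLeq[OF \<mu>C card_of_Card_order] by blast
      moreover have FS: "|Field (cardSuc \<mu>)| =o cardSuc \<mu>"
          by (rule card_of_Field_ordIso[OF cardSuc_Card_order[OF \<mu>C]])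
      ultimately have "|Field (cardSuc \<mu>)| \<le>o |Pow (Field \<mu>)|" using ordIso_ordLeq_trans by blast
      then have sS: "small (Field (cardSuc \<mu>))" by (rule small_ordLeq[OF small_Pow[OF sF]])
      then obtain V1 :: "'u set" where V1: "|Field (cardSuc \<mu>)| =o |V1|" by (rule small_copy)
      have sV1: "small V1"
          by (rule small_ordLeq[OF sS ordIso_imp_ordLeq[OF ordIso_symmetric[OF V1]]])
      have V1s: "|V1| =o cardSuc \<mu>" by (rule ordIso_transitive[OF ordIso_symmetric[OF V1] FS])
      have V1n: "\<not> |V1| \<le>o \<mu>"
      proof
        assume "|V1| \<le>o \<mu>"
        then have "cardSuc \<mu> \<le>o \<mu>" by (rule ordIso_ordLeq_trans[OF ordIso_symmetric[OF V1s]])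
        then show False using cardSuc_greater[OF \<mu>C] not_ordLess_ordLeq by blast
      qed
      then have V1e: "V1 \<noteq> {}" using card_of_empty1[of \<mu>] card_order_on_well_order_on[OF \<mu>C]
          by blast
      have "|V1| \<le>o |types_over R K M|" by (rule ordIso_ordLeq_trans[OF V1s suc])
      then obtain t where t: "inj_on t V1" "t ` V1 \<subseteq> types_over R K M"
          unfolding card_of_ordLeq[symmetric] by blast
      obtain N where N: "sleq K M N" "\<forall>i \<in> V1. \<exists>b \<in> univ N. t i = ortp R K b (univ M) N"
        using realize_types[OF aec ap M(1) sV1 V1e, of t] t(2) by blast
      then obtain r where r: "\<And>i. i \<in> V1 \<Longrightarrow> r i \<in> univ N" "\<And>i. i \<in> V1 \<Longrightarrow>
          t i = ortp R K (r i) (univ M) N" by metis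
      have NK: "N \<in> Models K" by (rule AEC_D(6)[OF aec N(1)])
      have MN: "univ M \<subseteq> univ N" by (rule sleq_univ[OF aec N(1)])
      have "inj_on r V1" using t(1) r(2) by (auto simp: inj_on_def)
      then have "|V1| \<le>o |r ` V1|" unfolding card_of_ordLeq[symmetric] by blast
      then have rn: "\<not> |r ` V1| \<le>o \<mu>" using V1n ordLeq_transitive by blast
      have Y: "|Func A (univ M)| \<le>o \<mu>"
      proof -
        have "|univ M| ^c |A| \<le>o \<mu> ^c |?V|"
        proof (rule cexp_mono[OF ordIso_imp_ordLeq[OF M(2)] AV _ card_of_Card_order])
          have "A \<noteq> {}" using A(1) by auto
          then show "|A| =o (czero :: 'z rel) \<Longrightarrow> |?V| =o (czero :: 'z rel)"
        by (simp add: card_of_ordIso_czero_iff_empty)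
        qed
        then show ?thesis unfolding card_Func_cexp using bounds(1) ordLeq_transitive by blast
      qed
      have "\<exists>c a b. (\<forall>i \<in> ?V. c i \<in> r ` V1 \<and> a i \<in> Func A (univ M) \<and> b i \<in> Func A (univ M)) \<and>
        (\<forall>i \<in> ?V. \<forall>j \<in> ?V. j \<prec> i \<longrightarrow> tuple_type N (c j) (a i) = tuple_type N (c j) (b i)) \<and>
        (\<forall>i \<in> ?V. \<forall>j \<in> ?V. \<not> i \<prec> j \<longrightarrow> tuple_type N (c i) (a j) \<noteq> tuple_type N (c i) (b j))"
      proof (rule half_graph[OF \<mu>i _ bounds(1) _ ordLeq_transitive[OF QV V\<mu>] Y rn])
        show "?V \<noteq> {}" using Vinf by (metis finite.emptyI)
        show "|Func (Func ?V ?Q) ?Q| \<le>o \<mu>"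
          by (rule ordLeq_transitive[OF card_Func_Func[OF Vinf QV] bounds(2)]) blast
        show "tuple_type N x y \<in> ?Q" for x y unfolding tuple_type_def by blast
        fix x x' assume x: "x \<in> r ` V1" "x' \<in> r ` V1" "x \<noteq> x'"
        then obtain i j where ij: "i \<in> V1" "j \<in> V1" "x = r i" "x' = r j" "i \<noteq> j" by blast
        then have "t i \<noteq> t j" using t(1) by (auto dest: inj_onD)
        then show "\<exists>y \<in> Func A (univ M). tuple_type N x y \<noteq> tuple_type N x' y"
          unfolding ij(3,4) using ortp_separated[OF loc N(1) r(1)[OF ij(1)] r(1)[OF ij(2)]] r(2) ij(1,2) by simp
      qed
      then obtain c a b where H: "\<forall>i \<in> ?V. c i \<in> r ` V1 \<and> a i \<in> Func A (univ M) \<and>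
          b i \<in> Func A (univ M)"
        "\<forall>i \<in> ?V. \<forall>j \<in> ?V. j \<prec> i \<longrightarrow> tuple_type N (c j) (a i) = tuple_type N (c j) (b i)"
        "\<forall>i \<in> ?V. \<forall>j \<in> ?V. \<not> i \<prec> j \<longrightarrow> tuple_type N (c i) (a j) \<noteq> tuple_type N (c i) (b j)"
        by (elim exE conjE) (rule that)
      have cab: "c i \<in> r ` V1" "a i \<in> Func A (univ M)" "b i \<in> Func A (univ M)" if "i \<in> ?V" for i
        using H(1) that by blast+
      show False
      proof (rule no_half_graph[OF _ NK SV, of c a b])
        show "\<exists>i \<in> W. \<exists>j \<in> W. i \<prec> j \<and> swapped N (e i) (e j)"
          if "N \<in> Models K" "|S| \<le>o |W|" "\<And>i a. i \<in> W \<Longrightarrow> a \<in> A \<Longrightarrow> e i a \<in> univ N" for N W e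
          using S(2) that by simp
        show "c i \<in> univ N" if "i \<in> ?V" for i using cab(1)[OF that] r(1) by auto
        show "a i z \<in> univ N" if "i \<in> ?V" "z \<in> A" for i z
          using cab(2)[OF that(1)] that(2) MN unfolding Func_def by blast
        show "b i z \<in> univ N" if "i \<in> ?V" "z \<in> A" for i z
          using cab(3)[OF that(1)] that(2) MN unfolding Func_def by blast
        show "tuple_type N (c i) (a j) = tuple_type N (c i) (b j)" if "i \<in> ?V" "j \<in> ?V" "i \<prec> j"
            for i j
          by (rule H(2)[rule_format, OF that(2,1,3)])
        show "tuple_type N (c j) (a i) \<noteq> tuple_type N (c j) (b i)" if "i \<in> ?V" "j \<in> ?V" "i \<prec> j"
            for i j
          by (rule H(3)[rule_format, OF that(2,1) lt_asym[OF that(3)]])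
      qed
    qed
  qed
  moreover have "cardinal |X|" unfolding cardinal_def using card_of_Card_order sX
      unfolding small_def by blast
  moreover have "|A| <o |X|" by (rule ordLeq_ordLess_trans[OF AV VX])
  ultimately show ?thesis by blast
qed

end

theorem theorem1p3:
  fixes R :: "('r, 'x) ring_scheme"
    and K :: "('r, 'u) abstract_class"
    and \<kappa> LS :: "'u rel"
  assumes "set_universe TYPE('u)"
    and "ring R"
    and "AEC_of_modules R K"
    and "is_LS R K LS"
    and "cardinal \<kappa>" and "LS \<le>o \<kappa>"
    and "is_local R K \<kappa>"
  shows "\<exists>\<xi> :: 'u rel. cardinal \<xi> \<and> \<kappa> <o \<xi> \<and>
    (\<forall>\<mu> :: 'u rel. cardinal \<mu> \<and> \<mu> =o power_less \<mu> \<xi> +c sum_double_exp \<xi> \<longrightarrow>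
       almost_stable_in R K \<mu>) \<and>
    (amalgamation R K \<longrightarrow>
       (\<forall>\<mu> :: 'u rel. cardinal \<mu> \<and> \<mu> =o power_less \<mu> \<xi> +c sum_double_exp \<xi> \<longrightarrow>
          stable_in R K \<mu>))"
proof -
  \<comment> \<open>The field of \<kappa> has size \<kappa>. As \<kappa> is infinite and at least
    the Loewenheim-Skolem number, sets of at most that size lie in submodels of at most that
    size.\<close>
  let ?A = "Field \<kappa>"
  have \<kappa>: "Card_order \<kappa>" "\<kappa> <o |UNIV :: 'u set|" using assms(5) unfolding cardinal_def by blast+
  have A\<kappa>: "|?A| =o \<kappa>" by (rule card_of_Field_ordIso[OF \<kappa>(1)])
  have LS: "cardinal LS" "cinfinite LS" "|carrier R| \<le>o LS"
    "\<And>M X. M \<in> Models K \<Longrightarrow> X \<subseteq> univ M \<Longrightarrow> \<exists>M0. sleq K M0 M \<and> X \<subseteq> univ M0 \<and> |univ M0| \<le>o |X| +c LS"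
    using assms(4) unfolding is_LS_def ls_candidate_def by blast+
  have \<kappa>i: "Cinfinite \<kappa>" using cinfinite_mono[OF assms(6) LS(2)] \<kappa>(1) by blast
  have aec: "AEC R K" and mods: "\<forall>M \<in> Models K. left_module R M"
    using assms(3) unfolding AEC_of_modules_def by blast+
  interpret module_aec "TYPE('u)" R K ?A
  proof unfold_locales
    show "set_universe TYPE('u)" by (rule assms(1))
    show "AEC R K" by (rule aec)
    show "left_module R M" if "M \<in> Models K" for M using mods that by blast
    show "infinite ?A" using \<kappa>i unfolding cinfinite_def by blast
    show "small_set TYPE('u) ?A" unfolding small_set_def by (rule ordIso_ordLess_trans[OF A\<kappa> \<kappa>(2)])
    show "small_set TYPE('u) (carrier R)" unfolding small_set_def
      by (rule ordLeq_ordLess_trans[OF ordLeq_transitive[OF LS(3) assms(6)] \<kappa>(2)])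
    show "\<exists>M0. sleq K M0 M \<and> X \<subseteq> univ M0 \<and> |univ M0| \<le>o |?A|"
      if M: "M \<in> Models K" "X \<subseteq> univ M" "|X| \<le>o |?A|" for M X
    proof -
      obtain M0 where M0: "sleq K M0 M" "X \<subseteq> univ M0" "|univ M0| \<le>o |X| +c LS"
          using LS(4)[OF M(1,2)] by blast
      have "Card_order LS" using LS(1) unfolding cardinal_def by blast
      then have "|X| +c LS \<le>o \<kappa>"
        by (rule csum_cinfinite_bound[OF ordLeq_ordIso_trans[OF M(3) A\<kappa>] assms(6) card_of_Card_order _ \<kappa>i])
      then have "|univ M0| \<le>o |?A|"
        by (rule ordLeq_ordIso_trans[OF ordLeq_transitive[OF M0(3)] ordIso_symmetric[OF A\<kappa>]])
      then show ?thesis using M0(1,2) by blast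
    qed
  qed
  have le_\<kappa>: "|X| \<le>o \<kappa> \<longleftrightarrow> |X| \<le>o |?A|" for X :: "'u set"
    using ordLeq_ordIso_trans[of "|X|" \<kappa> "|?A|"] ordLeq_ordIso_trans[of "|X|" "|?A|" \<kappa>]
      A\<kappa> ordIso_symmetric[OF A\<kappa>] by blast
  have "is_local R K |?A|"
    using assms(7) unfolding is_local_def le_\<kappa> .
  from stable_if_amalgamation[OF this] obtain \<xi> :: "'u rel" where \<xi>: "cardinal \<xi>" "|?A| <o \<xi>"
    "amalgamation R K \<longrightarrow>
    (\<forall>\<mu> :: 'u rel. cardinal \<mu> \<and> \<mu> =o power_less \<mu> \<xi> +c sum_double_exp \<xi> \<longrightarrow> stable_in R K \<mu>)" by blast
  have "\<kappa> <o \<xi>" by (rule ordIso_ordLess_trans[OF ordIso_symmetric[OF A\<kappa>] \<xi>(2)])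
  then show ?thesis using \<xi>(1,3) almost_stable_trivial by blast
qed

end
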